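(* Let $k\geq 0$ and suppose that the positive function $f:\mathbb{T}^d\to\mathbb{R}$ has finite norm $\|f\|_{U^{k+1}(\mathbb{T}^d)}$. Then the measure $d\mu=f\,dx$ satisfies $$\|\mu\|_{U^{k+1}}=\|f\|_{U^{k+1}(\mathbb{T}^d)},$$ and the finite measure $\Delta^{k+1}\mu$ exists, is absolutely continuous with respect to Lebesgue measure on $\mathbb{T}^{d(k+2)}$, and has density given by $\Delta^{k+1}f$.
   Context: $\mathbb{T}=\mathbb{R}/\mathbb{Z}$, $d\ge1$; functions are measurable. Gowers norms of functions: $\Delta^0f(x):=f(x)$ and inductively, for $x\in\mathbb{T}^d$, $u=(u_1,\dots,u_{k+1})\in(\mathbb{T}^d)^{k+1}$, $u'=(u_1,\dots,u_k)$, $\Delta^{k+1}f(x;u):=\Delta^kf(x;u')\,\overline{\Delta^kf(x-u_{k+1};u')}$; and $\|f\|_{U^k(\mathbb{T}^d)}^{2^k}:=\int_{\mathbb{T}^d\times(\mathbb{T}^{d})^k}\Delta^kf(x;u)\,dx\,du$. Gowers norms of measures: $\overline{\nu}$ is the complex conjugate of a finite complex Radon measure $\nu$. On each $\mathbb{T}^d\times\mathbb{T}^r$ ($r\ge0$) an approximate identity $(\phi_n)_{n\in\mathbb{N}}$ is fixed: nonnegative continuous functions with $\int\phi_n=1$ whose integrals outside any fixed neighbourhood of $0$ tend to $0$. For complex Radon measures $\nu_0,\nu_1$ on $\mathbb{T}^d\times\mathbb{T}^r$ set $$T[\nu_0,\nu_1]:=\lim_{n\to\infty}\int (\phi_n*\overline{\nu_1})(x-u_{r+1};u')\,d\nu_0(x;u')\,du_{r+1},\qquad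 x,u_{r+1}\in\mathbb{T}^d,\ u'\in\mathbb{T}^r.$$ The measure $\Delta(\nu_0,\nu_1)$ on $\mathbb{T}^d\times\mathbb{T}^r\times\mathbb{T}^d$ is defined by $$\int F\,d\Delta(\nu_0,\nu_1):=\lim_{n\to\infty}\int F(x;u',u_{r+1})\,(\phi_n*\overline{\nu_1})(x-u_{r+1};u')\,d\nu_0(x;u')\,du_{r+1}\quad\text{for all continuous }F;$$ it is said to exist if these limits exist and define a finite Radon measure. For a measure $\mu$ on $\mathbb{T}^d$: $\Delta^0\mu:=\mu$, $\Delta^{k+1}\mu:=\Delta(\Delta^k\mu,\Delta^k\mu)$ (so $\Delta^k\mu$ is a measure on $\mathbb{T}^d\times\mathbb{T}^{dk}$), and $\|\mu\|_{U^{k+1}}:=(T[\Delta^k\mu,\Delta^k\mu])^{1/2^{k+1}}$ if $\Delta^k\mu$ exists, $\infty$ otherwise. *)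

theory Defs
  imports "HOL-Analysis.Analysis"
begin

quotient_type rmodz = real / "\<lambda>x y. x - y \<in> (\<int> :: real set)"
  morphisms rep_rmodz to_rmodz
proof (rule equivpI)
  show "reflp (\<lambda>x y. x - y \<in> (\<int> :: real set))"
    by (simp add: reflp_def)
  show "symp (\<lambda>x y. x - y \<in> (\<int> :: real set))"
    by (metis (no_types, lifting) Ints_minus minus_diff_eq sympI)
  show "transp (\<lambda>x y. x - y \<in> (\<int> :: real set))"
  proof (rule transpI)
    fix x y z :: real
    assume "x - y \<in> \<int>" "y - z \<in> \<int>"
    then have "(x - y) + (y - z) \<in> \<int>" by (rule Ints_add)
    then show "x - z \<in> \<int>" by simp
  qed
qed

instantiation rmodz :: ab_group_add
begin

lift_definition zero_rmodz :: rmodz is 0 .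

lift_definition plus_rmodz :: "rmodz \<Rightarrow> rmodz \<Rightarrow> rmodz" is "(+)"
proof -
  fix a b c d :: real
  assume "a - b \<in> \<int>" "c - d \<in> \<int>"
  then have "(a - b) + (c - d) \<in> \<int>" by (rule Ints_add)
  then show "a + c - (b + d) \<in> \<int>" by (simp add: algebra_simps)
qed

lift_definition minus_rmodz :: "rmodz \<Rightarrow> rmodz \<Rightarrow> rmodz" is "(-)"
proof -
  fix a b c d :: real
  assume "a - b \<in> \<int>" "c - d \<in> \<int>"
  then have "(a - b) - (c - d) \<in> \<int>" by (rule Ints_diff)
  then show "a - c - (b - d) \<in> \<int>" by (simp add: algebra_simps)
qed

lift_definition uminus_rmodz :: "rmodz \<Rightarrow> rmodz" is "uminus"
proof -
  fix a b :: real
  assume "a - b \<in> \<int>"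
  then have "- (a - b) \<in> \<int>" by (rule Ints_minus)
  then show "- a - - b \<in> \<int>" by (simp add: algebra_simps)
qed

instance
  by standard (transfer; simp add: algebra_simps)+

end

instantiation rmodz :: topological_space
begin

definition open_rmodz :: "rmodz set \<Rightarrow> bool" where
  "open_rmodz U \<longleftrightarrow> open (to_rmodz -` U)"

instance
  by standard (auto simp: open_rmodz_def vimage_Union vimage_Int)

end

definition haar_rmodz :: "rmodz measure" where
  "haar_rmodz = distr (restrict_space lborel {0..<1}) borel to_rmodz"

text \<open>
  A point of the \<open>n\<close>-dimensional torus is an extensional function on \<open>{..<n}\<close>; the topology is
  the subspace topology of the function space, i.e. the product topology.  The product of
  \<open>d\<close>-dimensional and \<open>r\<close>-dimensional tori is identified with the \<open>(d + r)\<close>-dimensional one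
  by concatenating coordinates.
\<close>

definition torus :: "nat \<Rightarrow> (nat \<Rightarrow> rmodz) set" where
  "torus n = {..<n} \<rightarrow>\<^sub>E UNIV"

definition torus_borel :: "nat \<Rightarrow> (nat \<Rightarrow> rmodz) measure" where
  "torus_borel n = (\<Pi>\<^sub>M i\<in>{..<n}. borel)"

definition torus_leb :: "nat \<Rightarrow> (nat \<Rightarrow> rmodz) measure" where
  "torus_leb n = completion (\<Pi>\<^sub>M i\<in>{..<n}. haar_rmodz)"

definition torus_zero :: "nat \<Rightarrow> nat \<Rightarrow> rmodz" where
  "torus_zero n = (\<lambda>i\<in>{..<n}. 0)"

definition torus_diff :: "nat \<Rightarrow> (nat \<Rightarrow> rmodz) \<Rightarrow> (nat \<Rightarrow> rmodz) \<Rightarrow> nat \<Rightarrow> rmodz" where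
  "torus_diff n z w = (\<lambda>i\<in>{..<n}. z i - w i)"

definition torus_append ::
    "nat \<Rightarrow> nat \<Rightarrow> (nat \<Rightarrow> rmodz) \<Rightarrow> (nat \<Rightarrow> rmodz) \<Rightarrow> nat \<Rightarrow> rmodz" where
  "torus_append n d z v = (\<lambda>i\<in>{..<n + d}. if i < n then z i else v (i - n))"

text \<open>The map \<open>((x; u'), v) \<mapsto> (x - v; u')\<close>, where \<open>x\<close> is the block of the first \<open>d\<close> coordinates.\<close>

definition torus_shift ::
    "nat \<Rightarrow> nat \<Rightarrow> (nat \<Rightarrow> rmodz) \<Rightarrow> (nat \<Rightarrow> rmodz) \<Rightarrow> nat \<Rightarrow> rmodz" where
  "torus_shift d n z v = (\<lambda>i\<in>{..<n}. if i < d then z i - v i else z i)"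

definition torus_block :: "nat \<Rightarrow> nat \<Rightarrow> (nat \<Rightarrow> rmodz) \<Rightarrow> nat \<Rightarrow> rmodz" where
  "torus_block d j z = (\<lambda>i\<in>{..<d}. z (d * j + i))"


section \<open>Gowers norms of functions\<close>

text \<open>Here \<open>u j\<close> is the vector written \<open>u\<close> with index \<open>j + 1\<close> in the usual notation.\<close>

primrec gowers_diff ::
    "nat \<Rightarrow> ((nat \<Rightarrow> rmodz) \<Rightarrow> complex) \<Rightarrow> nat \<Rightarrow> (nat \<Rightarrow> rmodz) \<Rightarrow> (nat \<Rightarrow> nat \<Rightarrow> rmodz) \<Rightarrow> complex"
  where
    "gowers_diff d f 0 x u = f x"
  | "gowers_diff d f (Suc k) x u =
       gowers_diff d f k x u * cnj (gowers_diff d f k (torus_diff d x (u k)) u)"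

text \<open>
  The same function on the \<open>d * (k + 1)\<close>-dimensional torus, \<open>z\<close> being the concatenation of
  \<open>x\<close>, \<open>u 0\<close>, ..., \<open>u (k - 1)\<close>.
\<close>

definition gowers_diff_flat ::
    "nat \<Rightarrow> ((nat \<Rightarrow> rmodz) \<Rightarrow> complex) \<Rightarrow> nat \<Rightarrow> (nat \<Rightarrow> rmodz) \<Rightarrow> complex" where
  "gowers_diff_flat d f k z =
     gowers_diff d f k (torus_block d 0 z) (\<lambda>j. torus_block d (Suc j) z)"

text \<open>
  The integral is a nonnegative real number for \<open>k \<ge> 1\<close>.  For nonnegative measurable \<open>f\<close>,
  failure of integrability means exactly that the integral is infinite.
\<close>

definition gowers_norm_fun :: "nat \<Rightarrow> nat \<Rightarrow> ((nat \<Rightarrow> rmodz) \<Rightarrow> complex) \<Rightarrow> ennreal" where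
  "gowers_norm_fun d k f =
     (if integrable (torus_leb (d * (k + 1))) (gowers_diff_flat d f k)
      then ennreal (root (2 ^ k) (Re (LINT z|torus_leb (d * (k + 1)). gowers_diff_flat d f k z)))
      else \<infinity>)"


section \<open>Finite complex measures\<close>

text \<open>
  Set functions on the sigma-algebra of \<open>M\<close>, extended by \<open>0\<close> so that equality of measures is
  equality of functions.  Boundedness, which spells out finiteness, is implied by countable
  additivity.  On \<open>torus_borel n\<close> these are the finite complex Radon measures, since a finite
  Borel measure on a compact metrizable space is Radon.
\<close>

definition complex_measure :: "'a measure \<Rightarrow> ('a set \<Rightarrow> complex) \<Rightarrow> bool" where
  "complex_measure M \<nu> \<longleftrightarrow>
     (\<forall>A. A \<notin> sets M \<longrightarrow> \<nu> A = 0) \<and>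
     bounded (range \<nu>) \<and>
     (\<forall>A :: nat \<Rightarrow> 'a set. range A \<subseteq> sets M \<longrightarrow> disjoint_family A \<longrightarrow>
        (\<lambda>i. \<nu> (A i)) sums \<nu> (\<Union>i. A i))"

text \<open>
  The positive part in the Jordan decomposition of a signed measure (\<open>ennreal\<close> sends negative
  reals to \<open>0\<close>); the negative part of \<open>\<sigma>\<close> is the positive part of \<open>- \<sigma>\<close>.
\<close>

definition positive_part :: "'a measure \<Rightarrow> ('a set \<Rightarrow> real) \<Rightarrow> 'a measure" where
  "positive_part M \<sigma> =
     measure_of (space M) (sets M) (\<lambda>A. SUP B\<in>{B \<in> sets M. B \<subseteq> A}. ennreal (\<sigma> B))"

definition complex_integral ::
    "'a measure \<Rightarrow> ('a set \<Rightarrow> complex) \<Rightarrow> ('a \<Rightarrow> complex) \<Rightarrow> complex" where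
  "complex_integral M \<nu> F =
     (LINT z|positive_part M (\<lambda>A. Re (\<nu> A)). F z) - (LINT z|positive_part M (\<lambda>A. - Re (\<nu> A)). F z)
     + \<i> * ((LINT z|positive_part M (\<lambda>A. Im (\<nu> A)). F z)
            - (LINT z|positive_part M (\<lambda>A. - Im (\<nu> A)). F z))"

text \<open>The measure \<open>g dz\<close>, for an integrable function \<open>g\<close> on the torus.\<close>

definition torus_density ::
    "nat \<Rightarrow> ((nat \<Rightarrow> rmodz) \<Rightarrow> complex) \<Rightarrow> (nat \<Rightarrow> rmodz) set \<Rightarrow> complex" where
  "torus_density n g A =
     (if A \<in> sets (torus_borel n) then (LINT z:A|torus_leb n. g z) else 0)"


section \<open>Gowers norms of measures\<close>

definition approximate_identity :: "nat \<Rightarrow> (nat \<Rightarrow> (nat \<Rightarrow> rmodz) \<Rightarrow> real) \<Rightarrow> bool" where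
  "approximate_identity n \<phi> \<longleftrightarrow>
     (\<forall>j. continuous_on (torus n) (\<phi> j) \<and> (\<forall>z\<in>torus n. 0 \<le> \<phi> j z) \<and>
          (LINT z|torus_leb n. \<phi> j z) = 1) \<and>
     (\<forall>U. open U \<longrightarrow> torus_zero n \<in> U \<longrightarrow>
          (\<lambda>j. LINT z:(torus n - U)|torus_leb n. \<phi> j z) \<longlonglongrightarrow> 0)"

definition torus_convolution ::
    "nat \<Rightarrow> ((nat \<Rightarrow> rmodz) \<Rightarrow> real) \<Rightarrow> ((nat \<Rightarrow> rmodz) set \<Rightarrow> complex) \<Rightarrow> (nat \<Rightarrow> rmodz) \<Rightarrow> complex"
  where
    "torus_convolution n \<phi> \<nu> z =
       complex_integral (torus_borel n) \<nu> (\<lambda>w. complex_of_real (\<phi> (torus_diff n z w)))"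

text \<open>In what follows \<open>\<nu>0\<close>, \<open>\<nu>1\<close> are measures and \<open>\<phi> j\<close> functions on the \<open>(d + r)\<close>-dimensional torus.\<close>

definition delta_approx ::
    "nat \<Rightarrow> nat \<Rightarrow> (nat \<Rightarrow> (nat \<Rightarrow> rmodz) \<Rightarrow> real) \<Rightarrow>
     ((nat \<Rightarrow> rmodz) set \<Rightarrow> complex) \<Rightarrow> ((nat \<Rightarrow> rmodz) set \<Rightarrow> complex) \<Rightarrow>
     ((nat \<Rightarrow> rmodz) \<Rightarrow> complex) \<Rightarrow> nat \<Rightarrow> complex" where
  "delta_approx d r \<phi> \<nu>0 \<nu>1 F j =
     complex_integral (torus_borel (d + r)) \<nu>0
       (\<lambda>z. LINT v|torus_leb d.
          F (torus_append (d + r) d z v) *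
          torus_convolution (d + r) (\<phi> j) (\<lambda>A. cnj (\<nu>1 A)) (torus_shift d (d + r) z v))"

text \<open>The sequence whose limit is \<open>T[\<nu>0, \<nu>1]\<close>.\<close>

definition T_approx ::
    "nat \<Rightarrow> nat \<Rightarrow> (nat \<Rightarrow> (nat \<Rightarrow> rmodz) \<Rightarrow> real) \<Rightarrow>
     ((nat \<Rightarrow> rmodz) set \<Rightarrow> complex) \<Rightarrow> ((nat \<Rightarrow> rmodz) set \<Rightarrow> complex) \<Rightarrow> nat \<Rightarrow> complex" where
  "T_approx d r \<phi> \<nu>0 \<nu>1 j =
     complex_integral (torus_borel (d + r)) \<nu>0
       (\<lambda>z. LINT v|torus_leb d.
          torus_convolution (d + r) (\<phi> j) (\<lambda>A. cnj (\<nu>1 A)) (torus_shift d (d + r) z v))"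

definition is_delta ::
    "nat \<Rightarrow> nat \<Rightarrow> (nat \<Rightarrow> (nat \<Rightarrow> rmodz) \<Rightarrow> real) \<Rightarrow>
     ((nat \<Rightarrow> rmodz) set \<Rightarrow> complex) \<Rightarrow> ((nat \<Rightarrow> rmodz) set \<Rightarrow> complex) \<Rightarrow>
     ((nat \<Rightarrow> rmodz) set \<Rightarrow> complex) \<Rightarrow> bool" where
  "is_delta d r \<phi> \<nu>0 \<nu>1 \<rho> \<longleftrightarrow>
     complex_measure (torus_borel (d + r + d)) \<rho> \<and>
     (\<forall>F. continuous_on (torus (d + r + d)) F \<longrightarrow>
        delta_approx d r \<phi> \<nu>0 \<nu>1 F \<longlonglongrightarrow> complex_integral (torus_borel (d + r + d)) \<rho> F)"

definition delta_measure ::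
    "nat \<Rightarrow> nat \<Rightarrow> (nat \<Rightarrow> (nat \<Rightarrow> rmodz) \<Rightarrow> real) \<Rightarrow>
     ((nat \<Rightarrow> rmodz) set \<Rightarrow> complex) \<Rightarrow> ((nat \<Rightarrow> rmodz) set \<Rightarrow> complex) \<Rightarrow>
     (nat \<Rightarrow> rmodz) set \<Rightarrow> complex" where
  "delta_measure d r \<phi> \<nu>0 \<nu>1 = (THE \<rho>. is_delta d r \<phi> \<nu>0 \<nu>1 \<rho>)"

text \<open>From here on, \<open>\<phi> r\<close> is the approximate identity fixed on the \<open>(d + r)\<close>-dimensional torus.\<close>

primrec delta_power ::
    "nat \<Rightarrow> (nat \<Rightarrow> nat \<Rightarrow> (nat \<Rightarrow> rmodz) \<Rightarrow> real) \<Rightarrow> ((nat \<Rightarrow> rmodz) set \<Rightarrow> complex) \<Rightarrow> nat \<Rightarrow>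
     (nat \<Rightarrow> rmodz) set \<Rightarrow> complex" where
  "delta_power d \<phi> \<mu> 0 = \<mu>"
| "delta_power d \<phi> \<mu> (Suc k) =
     delta_measure d (d * k) (\<phi> (d * k)) (delta_power d \<phi> \<mu> k) (delta_power d \<phi> \<mu> k)"

primrec delta_power_exists ::
    "nat \<Rightarrow> (nat \<Rightarrow> nat \<Rightarrow> (nat \<Rightarrow> rmodz) \<Rightarrow> real) \<Rightarrow> ((nat \<Rightarrow> rmodz) set \<Rightarrow> complex) \<Rightarrow> nat \<Rightarrow> bool"
  where
    "delta_power_exists d \<phi> \<mu> 0 \<longleftrightarrow> complex_measure (torus_borel d) \<mu>"
  | "delta_power_exists d \<phi> \<mu> (Suc k) \<longleftrightarrow>
       delta_power_exists d \<phi> \<mu> k \<and>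
       (\<exists>\<rho>. is_delta d (d * k) (\<phi> (d * k)) (delta_power d \<phi> \<mu> k) (delta_power d \<phi> \<mu> k) \<rho>)"

text \<open>
  The norm with index \<open>k + 1\<close>.  The limit \<open>T\<close>, when it exists, is a nonnegative real number; the
  norm is also infinite if it does not exist (as a finite number).
\<close>

definition gowers_norm_measure_Suc ::
    "nat \<Rightarrow> (nat \<Rightarrow> nat \<Rightarrow> (nat \<Rightarrow> rmodz) \<Rightarrow> real) \<Rightarrow> nat \<Rightarrow> ((nat \<Rightarrow> rmodz) set \<Rightarrow> complex) \<Rightarrow> ennreal"
  where
    "gowers_norm_measure_Suc d \<phi> k \<mu> =
       (let T = T_approx d (d * k) (\<phi> (d * k)) (delta_power d \<phi> \<mu> k) (delta_power d \<phi> \<mu> k)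
        in if delta_power_exists d \<phi> \<mu> k \<and> convergent T
           then ennreal (root (2 ^ (k + 1)) (Re (lim T)))
           else \<infinity>)"

end

theory Submission
  imports Defs "HOL-Probability.Infinite_Product_Measure"
begin

text \<open>
  Write \<open>g\<^sub>j = \<Delta>\<^sup>j f\<close>, a nonnegative function of \<open>(x; u')\<close>, and \<open>H\<^sub>j(u') = \<integral> g\<^sub>j(x; u') dx\<close>.  Integrating
  \<open>g\<^sub>j\<^sub>+\<^sub>1(x; u', v) = g\<^sub>j(x; u') g\<^sub>j(x - v; u')\<close> over \<open>v\<close> and then over \<open>x\<close> gives
  \<open>\<integral> g\<^sub>j\<^sub>+\<^sub>1 = \<integral> H\<^sub>j\<^sup>2\<close>, so integrability descends from \<open>g\<^sub>k\<^sub>+\<^sub>1\<close> to all \<open>g\<^sub>j\<close> with \<open>j \<le> k\<close>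
  (\<open>integrable_real_gowers_diff_downward\<close>).  Going up again, everything reduces to one step
  (\<open>is_delta_density\<close>): if \<open>g \<ge> 0\<close> and \<open>G(x; u', v) = g(x; u') g(x - v; u')\<close> is integrable, then the
  difference of \<open>g dz\<close> with itself exists and is \<open>G\<close> times Lebesgue measure.  Since
  test functions are bounded, it suffices that
  \<open>A\<^sub>n(x; u', v) = g(x; u') (\<phi>\<^sub>n * g)(x - v; u')\<close> converges to \<open>G\<close> in \<open>L\<^sup>1\<close>
  (\<open>smoothed_correlation_tends_L1\<close>).

  Convergence \<open>\<phi>\<^sub>n * g \<rightarrow> g\<close> in \<open>L\<^sup>1\<close> (\<open>smoothing_tends_L1\<close>) settles this only where the factor
  \<open>g(x; u')\<close> is bounded.  For the rest, note that \<open>\<integral> A\<^sub>n\<close> is the average, with weight \<open>\<phi>\<^sub>n\<close>, of the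
  integrals \<open>\<integral> H(u') H(u' - w') du'\<close>, each of which is at most \<open>\<integral> H\<^sup>2 = \<integral> G\<close> because
  \<open>2ab \<le> a\<^sup>2 + b\<^sup>2\<close>.  From \<open>\<integral> A\<^sub>n \<le> \<integral> G\<close> and \<open>\<bar>A\<^sub>n - G\<bar> = (A\<^sub>n - G) + 2 (G - A\<^sub>n)\<^sup>+\<close> it follows that only
  \<open>\<integral> (G - A\<^sub>n)\<^sup>+\<close> has to tend to \<open>0\<close>.  Now \<open>(G - A\<^sub>n)\<^sup>+ \<le> G\<close>, so the part where \<open>g(x; u') > L\<close> is small
  uniformly in \<open>n\<close> once \<open>L\<close> is large, and where \<open>g(x; u') \<le> L\<close> the integrand is at most
  \<open>L \<bar>\<phi>\<^sub>n * g - g\<bar>(x - v; u')\<close>.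

  The same device gives \<open>\<phi>\<^sub>n * g \<rightarrow> g\<close> in \<open>L\<^sup>1\<close>: if \<open>U\<close> is an open box, \<open>\<phi>\<^sub>n * 1\<^sub>U\<close> has the integral of \<open>1\<^sub>U\<close>
  and \<open>(1\<^sub>U - \<phi>\<^sub>n * 1\<^sub>U)\<^sup>+\<close> tends to \<open>0\<close> at each point; a Dynkin class argument and approximation in
  \<open>L\<^sup>1\<close> extend this to all integrable functions.

  Two further points concern the definitions.  The difference of two measures is defined by
  description, so its identification needs that a complex measure is determined by
  its integrals of continuous functions (\<open>complex_measure_eqI_continuous\<close>); integrals against a
  complex measure are in turn defined by Jordan decompositions.  And \<open>f\<close> is Lebesgue rather than Borel
  measurable; it is replaced by a Borel function equal to it almost everywhere, which
  changes \<open>\<Delta>\<^sup>j f\<close> only on a null set (\<open>gowers_diff_flat_cong_AE\<close>).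
\<close>

section \<open>The topology of the circle\<close>

lemma to_rmodz_eq_iff: "to_rmodz x = to_rmodz y \<longleftrightarrow> x - y \<in> \<int>"
  by (fact rmodz.abs_eq_iff)

lemma to_rmodz_rep [simp]: "to_rmodz (rep_rmodz t) = t"
  by (rule Quotient3_abs_rep[OF Quotient3_rmodz])

lemma to_rmodz_diff: "to_rmodz x - to_rmodz y = to_rmodz (x - y)"
  by (fact minus_rmodz.abs_eq)

lemma to_rmodz_of_int_add: "to_rmodz (x + of_int m) = to_rmodz x"
  by (simp add: to_rmodz_eq_iff)

lemma continuous_to_rmodz: "continuous_on UNIV to_rmodz"
  by (simp add: continuous_on_open_vimage open_rmodz_def)

text \<open>
  The full preimage of the image of \<open>U\<close> is the union of the integer translates of \<open>U\<close>.
\<close>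

lemma open_to_rmodz_image:
  assumes "open U"
  shows "open (to_rmodz ` U)"
proof -
  have "to_rmodz -` (to_rmodz ` U) = (\<Union>m::int. (+) (of_int m) ` U)"
  proof (intro equalityI subsetI)
    fix x assume "x \<in> to_rmodz -` (to_rmodz ` U)"
    then obtain y where y: "y \<in> U" "x - y \<in> \<int>" by (auto simp: to_rmodz_eq_iff)
    from y(2) obtain m where "x - y = of_int m" by (auto elim: Ints_cases)
    then have "x = of_int m + y" by simp
    with y(1) show "x \<in> (\<Union>m::int. (+) (of_int m) ` U)" by blast
  next
    fix x assume "x \<in> (\<Union>m::int. (+) (of_int m) ` U)"
    then obtain m y where "y \<in> U" "x = of_int m + y" by auto
    then show "x \<in> to_rmodz -` (to_rmodz ` U)"
      by (auto intro!: image_eqI[where x = y] simp: to_rmodz_eq_iff)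
  qed
  moreover have "open (\<Union>m::int. (+) (of_int m) ` U)"
    using assms by (intro open_UN ballI open_translation)
  ultimately show ?thesis by (simp add: open_rmodz_def)
qed

instance rmodz :: second_countable_topology
proof
  obtain B :: "real set set" where B: "countable B" "topological_basis B"
    using ex_countable_basis by blast
  have "topological_basis ((`) to_rmodz ` B)"
    unfolding topological_basis_def
  proof (intro conjI ballI allI impI)
    show "open U" if "U \<in> (`) to_rmodz ` B" for U
      using that B(2) by (auto intro!: open_to_rmodz_image topological_basis_open)
  next
    fix U :: "rmodz set" assume "open U"
    then have "open (to_rmodz -` U)" by (simp add: open_rmodz_def)
    then obtain C where C: "C \<subseteq> B" "\<Union>C = to_rmodz -` U"
      using B(2) by (auto simp: topological_basis_def)
    have "\<Union>((`) to_rmodz ` C) = to_rmodz ` (\<Union>C)" by blast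
    also have "\<dots> = U"
    proof -
      have "t \<in> to_rmodz ` (to_rmodz -` U)" if "t \<in> U" for t
        using that by (intro image_eqI[where x = "rep_rmodz t"]) auto
      then show ?thesis unfolding C(2) by auto
    qed
    finally show "\<exists>C'\<subseteq>(`) to_rmodz ` B. \<Union>C' = U"
      using C(1) by blast
  qed
  then show "\<exists>B::rmodz set set. countable B \<and> open = generate_topology B"
    using B(1) topological_basis_imp_subbasis by blast
qed

lemma compact_rmodz: "compact (UNIV :: rmodz set)"
proof -
  have "t \<in> to_rmodz ` {0..1}" for t
  proof (rule image_eqI)
    have "rep_rmodz t - frac (rep_rmodz t) \<in> \<int>" by (simp add: frac_def)
    then show "t = to_rmodz (frac (rep_rmodz t))"
      by (metis to_rmodz_eq_iff to_rmodz_rep)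
    show "frac (rep_rmodz t) \<in> {0..1}" using frac_lt_1[of "rep_rmodz t"] by auto
  qed
  then have "(UNIV :: rmodz set) = to_rmodz ` {0..1}" by blast
  then show ?thesis
    by (metis compact_Icc compact_continuous_image continuous_on_subset continuous_to_rmodz subset_UNIV)
qed

text \<open>
  A product of quotient maps need not be a quotient map.  Here it is one because \<open>to_rmodz\<close> is open:
  neighbourhoods of representatives map to neighbourhoods.
\<close>

lemma continuous_rmodz_diff: "continuous_on UNIV (\<lambda>p::rmodz \<times> rmodz. fst p - snd p)"
  unfolding continuous_on_open_vimage[OF open_UNIV]
proof (intro allI impI)
  fix W :: "rmodz set" assume "open W"
  then have "open (to_rmodz -` W)" by (simp add: open_rmodz_def)
  moreover have "continuous_on UNIV (\<lambda>p::real \<times> real. fst p - snd p)"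
    by (intro continuous_intros)
  ultimately have op: "open ((\<lambda>p::real \<times> real. fst p - snd p) -` (to_rmodz -` W))"
    by (rule open_vimage)
  have "\<exists>A B. open A \<and> open B \<and> p \<in> A \<times> B \<and> A \<times> B \<subseteq> (\<lambda>p. fst p - snd p) -` W"
    if p: "fst p - snd p \<in> W" for p :: "rmodz \<times> rmodz"
  proof -
    define x y where "x = rep_rmodz (fst p)" and "y = rep_rmodz (snd p)"
    have "(x, y) \<in> (\<lambda>p::real \<times> real. fst p - snd p) -` (to_rmodz -` W)"
      using p by (simp add: x_def y_def to_rmodz_diff[symmetric])
    with op obtain A B where AB: "open A" "open B" "(x, y) \<in> A \<times> B"
        "A \<times> B \<subseteq> (\<lambda>p::real \<times> real. fst p - snd p) -` (to_rmodz -` W)"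
      by (rule open_prod_elim)
    have "p \<in> (to_rmodz ` A) \<times> (to_rmodz ` B)"
      using AB(3) by (cases p) (simp add: x_def y_def image_iff, metis to_rmodz_rep)
    moreover have "(to_rmodz ` A) \<times> (to_rmodz ` B) \<subseteq> (\<lambda>p. fst p - snd p) -` W"
      using AB(4) by (auto simp: to_rmodz_diff)
    ultimately show ?thesis
      using AB(1,2) open_to_rmodz_image by blast
  qed
  then show "open ((\<lambda>p::rmodz \<times> rmodz. fst p - snd p) -` W \<inter> UNIV)"
    by (auto simp: open_prod_def)
qed

lemma borel_measurable_rmodz_diff [measurable (raw)]:
  fixes f g :: "'a \<Rightarrow> rmodz"
  assumes [measurable]: "f \<in> borel_measurable M" "g \<in> borel_measurable M"
  shows "(\<lambda>x. f x - g x) \<in> borel_measurable M"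
  using assms continuous_rmodz_diff
  by (rule borel_measurable_continuous_Pair) 

lemma open_rmodz_reflected_translate:
  fixes c :: rmodz
  assumes "open U"
  shows "open {t. c - t \<in> U}"
proof -
  have "continuous_on UNIV (\<lambda>t. c - t)"
    using continuous_on_compose2[OF continuous_rmodz_diff continuous_on_Pair[OF continuous_on_const[of _ c] continuous_on_id]]
    by simp
  from open_vimage[OF assms this] show ?thesis by (simp add: vimage_def)
qed

text \<open>
  The distance from a real number to the preimage of \<open>C\<close> is periodic and so descends to the
  circle.  The resulting function serves to approximate indicator
  functions by continuous ones.
\<close>

lemma closed_rmodz_distance_function:
  fixes C :: "rmodz set"
  assumes "closed C" "C \<noteq> {}"
  obtains \<delta> :: "rmodz \<Rightarrow> real"
    where "continuous_on UNIV \<delta>" "\<And>t. 0 \<le> \<delta> t" "\<And>t. \<delta> t = 0 \<longleftrightarrow> t \<in> C"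
proof -
  define P where "P = to_rmodz -` C"
  have "closed P"
    using assms(1) by (auto simp: P_def closed_def open_rmodz_def vimage_Compl)
  have "P \<noteq> {}"
  proof -
    obtain t where "t \<in> C" using assms(2) by blast
    then have "rep_rmodz t \<in> P" by (simp add: P_def)
    then show ?thesis by blast
  qed
  have per: "infdist (x + of_int m) P = infdist x P" for x :: real and m
  proof -
    have le: "infdist (x + of_int m) P \<le> infdist x P" for x :: real and m
    proof -
      have "infdist (x + of_int m) P \<le> dist x a" if "a \<in> P" for a
      proof -
        have "a + of_int m \<in> P" using that by (simp add: P_def to_rmodz_of_int_add)
        from infdist_le[OF this, of "x + of_int m"] show ?thesis by (simp add: dist_real_def)
      qed
      then show ?thesis
        using \<open>P \<noteq> {}\<close> by (simp add: infdist_notempty cINF_greatest le_cINF_iff)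
    qed
    from le[of x m] le[of "x + of_int m" "-m"] show ?thesis by simp
  qed
  define \<delta> where "\<delta> t = infdist (rep_rmodz t) P" for t
  have \<delta>: "\<delta> (to_rmodz x) = infdist x P" for x
  proof -
    have "rep_rmodz (to_rmodz x) - x \<in> \<int>" by (simp add: to_rmodz_eq_iff[symmetric])
    then obtain m where "rep_rmodz (to_rmodz x) = x + of_int m"
      by (elim Ints_cases) (simp add: algebra_simps)
    then show ?thesis using per by (simp add: \<delta>_def)
  qed
  show ?thesis
  proof
    show "continuous_on UNIV \<delta>"
      unfolding continuous_on_open_vimage[OF open_UNIV]
    proof (intro allI impI)
      fix B :: "real set" assume "open B"
      have "continuous_on UNIV (\<lambda>x. infdist x P)" by (intro continuous_intros)
      from open_vimage[OF \<open>open B\<close> this] show "open (\<delta> -` B \<inter> UNIV)"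
        by (simp add: open_rmodz_def vimage_def \<delta>)
    qed
    show "0 \<le> \<delta> t" for t by (simp add: \<delta>_def infdist_nonneg)
    show "\<delta> t = 0 \<longleftrightarrow> t \<in> C" for t
      using in_closed_iff_infdist_zero[OF \<open>closed P\<close> \<open>P \<noteq> {}\<close>, of "rep_rmodz t"]
      by (simp add: \<delta>_def P_def)
  qed
qed

section \<open>Haar measure on the circle\<close>

lemma measurable_to_rmodz [measurable]: "to_rmodz \<in> borel_measurable borel"
  by (intro borel_measurable_continuous_onI continuous_to_rmodz)

lemma space_haar_rmodz [simp]: "space haar_rmodz = UNIV"
  by (simp add: haar_rmodz_def)

lemma sets_haar_rmodz [simp, measurable_cong]: "sets haar_rmodz = sets borel"
  by (simp add: haar_rmodz_def)

lemma measurable_to_rmodz_restrict: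
   "to_rmodz \<in> borel_measurable (restrict_space lborel {0..<1})"
  by (rule measurable_restrict_space1) simp

lemma emeasure_haar_rmodz:
  assumes [measurable]: "A \<in> sets borel"
  shows "emeasure haar_rmodz A = emeasure lborel (to_rmodz -` A \<inter> {0..<1})"
proof -
  have "emeasure haar_rmodz A
    = emeasure (restrict_space lborel {0..<1}) (to_rmodz -` A \<inter> {0..<1})"
    unfolding haar_rmodz_def
    by (subst emeasure_distr[OF measurable_to_rmodz_restrict]) (simp_all add: space_restrict_space)
  also have "\<dots> = emeasure lborel (to_rmodz -` A \<inter> {0..<1})"
    by (subst emeasure_restrict_space) auto
  finally show ?thesis .
qed

lemma prob_space_haar_rmodz: "prob_space haar_rmodz"
  by (rule prob_spaceI) (simp add: emeasure_haar_rmodz)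

interpretation haar_rmodz: prob_space haar_rmodz
  by (rule prob_space_haar_rmodz)

text \<open>
  After an integer translation the interval is \<open>[e, e + 1)\<close> with \<open>0 \<le> e < 1\<close>; its part
  beyond \<open>1\<close> is the translate of the missing part \<open>[0, e)\<close>.
\<close>

lemma emeasure_periodic_interval:
  fixes P :: "real set"
  assumes [measurable]: "P \<in> sets borel"
    and per: "\<And>x m. x + of_int m \<in> P \<longleftrightarrow> x \<in> P"
  shows "emeasure lborel (P \<inter> {c..<c + 1}) = emeasure lborel (P \<inter> {0..<1})"
proof -
  have shift: "emeasure lborel (P \<inter> {a + of_int m..<b + of_int m}) = emeasure lborel (P \<inter> {a..<b})"
    for a b :: real and m
  proof -
    have "emeasure lborel (P \<inter> {a..<b})
      = emeasure (distr lborel borel ((+) (of_int (-m)))) (P \<inter> {a..<b})"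
      by (simp add: lborel_distr_plus)
    also have "\<dots> = emeasure lborel ((+) (of_int (-m)) -` (P \<inter> {a..<b}))"
      by (subst emeasure_distr) auto
    also have "(+) (of_int (-m)) -` (P \<inter> {a..<b}) = P \<inter> {a + of_int m..<b + of_int m}"
    proof -
      have "of_int (- m) + x \<in> P \<longleftrightarrow> x \<in> P" for x
        using per[of x "- m"] by (simp only: add.commute)
      moreover have "of_int (- m) + x \<in> {a..<b} \<longleftrightarrow> x \<in> {a + of_int m..<b + of_int m}" for x
        by auto
      ultimately show ?thesis by blast
    qed
    finally show ?thesis by simp
  qed
  define e where "e = frac c"
  have e: "0 \<le> e" "e < 1" by (auto simp: e_def frac_lt_1)
  have c: "c = e + of_int \<lfloor>c\<rfloor>" by (simp add: e_def frac_def)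
  have "emeasure lborel (P \<inter> {c..<c + 1}) = emeasure lborel (P \<inter> {e..<e + 1})"
  proof -
    have "e + 1 + of_int \<lfloor>c\<rfloor> = c + 1" by (simp add: e_def frac_def)
    with shift[of e "\<lfloor>c\<rfloor>" "e + 1"] show ?thesis by (simp only: c[symmetric])
  qed
  also have "P \<inter> {e..<e + 1} = (P \<inter> {e..<1}) \<union> (P \<inter> {1..<e + 1})" using e by auto
  also have "emeasure lborel \<dots> = emeasure lborel (P \<inter> {e..<1}) + emeasure lborel (P \<inter> {1..<e + 1})"
    by (rule plus_emeasure[symmetric]) auto
  also have "emeasure lborel (P \<inter> {1..<e + 1}) = emeasure lborel (P \<inter> {0..<e})"
    using shift[of 0 1 e] by simp
  also have "emeasure lborel (P \<inter> {e..<1}) + emeasure lborel (P \<inter> {0..<e})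
    = emeasure lborel ((P \<inter> {e..<1}) \<union> (P \<inter> {0..<e}))"
    by (rule plus_emeasure) auto
  also have "(P \<inter> {e..<1}) \<union> (P \<inter> {0..<e}) = P \<inter> {0..<1}" using e by auto
  finally show ?thesis .
qed

lemma vimage_to_rmodz_periodic: "x + of_int m \<in> to_rmodz -` A \<longleftrightarrow> x \<in> to_rmodz -` A"
  by (simp add: to_rmodz_of_int_add)

lemma distr_haar_rmodz_translate: "distr haar_rmodz borel (\<lambda>t. t - c) = haar_rmodz"
proof (rule measure_eqI)
  fix A assume "A \<in> sets (distr haar_rmodz borel (\<lambda>t. t - c))"
  then have A [measurable]: "A \<in> sets borel" by simp
  define a where "a = rep_rmodz c"
  have c: "c = to_rmodz a" by (simp add: a_def)
  let ?P = "to_rmodz -` A"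
  have [measurable]: "?P \<in> sets borel"
    using measurable_sets[OF measurable_to_rmodz A] by simp
  have "(\<lambda>t. t - c) \<in> borel_measurable borel" by measurable
  then have pre: "(\<lambda>t. t - c) -` A \<in> sets borel"
    using measurable_sets_borel[OF _ A] by blast
  have "emeasure (distr haar_rmodz borel (\<lambda>t. t - c)) A
    = emeasure lborel (to_rmodz -` ((\<lambda>t. t - c) -` A) \<inter> {0..<1})"
    by (subst emeasure_distr) (simp_all add: emeasure_haar_rmodz pre)
  also have "to_rmodz -` ((\<lambda>t. t - c) -` A) \<inter> {0..<1} = (+) (- a) -` (?P \<inter> {- a..<- a + 1})"
    by (auto simp: c to_rmodz_diff)
  also have "emeasure lborel \<dots> = emeasure (distr lborel borel ((+) (- a))) (?P \<inter> {- a..<- a + 1})"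
    by (subst emeasure_distr) auto
  also have "\<dots> = emeasure lborel (?P \<inter> {- a..<- a + 1})"
    by (simp add: lborel_distr_plus)
  also have "\<dots> = emeasure lborel (?P \<inter> {0..<1})"
    by (intro emeasure_periodic_interval vimage_to_rmodz_periodic) fact
  finally show "emeasure (distr haar_rmodz borel (\<lambda>t. t - c)) A = emeasure haar_rmodz A"
    by (simp add: emeasure_haar_rmodz)
qed simp

lemma distr_haar_rmodz_reflect: "distr haar_rmodz borel (\<lambda>t. c - t) = haar_rmodz"
proof (rule measure_eqI)
  fix A assume "A \<in> sets (distr haar_rmodz borel (\<lambda>t. c - t))"
  then have A [measurable]: "A \<in> sets borel" by simp
  define a where "a = rep_rmodz c"
  have c: "c = to_rmodz a" by (simp add: a_def)
  let ?P = "to_rmodz -` A"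
  have [measurable]: "?P \<in> sets borel"
    using measurable_sets[OF measurable_to_rmodz A] by simp
  have "(\<lambda>t. c - t) \<in> borel_measurable borel" by measurable
  then have pre: "(\<lambda>t. c - t) -` A \<in> sets borel"
    using measurable_sets_borel[OF _ A] by blast
  have "emeasure (distr haar_rmodz borel (\<lambda>t. c - t)) A
    = emeasure lborel (to_rmodz -` ((\<lambda>t. c - t) -` A) \<inter> {0..<1})"
    by (subst emeasure_distr) (simp_all add: emeasure_haar_rmodz pre)
  also have "to_rmodz -` ((\<lambda>t. c - t) -` A) \<inter> {0..<1} = (\<lambda>t. a + (-1) * t) -` (?P \<inter> {a - 1<..a})"
    by (auto simp: c to_rmodz_diff)
  also have "emeasure lborel \<dots> = emeasure (distr lborel borel (\<lambda>t. a + (-1) * t)) (?P \<inter> {a - 1<..a})"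
    by (subst emeasure_distr) auto
  also have "distr lborel borel (\<lambda>t. a + (-1) * t) = lborel"
    using lborel_real_affine[of "-1" a] by (simp add: density_1)
  also have "emeasure lborel (?P \<inter> {a - 1<..a}) = emeasure lborel (?P \<inter> {a - 1..<(a - 1) + 1})"
  proof (rule emeasure_eq_AE)
    show "AE x in lborel. x \<in> ?P \<inter> {a - 1<..a} \<longleftrightarrow> x \<in> ?P \<inter> {a - 1..<(a - 1) + 1}"
      using AE_lborel_singleton[of a] AE_lborel_singleton[of "a - 1"] by eventually_elim auto
  qed auto
  also have "\<dots> = emeasure lborel (?P \<inter> {0..<1})"
    by (intro emeasure_periodic_interval vimage_to_rmodz_periodic) fact
  finally show "emeasure (distr haar_rmodz borel (\<lambda>t. c - t)) A = emeasure haar_rmodz A"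
    by (simp add: emeasure_haar_rmodz)
qed simp

section \<open>Haar measure on the torus\<close>

definition torus_haar :: "nat \<Rightarrow> (nat \<Rightarrow> rmodz) measure" where
  "torus_haar n = (\<Pi>\<^sub>M i\<in>{..<n}. haar_rmodz)"

lemma torus_leb_eq: "torus_leb n = completion (torus_haar n)"
  by (simp add: torus_leb_def torus_haar_def)

lemma sets_torus_haar [simp, measurable_cong]: "sets (torus_haar n) = sets (torus_borel n)"
  unfolding torus_haar_def torus_borel_def by (intro sets_PiM_cong) simp_all

lemma space_torus_haar [simp]: "space (torus_haar n) = torus n"
  by (simp add: torus_haar_def torus_def space_PiM)

lemma space_torus_borel [simp]: "space (torus_borel n) = torus n"
  by (simp add: torus_borel_def torus_def space_PiM)

lemma space_torus_leb [simp]: "space (torus_leb n) = torus n"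
  by (simp add: torus_leb_eq)

lemma prob_space_torus_haar: "prob_space (torus_haar n)"
  unfolding torus_haar_def by (intro prob_space_PiM prob_space_haar_rmodz)

interpretation torus_haar: prob_space "torus_haar n" for n
  by (rule prob_space_torus_haar)

lemma emeasure_torus_haar_torus [simp]: "emeasure (torus_haar n) (torus n) = 1"
  using torus_haar.emeasure_space_1[of n] by simp

interpretation torus_haar_pair: pair_prob_space "torus_haar m" "torus_haar n" for m n
  by standard

interpretation haar_product: product_sigma_finite "\<lambda>_::nat. haar_rmodz"
  by standard

lemma measurable_torus_component:
  assumes "f \<in> M \<rightarrow>\<^sub>M torus_borel n" "i < n"
  shows "(\<lambda>x. f x i) \<in> borel_measurable M"
  using measurable_compose[OF assms(1)[unfolded torus_borel_def] measurable_component_singleton] assms(2)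
  by simp

text \<open>
  This reduces measurability of the maps between tori, all of which are given coordinatewise, to that
  of their coordinates.
\<close>

lemma measurable_into_torus:
  assumes "\<And>i. i < n \<Longrightarrow> (\<lambda>x. f x i) \<in> borel_measurable M"
  shows "(\<lambda>x. \<lambda>i\<in>{..<n}. f x i) \<in> M \<rightarrow>\<^sub>M torus_borel n"
  unfolding torus_borel_def using assms by (intro measurable_restrict) simp

lemma measurable_torus_diff [measurable (raw)]:
  assumes "f \<in> M \<rightarrow>\<^sub>M torus_borel n" "g \<in> M \<rightarrow>\<^sub>M torus_borel n"
  shows "(\<lambda>x. torus_diff n (f x) (g x)) \<in> M \<rightarrow>\<^sub>M torus_borel n"
  unfolding torus_diff_def
  by (intro measurable_into_torus borel_measurable_rmodz_diff measurable_torus_component[OF assms(1)]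
      measurable_torus_component[OF assms(2)])

lemma measurable_torus_diff_right [measurable]: "torus_diff n z \<in> torus_borel n \<rightarrow>\<^sub>M torus_borel n"
proof -
  have "(\<lambda>w. \<lambda>i\<in>{..<n}. z i - w i) \<in> torus_borel n \<rightarrow>\<^sub>M torus_borel n"
    by (intro measurable_into_torus borel_measurable_rmodz_diff measurable_const measurable_torus_component) simp_all
  then show ?thesis by (simp add: torus_diff_def[abs_def])
qed

lemma measurable_torus_diff_left [measurable]: "(\<lambda>z. torus_diff n z w) \<in> torus_borel n \<rightarrow>\<^sub>M torus_borel n"
proof -
  have "(\<lambda>z. \<lambda>i\<in>{..<n}. z i - w i) \<in> torus_borel n \<rightarrow>\<^sub>M torus_borel n"
    by (intro measurable_into_torus borel_measurable_rmodz_diff measurable_const measurable_torus_component) simp_all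
  then show ?thesis by (simp add: torus_diff_def)
qed

lemma measurable_torus_append [measurable (raw)]:
  assumes "f \<in> M \<rightarrow>\<^sub>M torus_borel n" "g \<in> M \<rightarrow>\<^sub>M torus_borel d"
  shows "(\<lambda>x. torus_append n d (f x) (g x)) \<in> M \<rightarrow>\<^sub>M torus_borel (n + d)"
  unfolding torus_append_def
proof (rule measurable_into_torus)
  fix i assume "i < n + d"
  then show "(\<lambda>x. if i < n then f x i else g x (i - n)) \<in> borel_measurable M"
    using measurable_torus_component[OF assms(1), of i] measurable_torus_component[OF assms(2), of "i - n"]
    by (cases "i < n") auto
qed

lemma measurable_torus_shift [measurable (raw)]:
  assumes "f \<in> M \<rightarrow>\<^sub>M torus_borel n" "g \<in> M \<rightarrow>\<^sub>M torus_borel d"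
  shows "(\<lambda>x. torus_shift d n (f x) (g x)) \<in> M \<rightarrow>\<^sub>M torus_borel n"
  unfolding torus_shift_def
proof (rule measurable_into_torus)
  fix i assume "i < n"
  then show "(\<lambda>x. if i < d then f x i - g x i else f x i) \<in> borel_measurable M"
    using measurable_torus_component[OF assms(1), of i] measurable_torus_component[OF assms(2), of i]
    by (cases "i < d") (auto intro: borel_measurable_rmodz_diff)
qed

lemma torus_diff_in_torus [simp]: "torus_diff n z w \<in> torus n"
  by (auto simp: torus_diff_def torus_def)

lemma torus_append_in_torus [simp]: "torus_append n d z v \<in> torus (n + d)"
  by (auto simp: torus_append_def torus_def)

lemma torus_shift_in_torus [simp]: "torus_shift d n z v \<in> torus n"
  by (auto simp: torus_shift_def torus_def)

lemma torus_diff_zero: "z \<in> torus n \<Longrightarrow> torus_diff n z (\<lambda>_. 0) = z"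
  by (auto simp: torus_diff_def torus_def PiE_iff extensional_def fun_eq_iff)

section \<open>Invariance of Haar measure on the torus\<close>

text \<open>
  The product measure is determined by its values on boxes, and the preimage of a box is a box with
  sides of the same measures.  Translations, reflections and shifts are special cases.
\<close>

lemma distr_torus_haar_componentwise:
  assumes \<tau>: "\<And>i. i < n \<Longrightarrow> \<tau> i \<in> borel_measurable borel"
    and inv: "\<And>i. i < n \<Longrightarrow> distr haar_rmodz borel (\<tau> i) = haar_rmodz"
  shows "distr (torus_haar n) (torus_borel n) (\<lambda>z. \<lambda>i\<in>{..<n}. \<tau> i (z i)) = torus_haar n"
  unfolding torus_haar_def[of n]
proof (rule haar_product.PiM_eqI)
  let ?f = "\<lambda>z::nat \<Rightarrow> rmodz. \<lambda>i\<in>{..<n}. \<tau> i (z i)"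
  let ?M = "Pi\<^sub>M {..<n} (\<lambda>_. haar_rmodz)"
  show "sets (distr ?M (torus_borel n) ?f) = sets ?M"
    using sets_torus_haar[of n] by (simp add: torus_haar_def)
  fix A :: "nat \<Rightarrow> rmodz set" assume "\<And>i. i \<in> {..<n} \<Longrightarrow> A i \<in> sets haar_rmodz"
  then have A: "A i \<in> sets borel" if "i < n" for i using that by simp
  have A': "\<tau> i -` A i \<in> sets borel" if "i < n" for i
    using measurable_sets_borel[OF \<tau> A, of i i] that by simp
  have f: "?f \<in> ?M \<rightarrow>\<^sub>M torus_borel n"
  proof (rule measurable_into_torus)
    fix i assume "i < n"
    then have "(\<lambda>z. z i) \<in> ?M \<rightarrow>\<^sub>M borel"
      using measurable_torus_component[of "\<lambda>z. z" ?M n i] sets_torus_haar[of n]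
      by (auto simp: torus_haar_def intro: measurable_ident_sets)
    from measurable_compose[OF this \<tau>[OF \<open>i < n\<close>]]
    show "(\<lambda>z. \<tau> i (z i)) \<in> borel_measurable ?M" .
  qed
  have box: "Pi\<^sub>E {..<n} A \<in> sets (torus_borel n)"
    unfolding torus_borel_def using A by (intro sets_PiM_I_finite) auto
  have "emeasure (distr ?M (torus_borel n) ?f) (Pi\<^sub>E {..<n} A)
    = emeasure ?M (?f -` (Pi\<^sub>E {..<n} A) \<inter> space ?M)"
    by (rule emeasure_distr[OF f box])
  also have "?f -` (Pi\<^sub>E {..<n} A) \<inter> space ?M = Pi\<^sub>E {..<n} (\<lambda>i. \<tau> i -` A i)"
    by (auto simp: space_PiM PiE_iff)
  also have "emeasure ?M \<dots> = (\<Prod>i<n. emeasure haar_rmodz (\<tau> i -` A i))"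
    using A' by (intro haar_product.emeasure_PiM) auto
  also have "\<dots> = (\<Prod>i<n. emeasure haar_rmodz (A i))"
  proof (rule prod.cong[OF refl])
    fix i assume "i \<in> {..<n}"
    then have i: "i < n" by simp
    have "emeasure haar_rmodz (A i) = emeasure (distr haar_rmodz borel (\<tau> i)) (A i)"
      by (simp add: inv[OF i])
    also have "\<dots> = emeasure haar_rmodz (\<tau> i -` A i)"
      using \<tau>[OF i] A[OF i] by (subst emeasure_distr) (auto cong: measurable_cong_sets)
    finally show "emeasure haar_rmodz (\<tau> i -` A i) = emeasure haar_rmodz (A i)" by simp
  qed
  finally show "emeasure (distr ?M (torus_borel n) ?f) (Pi\<^sub>E {..<n} A)
    = (\<Prod>i\<in>{..<n}. emeasure haar_rmodz (A i))" .
qed simp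

lemma distr_torus_haar_reflect:
  "distr (torus_haar n) (torus_borel n) (\<lambda>w. torus_diff n z w) = torus_haar n"
  unfolding torus_diff_def
  by (rule distr_torus_haar_componentwise) (simp_all add: distr_haar_rmodz_reflect)

lemma distr_torus_haar_translate:
  "distr (torus_haar n) (torus_borel n) (\<lambda>z. torus_diff n z w) = torus_haar n"
  unfolding torus_diff_def
  by (rule distr_torus_haar_componentwise) (simp_all add: distr_haar_rmodz_translate)

lemma distr_torus_haar_shift:
  "distr (torus_haar n) (torus_borel n) (\<lambda>z. torus_shift d n z v) = torus_haar n"
proof -
  have "(\<lambda>z. torus_shift d n z v) = (\<lambda>z. \<lambda>i\<in>{..<n}. (if i < d then (\<lambda>t. t - v i) else (\<lambda>t. t)) (z i))"
    by (auto simp: torus_shift_def fun_eq_iff)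
  moreover have "distr haar_rmodz borel (\<lambda>t. t) = haar_rmodz"
    by (rule distr_id2) simp
  ultimately show ?thesis
    by (simp only:) (rule distr_torus_haar_componentwise, auto simp: distr_haar_rmodz_translate)
qed

lemma distr_torus_haar_append:
  "distr (torus_haar n \<Otimes>\<^sub>M torus_haar d) (torus_borel (n + d)) (\<lambda>(z, v). torus_append n d z v)
    = torus_haar (n + d)"
  unfolding torus_haar_def[of "n + d"]
proof (rule haar_product.PiM_eqI)
  let ?f = "\<lambda>(z, v). torus_append n d z v"
  let ?P = "torus_haar n \<Otimes>\<^sub>M torus_haar d"
  show "sets (distr ?P (torus_borel (n + d)) ?f) = sets (Pi\<^sub>M {..<n + d} (\<lambda>_. haar_rmodz))"
    using sets_torus_haar[of "n + d"] by (simp add: torus_haar_def)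
  fix A :: "nat \<Rightarrow> rmodz set" assume "\<And>i. i \<in> {..<n + d} \<Longrightarrow> A i \<in> sets haar_rmodz"
  then have A: "A i \<in> sets borel" if "i < n + d" for i using that by simp
  let ?B = "Pi\<^sub>E {..<n} A" and ?C = "Pi\<^sub>E {..<d} (\<lambda>i. A (n + i))"
  have sets: "?B \<in> sets (torus_borel n)" "?C \<in> sets (torus_borel d)"
    "Pi\<^sub>E {..<n + d} A \<in> sets (torus_borel (n + d))"
    unfolding torus_borel_def using A by (auto intro!: sets_PiM_I_finite)
  have f: "?f \<in> ?P \<rightarrow>\<^sub>M torus_borel (n + d)" by measurable
  have "emeasure (distr ?P (torus_borel (n + d)) ?f) (Pi\<^sub>E {..<n + d} A)
    = emeasure ?P (?f -` (Pi\<^sub>E {..<n + d} A) \<inter> space ?P)"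
    by (rule emeasure_distr[OF f sets(3)])
  also have "?f -` (Pi\<^sub>E {..<n + d} A) \<inter> space ?P = ?B \<times> ?C"
  proof (intro equalityI subsetI; clarsimp simp: space_pair_measure)
    fix z v assume *: "torus_append n d z v \<in> Pi\<^sub>E {..<n + d} A" "z \<in> torus n" "v \<in> torus d"
    have "z i \<in> A i" if "i < n" for i
      using PiE_mem[OF *(1), of i] that by (simp add: torus_append_def)
    moreover have "v i \<in> A (n + i)" if "i < d" for i
      using PiE_mem[OF *(1), of "n + i"] that by (simp add: torus_append_def)
    ultimately show "z \<in> ?B \<and> v \<in> ?C"
      using *(2,3) by (auto simp: torus_def PiE_iff)
  next
    fix z v assume *: "z \<in> ?B" "v \<in> ?C"
    have "(if i < n then z i else v (i - n)) \<in> A i" if "i < n + d" for i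
      using PiE_mem[OF *(1), of i] PiE_mem[OF *(2), of "i - n"] that by auto
    then have "torus_append n d z v \<in> Pi\<^sub>E {..<n + d} A"
      by (auto simp: torus_append_def)
    with * show "torus_append n d z v \<in> Pi\<^sub>E {..<n + d} A \<and> z \<in> torus n \<and> v \<in> torus d"
      by (auto simp: torus_def PiE_iff)
  qed
  also have "emeasure ?P (?B \<times> ?C) = emeasure (torus_haar n) ?B * emeasure (torus_haar d) ?C"
    using sets by (intro torus_haar.emeasure_pair_measure_Times) simp_all
  also have "emeasure (torus_haar n) ?B = (\<Prod>i<n. emeasure haar_rmodz (A i))"
    unfolding torus_haar_def using A by (intro haar_product.emeasure_PiM) auto
  also have "emeasure (torus_haar d) ?C = (\<Prod>i<d. emeasure haar_rmodz (A (n + i)))"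
    unfolding torus_haar_def using A by (intro haar_product.emeasure_PiM) auto
  also have "(\<Prod>i<n. emeasure haar_rmodz (A i)) * (\<Prod>i<d. emeasure haar_rmodz (A (n + i)))
    = (\<Prod>i<n + d. emeasure haar_rmodz (A i))"
    by (induction d) (simp_all add: mult.assoc[symmetric])
  finally show "emeasure (distr ?P (torus_borel (n + d)) ?f) (Pi\<^sub>E {..<n + d} A)
    = (\<Prod>i\<in>{..<n + d}. emeasure haar_rmodz (A i))" .
qed simp

lemma nn_integral_torus_haar_invariant:
  assumes "distr (torus_haar n) (torus_borel n) T = torus_haar n"
    and "T \<in> torus_borel n \<rightarrow>\<^sub>M torus_borel n" "h \<in> borel_measurable (torus_borel n)"
  shows "(\<integral>\<^sup>+z. h (T z) \<partial>torus_haar n) = (\<integral>\<^sup>+z. h z \<partial>torus_haar n)"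
  using nn_integral_distr[of T "torus_haar n" "torus_borel n" h] assms
  by (simp cong: measurable_cong_sets)

text \<open>
  Fubini for the splitting of the first \<open>n\<close> from the last \<open>d\<close> coordinates.
\<close>

lemma nn_integral_torus_append:
  assumes [measurable]: "h \<in> borel_measurable (torus_borel (n + d))"
  shows "(\<integral>\<^sup>+z. h z \<partial>torus_haar (n + d))
    = (\<integral>\<^sup>+z. \<integral>\<^sup>+v. h (torus_append n d z v) \<partial>torus_haar d \<partial>torus_haar n)"
proof -
  have "(\<integral>\<^sup>+z. h z \<partial>torus_haar (n + d))
    = (\<integral>\<^sup>+p. h (case p of (z, v) \<Rightarrow> torus_append n d z v) \<partial>(torus_haar n \<Otimes>\<^sub>M torus_haar d))"
    by (subst distr_torus_haar_append[symmetric], subst nn_integral_distr) simp_all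
  also have "\<dots> = (\<integral>\<^sup>+z. \<integral>\<^sup>+v. h (torus_append n d z v) \<partial>torus_haar d \<partial>torus_haar n)"
    by (subst torus_haar.nn_integral_fst[symmetric]) simp_all
  finally show ?thesis .
qed

text \<open>
  The map \<open>((x; u'), v) \<mapsto> (x - v; u')\<close> preserves measure because it does so for each fixed \<open>v\<close>.
\<close>

lemma nn_integral_torus_shift:
  assumes [measurable]: "h \<in> borel_measurable (torus_borel n)"
  shows "(\<integral>\<^sup>+p. h (torus_shift d n (fst p) (snd p)) \<partial>(torus_haar n \<Otimes>\<^sub>M torus_haar d)) = (\<integral>\<^sup>+z. h z \<partial>torus_haar n)"
proof -
  have "(\<integral>\<^sup>+p. h (torus_shift d n (fst p) (snd p)) \<partial>(torus_haar n \<Otimes>\<^sub>M torus_haar d))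
    = (\<integral>\<^sup>+v. \<integral>\<^sup>+z. h (torus_shift d n z v) \<partial>torus_haar n \<partial>torus_haar d)"
    by (subst torus_haar_pair.nn_integral_snd[symmetric]) simp_all
  also have "\<dots> = (\<integral>\<^sup>+v. \<integral>\<^sup>+z. h z \<partial>torus_haar n \<partial>torus_haar d)"
  proof (rule nn_integral_cong)
    fix v assume "v \<in> space (torus_haar d)"
    then have "(\<lambda>z. torus_shift d n z v) \<in> torus_borel n \<rightarrow>\<^sub>M torus_borel n"
      by (intro measurable_torus_shift measurable_ident_sets measurable_const) simp_all
    from nn_integral_torus_haar_invariant[OF distr_torus_haar_shift this assms]
    show "(\<integral>\<^sup>+z. h (torus_shift d n z v) \<partial>torus_haar n) = (\<integral>\<^sup>+z. h z \<partial>torus_haar n)" .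
  qed
  finally show ?thesis by (simp add: torus_haar.emeasure_space_1)
qed

section \<open>Continuous functions on the torus\<close>

text \<open>
  Since the topology is defined on all functions on \<open>\<nat>\<close>, a function that is continuous on the torus is
  first extended continuously by composing it with the restriction of coordinates.
\<close>

lemma continuous_on_restrict_torus:
  fixes F :: "(nat \<Rightarrow> rmodz) \<Rightarrow> 'a::topological_space"
  assumes "continuous_on (torus n) F"
  shows "continuous_on UNIV (\<lambda>z. F (restrict z {..<n}))"
proof (rule continuous_on_compose2[OF assms])
  show "continuous_on UNIV (\<lambda>z::nat \<Rightarrow> rmodz. restrict z {..<n})"
  proof (rule continuous_on_coordinatewise_then_product)
    fix i show "continuous_on UNIV (\<lambda>z::nat \<Rightarrow> rmodz. restrict z {..<n} i)"
      by (cases "i < n") (auto intro: continuous_on_product_coordinates)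
  qed
qed (auto simp: torus_def split: if_splits)

text \<open>
  The Borel sets of the function space are generated by countably many coordinates; those beyond \<open>n\<close>
  are constant on the torus.
\<close>

lemma measurable_torus_into_functions: "(\<lambda>z. z) \<in> torus_borel n \<rightarrow>\<^sub>M (borel :: (nat \<Rightarrow> rmodz) measure)"
proof (rule measurable_coordinatewise_then_product)
  fix i show "(\<lambda>z. z i) \<in> borel_measurable (torus_borel n)"
  proof (cases "i < n")
    case True then show ?thesis by (intro measurable_torus_component) simp_all
  next
    case False
    then have "z i = undefined" if "z \<in> torus n" for z
      using that by (auto simp: torus_def PiE_iff extensional_def)
    then show ?thesis by (subst measurable_cong[where g = "\<lambda>_. undefined"]) auto
  qed
qed

lemma borel_measurable_continuous_on_torus:
  fixes F :: "(nat \<Rightarrow> rmodz) \<Rightarrow> 'a::topological_space"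
  assumes "continuous_on (torus n) F"
  shows "F \<in> borel_measurable (torus_borel n)"
proof -
  have "(\<lambda>z. F (restrict z {..<n})) \<in> borel_measurable borel"
    by (intro borel_measurable_continuous_onI continuous_on_restrict_torus assms)
  from measurable_compose[OF measurable_torus_into_functions this]
  have "(\<lambda>z. F (restrict z {..<n})) \<in> borel_measurable (torus_borel n)" .
  moreover have "restrict z {..<n} = z" if "z \<in> torus n" for z
    using that by (auto simp: torus_def PiE_iff extensional_restrict)
  ultimately show ?thesis by (subst (asm) measurable_cong[where g = F]) auto
qed

lemma open_Int_torus_sets: "open U \<Longrightarrow> torus n \<inter> U \<in> sets (torus_borel n)"
  using measurable_sets[OF measurable_torus_into_functions, of U n] by (simp add: Int_commute)

lemma compact_torus: "compact (torus n)"
proof -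
  let ?S = "\<lambda>i. if i < n then UNIV else {undefined} :: rmodz set"
  have "torus n = Pi\<^sub>E UNIV ?S"
  proof (intro equalityI subsetI)
    fix z assume "z \<in> torus n"
    then show "z \<in> Pi\<^sub>E UNIV ?S" by (auto simp: torus_def PiE_iff extensional_def)
  next
    fix z assume z: "z \<in> Pi\<^sub>E UNIV ?S"
    have "z i = undefined" if "\<not> i < n" for i using PiE_mem[OF z, of i] that by simp
    then show "z \<in> torus n" by (simp add: torus_def PiE_iff extensional_def)
  qed
  moreover have "compactin (product_topology (\<lambda>_. euclidean) UNIV) (Pi\<^sub>E UNIV ?S)"
    unfolding compactin_PiE using compact_rmodz by auto
  ultimately show ?thesis by (simp add: euclidean_product_topology)
qed

lemma continuous_on_torus_bounded:
  fixes F :: "(nat \<Rightarrow> rmodz) \<Rightarrow> 'a::real_normed_vector"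
  assumes "continuous_on (torus n) F"
  obtains B where "0 \<le> B" "\<And>z. z \<in> torus n \<Longrightarrow> norm (F z) \<le> B"
proof -
  have "bounded (F ` torus n)"
    by (intro compact_imp_bounded compact_continuous_image assms compact_torus)
  then obtain B where "\<forall>y\<in>F ` torus n. norm y \<le> B" by (auto simp: bounded_iff)
  then show ?thesis by (intro that[of "max 0 B"]) (auto simp: le_max_iff_disj)
qed

section \<open>Jordan decomposition\<close>

text \<open>
  The common form of the real and imaginary parts of a complex measure and of their negatives.
\<close>

definition signed_measure :: "'a measure \<Rightarrow> ('a set \<Rightarrow> real) \<Rightarrow> bool" where
  "signed_measure M \<sigma> \<longleftrightarrow>
     (\<exists>B. \<forall>A. \<bar>\<sigma> A\<bar> \<le> B) \<and>
     (\<forall>A :: nat \<Rightarrow> 'a set. range A \<subseteq> sets M \<longrightarrow> disjoint_family A \<longrightarrow> (\<lambda>i. \<sigma> (A i)) sums \<sigma> (\<Union>i. A i))"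

lemma signed_measure_uminus: "signed_measure M \<sigma> \<Longrightarrow> signed_measure M (\<lambda>A. - \<sigma> A)"
  by (simp add: signed_measure_def sums_minus)

lemma complex_measure_Re: "complex_measure M \<nu> \<Longrightarrow> signed_measure M (\<lambda>A. Re (\<nu> A))"
  unfolding signed_measure_def
proof (intro conjI allI impI)
  assume \<nu>: "complex_measure M \<nu>"
  then obtain B where "\<And>A. cmod (\<nu> A) \<le> B" by (auto simp: complex_measure_def bounded_iff)
  then show "\<exists>B. \<forall>A. \<bar>Re (\<nu> A)\<bar> \<le> B" using abs_Re_le_cmod order_trans by blast
  fix A :: "nat \<Rightarrow> 'a set"
  assume "range A \<subseteq> sets M" "disjoint_family A"
  with \<nu> show "(\<lambda>i. Re (\<nu> (A i))) sums Re (\<nu> (\<Union>i. A i))"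
    unfolding complex_measure_def by (intro sums_Re) blast
qed

lemma complex_measure_Im: "complex_measure M \<nu> \<Longrightarrow> signed_measure M (\<lambda>A. Im (\<nu> A))"
  unfolding signed_measure_def
proof (intro conjI allI impI)
  assume \<nu>: "complex_measure M \<nu>"
  then obtain B where "\<And>A. cmod (\<nu> A) \<le> B" by (auto simp: complex_measure_def bounded_iff)
  then show "\<exists>B. \<forall>A. \<bar>Im (\<nu> A)\<bar> \<le> B" using abs_Im_le_cmod order_trans by blast
  fix A :: "nat \<Rightarrow> 'a set"
  assume "range A \<subseteq> sets M" "disjoint_family A"
  with \<nu> show "(\<lambda>i. Im (\<nu> (A i))) sums Im (\<nu> (\<Union>i. A i))"
    unfolding complex_measure_def by (intro sums_Im) blast
qed

text \<open>
  The constant series with terms \<open>\<sigma> {}\<close> converges.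
\<close>

lemma signed_measure_empty:
  assumes "signed_measure M \<sigma>"
  shows "\<sigma> {} = 0"
proof -
  have "(\<lambda>i::nat. \<sigma> {}) sums \<sigma> (\<Union>i::nat. {})"
    using assms unfolding signed_measure_def by (auto simp: disjoint_family_on_def)
  then have "summable (\<lambda>i::nat. \<sigma> {})" by (rule sums_summable)
  then show ?thesis by (simp add: summable_const_iff)
qed

lemma signed_measure_Un:
  assumes "signed_measure M \<sigma>" "A \<in> sets M" "B \<in> sets M" "A \<inter> B = {}"
  shows "\<sigma> (A \<union> B) = \<sigma> A + \<sigma> B"
proof -
  have "range (binaryset A B) \<subseteq> sets M" using assms by (simp add: range_binaryset_eq)
  moreover have "disjoint_family (binaryset A B)"
    using assms(4) by (simp add: disjoint_family_on_def binaryset_def Int_commute)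
  ultimately have "(\<lambda>i. \<sigma> (binaryset A B i)) sums \<sigma> (\<Union>i. binaryset A B i)"
    using assms(1) unfolding signed_measure_def by blast
  then show ?thesis
    using binaryset_sums[of \<sigma> A B, OF signed_measure_empty[OF assms(1)]]
    by (simp add: UN_binaryset_eq sums_unique2)
qed

lemma ennreal_sums_le_suminf:
  fixes f :: "nat \<Rightarrow> real"
  assumes "f sums s"
  shows "ennreal s \<le> (\<Sum>i. ennreal (f i))"
proof (rule LIMSEQ_le_const2)
  show "(\<lambda>n. ennreal (\<Sum>i<n. f i)) \<longlonglongrightarrow> ennreal s"
    using assms by (intro tendsto_ennrealI) (simp add: sums_def)
  have "ennreal (\<Sum>i<n. f i) \<le> (\<Sum>i<n. ennreal (f i))" for n
  proof (induction n)
    case (Suc n)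
    have "ennreal (a + b) \<le> ennreal a + ennreal b" for a b
      by (cases "0 \<le> a"; cases "0 \<le> b") (auto simp: ennreal_neg not_le intro!: ennreal_leI add_nonpos_nonpos simp flip: ennreal_plus)
    from order_trans[OF this add_right_mono[OF Suc]] show ?case by simp
  qed simp
  moreover have "(\<Sum>i<n. ennreal (f i)) \<le> (\<Sum>i. ennreal (f i))" for n
    by (rule sum_le_suminf) auto
  ultimately show "\<exists>N. \<forall>n\<ge>N. ennreal (\<Sum>i<n. f i) \<le> (\<Sum>i. ennreal (f i))"
    using order_trans by blast
qed

lemma sets_positive_part [simp, measurable_cong]: "sets (positive_part M \<sigma>) = sets M"
  by (simp add: positive_part_def sets.space_closed)

lemma space_positive_part [simp]: "space (positive_part M \<sigma>) = space M"
  by (simp add: positive_part_def space_measure_of sets.space_closed)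

text \<open>
  The supremum defining the positive part is countably additive.  It is superadditive because
  subsets of disjoint sets can be united, and countably subadditive because a subset of a
  union splits into countably many pieces.
\<close>

lemma emeasure_positive_part:
  assumes \<sigma>: "signed_measure M \<sigma>" and A: "A \<in> sets M"
  shows "emeasure (positive_part M \<sigma>) A = (SUP B\<in>{B \<in> sets M. B \<subseteq> A}. ennreal (\<sigma> B))"
proof -
  \<comment> \<open>As \<open>ennreal\<close> sends negative reals to \<open>0\<close>, a set \<open>B\<close> with \<open>\<sigma> B < 0\<close> contributes as little as \<open>{}\<close>.\<close>
  define p where "p A = (SUP B\<in>{B \<in> sets M. B \<subseteq> A}. ennreal (\<sigma> B))" for A
  have upper: "ennreal (\<sigma> B) \<le> p A" if "B \<in> sets M" "B \<subseteq> A" for A B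
    unfolding p_def using that by (intro SUP_upper) auto
  have super: "p X + p Y \<le> p (X \<union> Y)" if "X \<inter> Y = {}" for X Y
  proof -
    have le: "ennreal (\<sigma> B) + ennreal (\<sigma> C) \<le> p (X \<union> Y)"
      if "B \<in> sets M" "B \<subseteq> X" "C \<in> sets M" "C \<subseteq> Y" for B C
    proof -
      have BC: "B \<union> C \<in> sets M" "B \<union> C \<subseteq> X \<union> Y" "B \<inter> C = {}"
        using that \<open>X \<inter> Y = {}\<close> by auto
      consider "\<sigma> B \<le> 0" | "\<sigma> C \<le> 0" | "0 \<le> \<sigma> B" "0 \<le> \<sigma> C" by linarith
      then show ?thesis
      proof cases
        case 1 then show ?thesis using upper[of C "X \<union> Y"] that by (auto simp: ennreal_neg)
      next
        case 2 then show ?thesis using upper[of B "X \<union> Y"] that by (auto simp: ennreal_neg)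
      next
        case 3 then show ?thesis
          using upper[OF BC(1,2)] signed_measure_Un[OF \<sigma> that(1,3) BC(3)] by simp
      qed
    qed
    have ne: "{B \<in> sets M. B \<subseteq> Z} \<noteq> {}" for Z by blast
    have "p X + ennreal (\<sigma> C) \<le> p (X \<union> Y)" if "C \<in> sets M" "C \<subseteq> Y" for C
      unfolding p_def[of X] ennreal_SUP_add_left[OF ne, symmetric]
      using le that by (intro SUP_least) auto
    then show ?thesis
      unfolding p_def[of Y] ennreal_SUP_add_right[OF ne]
      by (intro SUP_least) auto
  qed
  have "measure_space (space M) (sets M) p"
  proof (rule measure_space_def[THEN iffD2], intro conjI)
    show "sigma_algebra (space M) (sets M)" by (rule sets.sigma_algebra_axioms)
    show "positive (sets M) p"
      using signed_measure_empty[OF \<sigma>] by (auto simp: positive_def p_def bot_ennreal intro!: SUP_eq_const)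
    show "countably_additive (sets M) p"
      unfolding countably_additive_def
    proof (intro allI impI antisym)
      fix A :: "nat \<Rightarrow> 'a set"
      assume A: "range A \<subseteq> sets M" "disjoint_family A"
      have "(\<Sum>i<n. p (A i)) \<le> p (\<Union>i<n. A i)" for n
      proof (induction n)
        case (Suc n)
        have "(\<Sum>i<Suc n. p (A i)) \<le> p (\<Union>i<n. A i) + p (A n)"
          using Suc by (simp add: add_right_mono)
        also have "\<dots> \<le> p ((\<Union>i<n. A i) \<union> A n)"
        proof (intro super)
          have "A i \<inter> A n = {}" if "i < n" for i
            using A(2) that by (auto simp: disjoint_family_on_def)
          then show "(\<Union>i<n. A i) \<inter> A n = {}" by blast
        qed
        finally show ?case by (simp add: lessThan_Suc Un_commute)
      qed simp
      also have "p (\<Union>i<n. A i) \<le> p (\<Union>i. A i)" for n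
        unfolding p_def by (rule SUP_subset_mono) auto
      finally show "(\<Sum>i. p (A i)) \<le> p (\<Union>i. A i)"
        by (intro suminf_le_const) auto
      show "p (\<Union>i. A i) \<le> (\<Sum>i. p (A i))"
        unfolding p_def[of "\<Union>i. A i"]
      proof (rule SUP_least)
        fix B assume "B \<in> {B \<in> sets M. B \<subseteq> (\<Union>i. A i)}"
        then have B: "B \<in> sets M" "(\<Union>i. B \<inter> A i) = B" by auto
        have "disjoint_family (\<lambda>i. B \<inter> A i)"
          using A(2) by (auto simp: disjoint_family_on_def)
        moreover have "range (\<lambda>i. B \<inter> A i) \<subseteq> sets M" using A(1) B(1) by auto
        ultimately have "(\<lambda>i. \<sigma> (B \<inter> A i)) sums \<sigma> B"
          using \<sigma> B(2) unfolding signed_measure_def by metis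
        then have "ennreal (\<sigma> B) \<le> (\<Sum>i. ennreal (\<sigma> (B \<inter> A i)))"
          by (rule ennreal_sums_le_suminf)
        also have "\<dots> \<le> (\<Sum>i. p (A i))"
          using A(1) B(1) by (intro suminf_le upper) auto
        finally show "ennreal (\<sigma> B) \<le> (\<Sum>i. p (A i))" .
      qed
    qed
  qed
  then have "emeasure (measure_of (space M) (sets M) p) A = p A"
    using A by (subst emeasure_measure_of_conv) (simp_all add: sets.sigma_sets_eq)
  then show ?thesis by (simp add: positive_part_def p_def[abs_def])
qed

lemma finite_measure_positive_part:
  assumes \<sigma>: "signed_measure M \<sigma>"
  shows "finite_measure (positive_part M \<sigma>)"
proof
  obtain B where "\<And>A. \<bar>\<sigma> A\<bar> \<le> B" using \<sigma> by (auto simp: signed_measure_def)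
  then have "emeasure (positive_part M \<sigma>) (space M) \<le> ennreal B"
    unfolding emeasure_positive_part[OF \<sigma> sets.top]
    by (intro SUP_least ennreal_leI) (meson abs_le_D1)
  then show "emeasure (positive_part M \<sigma>) (space (positive_part M \<sigma>)) \<noteq> \<infinity>"
    by (auto simp: top_unique)
qed

lemma positive_part_upper:
  assumes \<sigma>: "signed_measure M \<sigma>" and "A \<in> sets M" "B \<in> sets M" "B \<subseteq> A"
  shows "\<sigma> B \<le> measure (positive_part M \<sigma>) A"
proof -
  interpret finite_measure "positive_part M \<sigma>" by (rule finite_measure_positive_part[OF \<sigma>])
  have "ennreal (\<sigma> B) \<le> ennreal (measure (positive_part M \<sigma>) A)"
    unfolding emeasure_eq_measure[symmetric] emeasure_positive_part[OF \<sigma> assms(2)]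
    using assms by (intro SUP_upper) auto
  then show ?thesis using measure_nonneg[of "positive_part M \<sigma>" A] by (auto simp: ennreal_le_iff2)
qed

text \<open>
  For \<open>B \<subseteq> A\<close> one has \<open>\<sigma> B = \<sigma> A - \<sigma> (A - B)\<close>, which is at most \<open>\<sigma> A\<close> plus the negative part of \<open>A\<close>;
  the supremum over \<open>B\<close> gives one inequality, and the same argument for \<open>- \<sigma>\<close> the other.
\<close>

lemma Jordan_decomposition:
  assumes \<sigma>: "signed_measure M \<sigma>" and A: "A \<in> sets M"
  shows "measure (positive_part M \<sigma>) A - measure (positive_part M (\<lambda>A. - \<sigma> A)) A = \<sigma> A"
proof -
  have *: "measure (positive_part M \<tau>) A \<le> \<tau> A + measure (positive_part M (\<lambda>A. - \<tau> A)) A"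
    if \<tau>: "signed_measure M \<tau>" for \<tau>
  proof -
    interpret finite_measure "positive_part M \<tau>" by (rule finite_measure_positive_part[OF \<tau>])
    let ?c = "\<tau> A + measure (positive_part M (\<lambda>A. - \<tau> A)) A"
    have le: "\<tau> B \<le> ?c" if "B \<in> sets M" "B \<subseteq> A" for B
    proof -
      have "\<tau> (B \<union> (A - B)) = \<tau> B + \<tau> (A - B)"
        using that A by (intro signed_measure_Un[OF \<tau>]) auto
      moreover have "B \<union> (A - B) = A" using that by auto
      moreover have "- \<tau> (A - B) \<le> measure (positive_part M (\<lambda>A. - \<tau> A)) A"
        using that A by (intro positive_part_upper signed_measure_uminus \<tau>) auto
      ultimately show ?thesis by simp
    qed
    have "0 \<le> ?c" using le[of "{}"] signed_measure_empty[OF \<tau>] by simp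
    moreover have "ennreal (measure (positive_part M \<tau>) A) \<le> ennreal ?c"
      unfolding emeasure_eq_measure[symmetric] emeasure_positive_part[OF \<tau> A]
      using le by (intro SUP_least ennreal_leI) auto
    ultimately show ?thesis by (simp add: ennreal_le_iff)
  qed
  from *[OF \<sigma>] *[OF signed_measure_uminus[OF \<sigma>]] show ?thesis by simp
qed

lemma integral_positive_part_nonpos:
  fixes F :: "'a \<Rightarrow> complex"
  assumes \<sigma>: "signed_measure M \<sigma>" and "\<And>A. A \<in> sets M \<Longrightarrow> \<sigma> A \<le> 0"
  shows "(LINT z|positive_part M \<sigma>. F z) = 0"
proof (rule integral_eq_zero_AE)
  have "emeasure (positive_part M \<sigma>) (space M) = 0"
    unfolding emeasure_positive_part[OF \<sigma> sets.top]
    using assms(2) by (intro antisym SUP_least) (auto simp: ennreal_neg)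
  then have "space M \<in> null_sets (positive_part M \<sigma>)" by (simp add: null_sets_def)
  from AE_not_in[OF this] AE_space show "AE z in positive_part M \<sigma>. F z = 0"
    by eventually_elim simp
qed

section \<open>Measures with a density\<close>

lemma set_integral_sums:
  fixes f :: "'a \<Rightarrow> 'b::{banach, second_countable_topology}"
  assumes f: "integrable M f" and A: "range A \<subseteq> sets M" "disjoint_family A"
  shows "(\<lambda>i::nat. LINT x:A i|M. f x) sums (LINT x:(\<Union>i. A i)|M. f x)"
proof -
  have A': "A i \<in> sets M" for i using A(1) by auto
  have int: "integrable M (\<lambda>x. indicator (A i) x *\<^sub>R f x)" for i
    by (rule integrable_mult_indicator[OF A' f])
  have "(\<lambda>n. LINT x|M. (\<Sum>i<n. indicator (A i) x *\<^sub>R f x)) \<longlonglongrightarrow> (LINT x|M. indicator (\<Union>i. A i) x *\<^sub>R f x)"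
  proof (rule integral_dominated_convergence)
    show "(\<lambda>x. indicator (\<Union>i. A i) x *\<^sub>R f x) \<in> borel_measurable M"
      by (intro borel_measurable_integrable integrable_mult_indicator f sets.countable_UN A(1))
    show "(\<lambda>x. \<Sum>i<n. indicator (A i) x *\<^sub>R f x) \<in> borel_measurable M" for n
      by (intro borel_measurable_sum borel_measurable_integrable int)
    show "integrable M (\<lambda>x. norm (f x))" by (rule integrable_norm[OF f])
    show "AE x in M. (\<lambda>n. \<Sum>i<n. indicator (A i) x *\<^sub>R f x) \<longlonglongrightarrow> indicator (\<Union>i. A i) x *\<^sub>R f x"
    proof (intro AE_I2)
      fix x
      have "(\<lambda>i. indicator (A i) x :: real) sums indicator (\<Union>i. A i) x"
        using A(2) by (intro indicator_sums) (auto simp: disjoint_family_on_def)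
      from sums_scaleR_left[OF this] show "(\<lambda>n. \<Sum>i<n. indicator (A i) x *\<^sub>R f x) \<longlonglongrightarrow> indicator (\<Union>i. A i) x *\<^sub>R f x"
        by (simp add: sums_def)
    qed
    show "AE x in M. norm (\<Sum>i<n. indicator (A i) x *\<^sub>R f x) \<le> norm (f x)" for n
    proof (intro AE_I2)
      fix x
      have dj: "disjoint_family_on A {..<n}" using A(2) by (auto simp: disjoint_family_on_def)
      have "(\<Sum>i<n. indicator (A i) x *\<^sub>R f x) = (\<Sum>i<n. indicator (A i) x :: real) *\<^sub>R f x"
        by (simp add: scaleR_sum_left)
      also have "(\<Sum>i<n. indicator (A i) x :: real) = indicator (\<Union>i<n. A i) x"
        by (rule indicator_UN_disjoint[OF finite_lessThan dj, symmetric])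
      finally show "norm (\<Sum>i<n. indicator (A i) x *\<^sub>R f x) \<le> norm (f x)"
        by (simp add: indicator_def)
    qed
  qed
  moreover have "(LINT x|M. (\<Sum>i<n. indicator (A i) x *\<^sub>R f x)) = (\<Sum>i<n. LINT x|M. indicator (A i) x *\<^sub>R f x)" for n
    by (rule Bochner_Integration.integral_sum) (rule int)
  ultimately show ?thesis
    unfolding sums_def set_lebesgue_integral_def by simp
qed

lemma complex_measure_torus_density:
  assumes g: "integrable (torus_leb n) g"
  shows "complex_measure (torus_borel n) (torus_density n g)"
  unfolding complex_measure_def
proof (intro conjI allI impI)
  show "torus_density n g A = 0" if "A \<notin> sets (torus_borel n)" for A
    using that by (simp add: torus_density_def)
  have sub: "A \<in> sets (torus_leb n)" if "A \<in> sets (torus_borel n)" for A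
    using that by (simp add: torus_leb_eq)
  have "norm (torus_density n g A) \<le> (LINT z|torus_leb n. norm (g z))" for A
  proof (cases "A \<in> sets (torus_borel n)")
    case True
    have "norm (LINT z|torus_leb n. indicator A z *\<^sub>R g z) \<le> (LINT z|torus_leb n. norm (indicator A z *\<^sub>R g z))"
      by (rule integral_norm_bound)
    also have "\<dots> \<le> (LINT z|torus_leb n. norm (g z))"
      by (intro integral_mono integrable_norm integrable_mult_indicator[OF sub[OF True] g] g) (auto simp: indicator_def)
    finally have "norm (LINT z|torus_leb n. indicator A z *\<^sub>R g z) \<le> (LINT z|torus_leb n. norm (g z))" .
    with True show ?thesis by (simp add: torus_density_def set_lebesgue_integral_def)
  qed (simp add: torus_density_def)
  then show "bounded (range (torus_density n g))" by (auto simp: bounded_iff)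
  fix A :: "nat \<Rightarrow> (nat \<Rightarrow> rmodz) set"
  assume A: "range A \<subseteq> sets (torus_borel n)" "disjoint_family A"
  then have "(\<Union>i. A i) \<in> sets (torus_borel n)" "\<And>i. A i \<in> sets (torus_borel n)" by auto
  then show "(\<lambda>i. torus_density n g (A i)) sums torus_density n g (\<Union>i. A i)"
    using set_integral_sums[OF g _ A(2)] sub A(1) by (simp add: torus_density_def image_subset_iff)
qed

lemma torus_density_borel:
  fixes g :: "(nat \<Rightarrow> rmodz) \<Rightarrow> complex"
  assumes [measurable]: "g \<in> borel_measurable (torus_borel n)" and A [measurable]: "A \<in> sets (torus_borel n)"
  shows "torus_density n g A = (LINT z:A|torus_haar n. g z)"
  using A unfolding torus_density_def torus_leb_eq set_lebesgue_integral_def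
  by (simp, intro integral_completion) measurable

text \<open>
  The real part of the measure is nonnegative, so its positive part is the measure with density \<open>g\<close>,
  and the three other parts vanish.
\<close>

lemma complex_integral_torus_density:
  fixes g :: "(nat \<Rightarrow> rmodz) \<Rightarrow> real" and F :: "(nat \<Rightarrow> rmodz) \<Rightarrow> complex"
  assumes g: "integrable (torus_haar n) g" and nonneg: "\<And>z. 0 \<le> g z"
    and F: "F \<in> borel_measurable (torus_borel n)"
  shows "complex_integral (torus_borel n) (torus_density n (\<lambda>z. complex_of_real (g z))) F
    = (LINT z|torus_haar n. g z *\<^sub>R F z)"
proof -
  let ?M = "torus_borel n"
  define \<nu> where "\<nu> = torus_density n (\<lambda>z. complex_of_real (g z))"
  have [measurable]: "g \<in> borel_measurable ?M"
    using borel_measurable_integrable[OF g] by (simp cong: measurable_cong_sets)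
  have gc: "integrable (torus_leb n) (\<lambda>z. complex_of_real (g z))"
    unfolding torus_leb_eq by (subst integrable_completion) (simp_all add: g)
  have \<nu>: "complex_measure ?M \<nu>"
    unfolding \<nu>_def by (rule complex_measure_torus_density[OF gc])
  have \<nu>_A: "\<nu> A = complex_of_real (LINT z:A|torus_haar n. g z)" if "A \<in> sets ?M" for A
    using that by (simp add: \<nu>_def torus_density_borel set_integral_complex_of_real)
  have int_A: "ennreal (LINT z:A|torus_haar n. g z) = (\<integral>\<^sup>+z\<in>A. ennreal (g z) \<partial>torus_haar n)"
    and nn_A: "0 \<le> (LINT z:A|torus_haar n. g z)" if "A \<in> sets ?M" for A
  proof -
    have "integrable (torus_haar n) (\<lambda>z. indicator A z *\<^sub>R g z)"
      using that by (intro integrable_mult_indicator g) simp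
    then show "ennreal (LINT z:A|torus_haar n. g z) = (\<integral>\<^sup>+z\<in>A. ennreal (g z) \<partial>torus_haar n)"
      unfolding set_lebesgue_integral_def
      by (subst nn_integral_eq_integral[symmetric])
         (auto simp: nonneg indicator_def intro!: nn_integral_cong)
    show "0 \<le> (LINT z:A|torus_haar n. g z)"
      unfolding set_lebesgue_integral_def by (intro integral_nonneg_AE) (auto simp: nonneg)
  qed
  have "positive_part ?M (\<lambda>A. Re (\<nu> A)) = density (torus_haar n) (\<lambda>z. ennreal (g z))"
  proof (rule measure_eqI)
    fix A assume "A \<in> sets (positive_part ?M (\<lambda>A. Re (\<nu> A)))"
    then have A: "A \<in> sets ?M" by simp
    have "emeasure (positive_part ?M (\<lambda>A. Re (\<nu> A))) A
      = (SUP B\<in>{B \<in> sets ?M. B \<subseteq> A}. \<integral>\<^sup>+z\<in>B. ennreal (g z) \<partial>torus_haar n)"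
      unfolding emeasure_positive_part[OF complex_measure_Re[OF \<nu>] A]
      by (intro SUP_cong refl) (simp add: \<nu>_A int_A)
    also have "\<dots> = (\<integral>\<^sup>+z\<in>A. ennreal (g z) \<partial>torus_haar n)"
      using A by (intro antisym SUP_least SUP_upper nn_integral_mono) (auto simp: indicator_def)
    also have "\<dots> = emeasure (density (torus_haar n) (\<lambda>z. ennreal (g z))) A"
      using A by (subst emeasure_density) simp_all
    finally show "emeasure (positive_part ?M (\<lambda>A. Re (\<nu> A))) A
      = emeasure (density (torus_haar n) (\<lambda>z. ennreal (g z))) A" .
  qed simp
  moreover have "(LINT z|density (torus_haar n) (\<lambda>z. ennreal (g z)). F z) = (LINT z|torus_haar n. g z *\<^sub>R F z)"
    using F by (intro integral_density) (auto simp: nonneg cong: measurable_cong_sets)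
  moreover have "(LINT z|positive_part ?M (\<lambda>A. - Re (\<nu> A)). F z) = 0"
    using nn_A by (intro integral_positive_part_nonpos signed_measure_uminus complex_measure_Re[OF \<nu>]) (simp add: \<nu>_A)
  moreover have "(LINT z|positive_part ?M (\<lambda>A. Im (\<nu> A)). F z) = 0"
    by (intro integral_positive_part_nonpos complex_measure_Im[OF \<nu>]) (simp add: \<nu>_A)
  moreover have "(LINT z|positive_part ?M (\<lambda>A. - Im (\<nu> A)). F z) = 0"
    by (intro integral_positive_part_nonpos signed_measure_uminus complex_measure_Im[OF \<nu>]) (simp add: \<nu>_A)
  ultimately show ?thesis
    by (simp add: complex_integral_def flip: \<nu>_def)
qed

section \<open>Complex measures are determined by continuous functions\<close>

definition open_boxes :: "nat \<Rightarrow> (nat \<Rightarrow> rmodz) set set" where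
  "open_boxes n = {Pi\<^sub>E {..<n} A |A. \<forall>i<n. open (A i)}"

lemma sets_torus_borel_eq_open_boxes: "sets (torus_borel n) = sigma_sets (torus n) (open_boxes n)"
proof -
  let ?E = "\<lambda>i::nat. {S::rmodz set. open S}"
  let ?P = "{{f \<in> (\<Pi>\<^sub>E i\<in>{..<n}. UNIV). \<forall>i\<in>j. f i \<in> A i} |A j. j \<in> {{..<n}} \<and> A \<in> Pi j ?E}"
  have P: "?P = open_boxes n"
  proof (intro equalityI subsetI)
    fix B assume "B \<in> ?P"
    then obtain A where "B = {f \<in> (\<Pi>\<^sub>E i\<in>{..<n}. UNIV). \<forall>i<n. f i \<in> A i}" "\<forall>i<n. open (A i)" by auto
    moreover from this have "B = Pi\<^sub>E {..<n} A" by (auto simp: PiE_iff extensional_def)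
    ultimately show "B \<in> open_boxes n" unfolding open_boxes_def by blast
  next
    fix B assume "B \<in> open_boxes n"
    then obtain A where A: "B = Pi\<^sub>E {..<n} A" "\<forall>i<n. open (A i)" by (auto simp: open_boxes_def)
    then have "B = {f \<in> (\<Pi>\<^sub>E i\<in>{..<n}. UNIV). \<forall>i\<in>{..<n}. f i \<in> A i}" by (auto simp: PiE_iff extensional_def)
    moreover have "A \<in> Pi {..<n} ?E" using A by auto
    ultimately show "B \<in> ?P" by blast
  qed
  have "sets (torus_borel n) = sets (\<Pi>\<^sub>M i\<in>{..<n}. sigma UNIV {S::rmodz set. open S})"
    by (simp add: torus_borel_def borel_def)
  also have "\<dots> = sets (sigma (\<Pi>\<^sub>E i\<in>{..<n}. UNIV) ?P)"
    by (rule sets_PiM_sigma) (auto intro!: exI[of _ "{UNIV}"])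
  also have "\<dots> = sigma_sets (torus n) (open_boxes n)"
    unfolding P by (subst sets_measure_of) (auto simp: torus_def open_boxes_def PiE_iff)
  finally show ?thesis .
qed

lemma Int_stable_open_boxes: "Int_stable (open_boxes n)"
proof (rule Int_stableI)
  fix X Y assume "X \<in> open_boxes n" "Y \<in> open_boxes n"
  then obtain A B where "X = Pi\<^sub>E {..<n} A" "\<forall>i<n. open (A i)" "Y = Pi\<^sub>E {..<n} B" "\<forall>i<n. open (B i)"
    by (auto simp: open_boxes_def)
  then have "X \<inter> Y = Pi\<^sub>E {..<n} (\<lambda>i. A i \<inter> B i)" "\<forall>i<n. open (A i \<inter> B i)"
    by (auto simp: PiE_Int)
  then show "X \<inter> Y \<in> open_boxes n" unfolding open_boxes_def by blast
qed

lemma open_boxes_subset: "open_boxes n \<subseteq> Pow (torus n)"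
  by (auto simp: open_boxes_def torus_def PiE_iff)

text \<open>
  Take \<open>h m t = min 1 (m \<cdot> \<delta> t)\<close>, where \<open>\<delta>\<close> vanishes exactly off \<open>U\<close>.
\<close>

lemma continuous_approximation_open_rmodz:
  fixes U :: "rmodz set"
  assumes "open U"
  obtains h :: "nat \<Rightarrow> rmodz \<Rightarrow> real"
    where "\<And>m. continuous_on UNIV (h m)" "\<And>m t. 0 \<le> h m t" "\<And>m t. h m t \<le> 1"
      "\<And>t. (\<lambda>m. h m t) \<longlonglongrightarrow> indicator U t"
proof (cases "U = UNIV")
  case True
  show ?thesis by (rule that[of "\<lambda>_ _. 1"]) (auto simp: True)
next
  case False
  then obtain \<delta> :: "rmodz \<Rightarrow> real" where \<delta>: "continuous_on UNIV \<delta>" "\<And>t. 0 \<le> \<delta> t" "\<And>t. \<delta> t = 0 \<longleftrightarrow> t \<in> - U"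
    using closed_rmodz_distance_function[of "- U"] assms by (auto simp: closed_def)
  show ?thesis
  proof (rule that[of "\<lambda>m t. min 1 (real m * \<delta> t)"])
    show "continuous_on UNIV (\<lambda>t. min 1 (real m * \<delta> t))" for m
      by (intro continuous_intros \<delta>)
    show "0 \<le> min 1 (real m * \<delta> t)" "min 1 (real m * \<delta> t) \<le> 1" for m t
      using \<delta>(2) by auto
    show "(\<lambda>m. min 1 (real m * \<delta> t)) \<longlonglongrightarrow> indicator U t" for t
    proof (cases "t \<in> U")
      case True
      then have "0 < \<delta> t" using \<delta>(2,3)[of t] by (simp add: less_le)
      have "eventually (\<lambda>m. 1 / \<delta> t \<le> real m) sequentially"
        using filterlim_real_sequentially by (simp add: filterlim_at_top)
      then have "eventually (\<lambda>m. min 1 (real m * \<delta> t) = 1) sequentially"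
        by eventually_elim (use \<open>0 < \<delta> t\<close> in \<open>simp add: field_simps min_def\<close>)
      then show ?thesis using True by (simp add: tendsto_eventually)
    next
      case False
      then show ?thesis using \<delta>(3)[of t] by simp
    qed
  qed
qed

lemma continuous_approximation_open_box:
  assumes "B \<in> open_boxes n"
  obtains h :: "nat \<Rightarrow> (nat \<Rightarrow> rmodz) \<Rightarrow> real"
    where "\<And>m. continuous_on (torus n) (h m)" "\<And>m z. \<bar>h m z\<bar> \<le> 1"
      "\<And>z. z \<in> torus n \<Longrightarrow> (\<lambda>m. h m z) \<longlonglongrightarrow> indicator B z"
proof -
  obtain A where B: "B = Pi\<^sub>E {..<n} A" and A: "\<And>i. i < n \<Longrightarrow> open (A i)"
    using assms by (auto simp: open_boxes_def)
  have "\<exists>h :: nat \<Rightarrow> rmodz \<Rightarrow> real. i < n \<longrightarrow> (\<forall>m. continuous_on UNIV (h m)) \<and>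
      (\<forall>m t. 0 \<le> h m t \<and> h m t \<le> 1) \<and> (\<forall>t. (\<lambda>m. h m t) \<longlonglongrightarrow> indicator (A i) t)" for i
  proof (cases "i < n")
    case True
    obtain h :: "nat \<Rightarrow> rmodz \<Rightarrow> real" where "\<And>m. continuous_on UNIV (h m)" "\<And>m t. 0 \<le> h m t" "\<And>m t. h m t \<le> 1"
      "\<And>t. (\<lambda>m. h m t) \<longlonglongrightarrow> indicator (A i) t"
      using continuous_approximation_open_rmodz[OF A[OF True]] by blast
    then show ?thesis by blast
  qed blast
  then obtain h :: "nat \<Rightarrow> nat \<Rightarrow> rmodz \<Rightarrow> real" where h: "\<And>i m. i < n \<Longrightarrow> continuous_on UNIV (h i m)"
      "\<And>i m t. i < n \<Longrightarrow> 0 \<le> h i m t \<and> h i m t \<le> 1"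
      "\<And>i t. i < n \<Longrightarrow> (\<lambda>m. h i m t) \<longlonglongrightarrow> indicator (A i) t"
    by metis
  show ?thesis
  proof (rule that[of "\<lambda>m z. \<Prod>i<n. h i m (z i)"])
    show "continuous_on (torus n) (\<lambda>z. \<Prod>i<n. h i m (z i))" for m
    proof (intro continuous_on_prod)
      fix i assume "i \<in> {..<n}"
      then show "continuous_on (torus n) (\<lambda>z. h i m (z i))"
        by (intro continuous_on_compose2[OF h(1)] continuous_on_subset[OF continuous_on_product_coordinates]) auto
    qed
    show "\<bar>\<Prod>i<n. h i m (z i)\<bar> \<le> 1" for m z
      using h(2) by (simp add: abs_prod) (intro prod_le_1, auto)
    fix z assume "z \<in> torus n"
    have "(\<lambda>m. \<Prod>i<n. h i m (z i)) \<longlonglongrightarrow> (\<Prod>i<n. indicator (A i) (z i))"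
      using h(3) by (intro tendsto_prod) auto
    moreover have "(\<Prod>i<n. indicator (A i) (z i) :: real) = indicator B z"
      using \<open>z \<in> torus n\<close> by (auto simp: indicator_def B torus_def PiE_iff prod_zero_iff)
    ultimately show "(\<lambda>m. \<Prod>i<n. h i m (z i)) \<longlonglongrightarrow> indicator B z" by simp
  qed
qed

lemma complex_integral_tendsto_indicator:
  fixes h :: "nat \<Rightarrow> 'a \<Rightarrow> real"
  assumes \<nu>: "complex_measure M \<nu>" and B: "B \<in> sets M"
    and h: "\<And>m. h m \<in> borel_measurable M" "\<And>m z. \<bar>h m z\<bar> \<le> 1"
      "\<And>z. z \<in> space M \<Longrightarrow> (\<lambda>m. h m z) \<longlonglongrightarrow> indicator B z"
  shows "(\<lambda>m. complex_integral M \<nu> (\<lambda>z. complex_of_real (h m z))) \<longlonglongrightarrow> \<nu> B"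
proof -
  have lim: "(\<lambda>m. LINT z|positive_part M \<sigma>. complex_of_real (h m z))
      \<longlonglongrightarrow> complex_of_real (measure (positive_part M \<sigma>) B)" if \<sigma>: "signed_measure M \<sigma>" for \<sigma>
  proof -
    interpret finite_measure "positive_part M \<sigma>" by (rule finite_measure_positive_part[OF \<sigma>])
    have "(\<lambda>m. LINT z|positive_part M \<sigma>. h m z) \<longlonglongrightarrow> (LINT z|positive_part M \<sigma>. indicator B z)"
      by (rule integral_dominated_convergence[where w = "\<lambda>_. 1"])
         (use B h in \<open>auto cong: measurable_cong_sets\<close>)
    then have "(\<lambda>m. LINT z|positive_part M \<sigma>. h m z) \<longlonglongrightarrow> measure (positive_part M \<sigma>) B"
      using sets.sets_into_space[OF B] by (simp add: Int_absorb1 Int_absorb2)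
    from tendsto_of_real[OF this] show ?thesis by simp
  qed
  note Re = complex_measure_Re[OF \<nu>] and Im = complex_measure_Im[OF \<nu>]
  let ?L = "complex_of_real (measure (positive_part M (\<lambda>A. Re (\<nu> A))) B)
      - complex_of_real (measure (positive_part M (\<lambda>A. - Re (\<nu> A))) B)
      + \<i> * (complex_of_real (measure (positive_part M (\<lambda>A. Im (\<nu> A))) B)
      - complex_of_real (measure (positive_part M (\<lambda>A. - Im (\<nu> A))) B))"
  have "(\<lambda>m. complex_integral M \<nu> (\<lambda>z. complex_of_real (h m z))) \<longlonglongrightarrow> ?L"
    unfolding complex_integral_def
    by (intro tendsto_add tendsto_diff tendsto_mult tendsto_const lim Re Im signed_measure_uminus)
  moreover have "?L = complex_of_real (Re (\<nu> B)) + \<i> * complex_of_real (Im (\<nu> B))"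
    unfolding of_real_diff[symmetric] Jordan_decomposition[OF Re B] Jordan_decomposition[OF Im B] ..
  ultimately show ?thesis by (simp flip: complex_eq)
qed

text \<open>
  Indicator functions of open boxes are limits of bounded sequences of continuous functions, so the
  measures agree on open boxes, and by Dynkin's lemma on all Borel sets.
\<close>

lemma complex_measure_eqI_continuous:
  assumes \<rho>1: "complex_measure (torus_borel n) \<rho>1" and \<rho>2: "complex_measure (torus_borel n) \<rho>2"
    and eq: "\<And>F. continuous_on (torus n) F \<Longrightarrow>
      complex_integral (torus_borel n) \<rho>1 F = complex_integral (torus_borel n) \<rho>2 F"
  shows "\<rho>1 = \<rho>2"
proof
  fix A
  show "\<rho>1 A = \<rho>2 A"
  proof (cases "A \<in> sets (torus_borel n)")
    case False
    then show ?thesis using \<rho>1 \<rho>2 by (simp add: complex_measure_def)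
  next
    case True
    have box: "\<rho>1 B = \<rho>2 B" if B: "B \<in> open_boxes n" for B
    proof -
      obtain h :: "nat \<Rightarrow> (nat \<Rightarrow> rmodz) \<Rightarrow> real" where h: "\<And>m. continuous_on (torus n) (h m)" "\<And>m z. \<bar>h m z\<bar> \<le> 1"
          "\<And>z. z \<in> torus n \<Longrightarrow> (\<lambda>m. h m z) \<longlonglongrightarrow> indicator B z"
        using continuous_approximation_open_box[OF B] by blast
      have Bs: "B \<in> sets (torus_borel n)"
        using B by (simp add: sets_torus_borel_eq_open_boxes sigma_sets.Basic)
      have "(\<lambda>m. complex_integral (torus_borel n) \<rho> (\<lambda>z. complex_of_real (h m z))) \<longlonglongrightarrow> \<rho> B"
        if "complex_measure (torus_borel n) \<rho>" for \<rho>
        using h by (intro complex_integral_tendsto_indicator[OF that Bs] borel_measurable_continuous_on_torus) auto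
      from this[OF \<rho>1] this[OF \<rho>2] show ?thesis
        using eq[OF continuous_on_of_real[OF h(1)]] by (simp add: LIMSEQ_unique)
    qed
    have diff: "\<rho> (torus n - B) = \<rho> (torus n) - \<rho> B"
      if \<rho>: "complex_measure (torus_borel n) \<rho>" and B: "B \<in> sets (torus_borel n)" for \<rho> B
    proof -
      have top: "torus n \<in> sets (torus_borel n)" using sets.top[of "torus_borel n"] by simp
      have "B \<union> (torus n - B) = torus n" using sets.sets_into_space[OF B] by auto
      then show ?thesis
        using signed_measure_Un[OF complex_measure_Re[OF \<rho>] B, of "torus n - B"]
          signed_measure_Un[OF complex_measure_Im[OF \<rho>] B, of "torus n - B"] B top
        by (simp add: complex_eq_iff)
    qed
    have "torus n \<in> open_boxes n"
      unfolding open_boxes_def torus_def by (auto intro!: exI[of _ "\<lambda>_. UNIV"])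
    from True show ?thesis
      unfolding sets_torus_borel_eq_open_boxes
    proof (induction rule: sigma_sets_induct_disjoint[OF Int_stable_open_boxes open_boxes_subset,
          consumes 1, case_names basic empty compl union])
      case (basic B) then show ?case by (rule box)
    next
      case empty
      show ?case
        using signed_measure_empty[OF complex_measure_Re[OF \<rho>1]] signed_measure_empty[OF complex_measure_Re[OF \<rho>2]]
          signed_measure_empty[OF complex_measure_Im[OF \<rho>1]] signed_measure_empty[OF complex_measure_Im[OF \<rho>2]]
        by (simp add: complex_eq_iff)
    next
      case (compl B)
      then have "B \<in> sets (torus_borel n)" by (simp add: sets_torus_borel_eq_open_boxes)
      then show ?case
        using diff[OF \<rho>1] diff[OF \<rho>2] compl(2) box[OF \<open>torus n \<in> open_boxes n\<close>] by simp
    next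
      case (union C)
      then have "range C \<subseteq> sets (torus_borel n)" by (simp add: sets_torus_borel_eq_open_boxes)
      then have "(\<lambda>i. \<rho>1 (C i)) sums \<rho>1 (\<Union>i. C i)" "(\<lambda>i. \<rho>2 (C i)) sums \<rho>2 (\<Union>i. C i)"
        using \<rho>1 \<rho>2 union(1) by (simp_all add: complex_measure_def)
      then show ?case using union(3) by (simp add: sums_unique2)
    qed
  qed
qed

section \<open>Convergence of smoothings in mean\<close>

text \<open>
  Convergence in \<open>L\<^sup>1\<close>, phrased with nonnegative integrals so that integrability need not be known
  beforehand.
\<close>

definition tends_L1 :: "'a measure \<Rightarrow> (nat \<Rightarrow> 'a \<Rightarrow> real) \<Rightarrow> ('a \<Rightarrow> real) \<Rightarrow> bool" where
  "tends_L1 M a b \<longleftrightarrow>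
     (\<forall>\<epsilon>>0. \<forall>\<^sub>F j in sequentially. (\<integral>\<^sup>+z. ennreal \<bar>a j z - b z\<bar> \<partial>M) \<le> ennreal \<epsilon>)"

lemma tends_L1I:
  assumes "(\<lambda>j. \<integral>\<^sup>+z. ennreal \<bar>a j z - b z\<bar> \<partial>M) \<longlonglongrightarrow> 0"
  shows "tends_L1 M a b"
  unfolding tends_L1_def
proof (intro allI impI)
  fix \<epsilon> :: real assume "0 < \<epsilon>"
  then have "\<forall>\<^sub>F j in sequentially. (\<integral>\<^sup>+z. ennreal \<bar>a j z - b z\<bar> \<partial>M) < ennreal \<epsilon>"
    by (intro order_tendstoD(2)[OF assms]) simp
  then show "\<forall>\<^sub>F j in sequentially. (\<integral>\<^sup>+z. ennreal \<bar>a j z - b z\<bar> \<partial>M) \<le> ennreal \<epsilon>"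
    by eventually_elim simp
qed

text \<open>
  Integrate \<open>\<bar>a - b\<bar> + b = 2 (b - a)\<^sup>+ + a\<close>.  Thus an upper bound on the total mass of \<open>a\<close> turns
  control of \<open>a\<close> from below into convergence in \<open>L\<^sup>1\<close>.
\<close>

lemma nn_integral_abs_diff_le:
  fixes a b :: "'a \<Rightarrow> real"
  assumes [measurable]: "a \<in> borel_measurable M" "b \<in> borel_measurable M"
    and nonneg: "\<And>z. z \<in> space M \<Longrightarrow> 0 \<le> a z" "\<And>z. z \<in> space M \<Longrightarrow> 0 \<le> b z"
    and le: "(\<integral>\<^sup>+z. ennreal (a z) \<partial>M) \<le> (\<integral>\<^sup>+z. ennreal (b z) \<partial>M)"
    and fin: "(\<integral>\<^sup>+z. ennreal (b z) \<partial>M) < \<infinity>"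
  shows "(\<integral>\<^sup>+z. ennreal \<bar>a z - b z\<bar> \<partial>M) \<le> 2 * (\<integral>\<^sup>+z. ennreal (b z - a z) \<partial>M)"
proof -
  have "(\<integral>\<^sup>+z. ennreal \<bar>a z - b z\<bar> \<partial>M) + (\<integral>\<^sup>+z. ennreal (b z) \<partial>M)
    = (\<integral>\<^sup>+z. ennreal \<bar>a z - b z\<bar> + ennreal (b z) \<partial>M)"
    by (rule nn_integral_add[symmetric]) measurable
  also have "\<dots> = (\<integral>\<^sup>+z. 2 * ennreal (b z - a z) + ennreal (a z) \<partial>M)"
  proof (rule nn_integral_cong)
    fix z assume z: "z \<in> space M"
    show "ennreal \<bar>a z - b z\<bar> + ennreal (b z) = 2 * ennreal (b z - a z) + ennreal (a z)"
    proof (cases "a z \<le> b z")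
      case True
      then have "2 * ennreal (b z - a z) = ennreal (2 * (b z - a z))"
        using ennreal_mult[of 2 "b z - a z"] by simp
      with True show ?thesis using nonneg[OF z] by (simp flip: ennreal_plus)
    next
      case False
      then show ?thesis using nonneg[OF z] by (simp add: ennreal_neg flip: ennreal_plus)
    qed
  qed
  also have "\<dots> = 2 * (\<integral>\<^sup>+z. ennreal (b z - a z) \<partial>M) + (\<integral>\<^sup>+z. ennreal (a z) \<partial>M)"
    by (simp add: nn_integral_add nn_integral_cmult)
  also have "\<dots> \<le> 2 * (\<integral>\<^sup>+z. ennreal (b z - a z) \<partial>M) + (\<integral>\<^sup>+z. ennreal (b z) \<partial>M)"
    using le by (rule add_left_mono)
  finally show ?thesis using fin by (auto simp: ennreal_add_left_cancel_le add.commute[of _ "\<integral>\<^sup>+z. ennreal (b z) \<partial>M"])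
qed

text \<open>
  The convolution \<open>\<psi> * g\<close>.
\<close>

definition smoothing :: "nat \<Rightarrow> ((nat \<Rightarrow> rmodz) \<Rightarrow> real) \<Rightarrow> ((nat \<Rightarrow> rmodz) \<Rightarrow> real) \<Rightarrow> (nat \<Rightarrow> rmodz) \<Rightarrow> real" where
  "smoothing n \<psi> g z = (LINT w|torus_haar n. \<psi> (torus_diff n z w) * g w)"

locale torus_kernel =
  fixes n :: nat and \<psi> :: "(nat \<Rightarrow> rmodz) \<Rightarrow> real"
  assumes continuous: "continuous_on (torus n) \<psi>"
    and nonneg: "\<And>z. z \<in> torus n \<Longrightarrow> 0 \<le> \<psi> z"
    and integral_eq_1: "(LINT z|torus_leb n. \<psi> z) = 1"
begin

lemma measurable_kernel [measurable]: "\<psi> \<in> borel_measurable (torus_borel n)"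
  by (rule borel_measurable_continuous_on_torus[OF continuous])

lemma integrable_kernel: "integrable (torus_haar n) \<psi>"
proof -
  have "integrable (torus_leb n) \<psi>"
    using integral_eq_1 not_integrable_integral_eq by fastforce
  then show ?thesis unfolding torus_leb_eq by (subst (asm) integrable_completion) simp_all
qed

lemma nn_integral_kernel: "(\<integral>\<^sup>+z. ennreal (\<psi> z) \<partial>torus_haar n) = 1"
proof -
  have "(LINT z|torus_haar n. \<psi> z) = 1"
    using integral_eq_1 unfolding torus_leb_eq by (subst (asm) integral_completion) simp_all
  then show ?thesis
    by (subst nn_integral_eq_integral[OF integrable_kernel]) (auto intro!: AE_I2 simp: nonneg)
qed

lemma integrable_smoothing:
  assumes g: "integrable (torus_haar n) g"
  shows "integrable (torus_haar n) (\<lambda>w. \<psi> (torus_diff n z w) * g w)"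
proof -
  obtain B where B: "0 \<le> B" "\<And>z. z \<in> torus n \<Longrightarrow> norm (\<psi> z) \<le> B"
    using continuous_on_torus_bounded[OF continuous] by blast
  have [measurable]: "g \<in> borel_measurable (torus_haar n)"
    by (rule borel_measurable_integrable[OF g])
  show ?thesis
  proof (rule Bochner_Integration.integrable_bound)
    show "integrable (torus_haar n) (\<lambda>w. B * g w)" using g by simp
    show "(\<lambda>w. \<psi> (torus_diff n z w) * g w) \<in> borel_measurable (torus_haar n)"
      by measurable
    show "AE w in torus_haar n. norm (\<psi> (torus_diff n z w) * g w) \<le> norm (B * g w)"
      using B by (intro AE_I2) (simp add: abs_mult mult_right_mono)
  qed
qed

lemma measurable_smoothing [measurable]:
  assumes [measurable]: "g \<in> borel_measurable (torus_borel n)"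
  shows "smoothing n \<psi> g \<in> borel_measurable (torus_borel n)"
  unfolding smoothing_def[abs_def] by measurable

lemma smoothing_nonneg: "(\<And>w. w \<in> torus n \<Longrightarrow> 0 \<le> g w) \<Longrightarrow> 0 \<le> smoothing n \<psi> g z"
  unfolding smoothing_def by (rule Bochner_Integration.integral_nonneg) (simp add: nonneg)

lemma smoothing_add:
  assumes "integrable (torus_haar n) g" "integrable (torus_haar n) h"
  shows "smoothing n \<psi> (\<lambda>z. g z + h z) z = smoothing n \<psi> g z + smoothing n \<psi> h z"
  unfolding smoothing_def
  using Bochner_Integration.integral_add[OF integrable_smoothing[OF assms(1)] integrable_smoothing[OF assms(2)]]
  by (simp add: distrib_left)

lemma smoothing_diff:
  assumes "integrable (torus_haar n) g" "integrable (torus_haar n) h"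
  shows "smoothing n \<psi> (\<lambda>z. g z - h z) z = smoothing n \<psi> g z - smoothing n \<psi> h z"
  unfolding smoothing_def
  using Bochner_Integration.integral_diff[OF integrable_smoothing[OF assms(1)] integrable_smoothing[OF assms(2)]]
  by (simp add: right_diff_distrib)

lemma smoothing_mult_right: "smoothing n \<psi> (\<lambda>z. g z * c) z = smoothing n \<psi> g z * c"
  unfolding smoothing_def by (simp add: mult.assoc[symmetric])

lemma nn_integral_reflect:
  assumes [measurable]: "h \<in> borel_measurable (torus_borel n)"
  shows "(\<integral>\<^sup>+w. h (torus_diff n z w) \<partial>torus_haar n) = (\<integral>\<^sup>+w. h w \<partial>torus_haar n)"
  by (rule nn_integral_torus_haar_invariant[OF distr_torus_haar_reflect]) measurable

lemma torus_diff_torus_diff: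
  "w \<in> torus n \<Longrightarrow> torus_diff n z (torus_diff n z w) = w"
  by (auto simp: torus_diff_def torus_def PiE_iff extensional_def fun_eq_iff)

text \<open>
  Substituting \<open>z - w\<close> for \<open>w\<close> exhibits the smoothing as an average of translates of \<open>g\<close> with
  weight \<open>\<psi>\<close>.
\<close>

lemma nn_smoothing:
  assumes g: "integrable (torus_haar n) g" and g0: "\<And>w. w \<in> torus n \<Longrightarrow> 0 \<le> g w"
  shows "ennreal (smoothing n \<psi> g z) = (\<integral>\<^sup>+w. ennreal (\<psi> w) * ennreal (g (torus_diff n z w)) \<partial>torus_haar n)"
proof -
  have [measurable]: "g \<in> borel_measurable (torus_borel n)"
    using borel_measurable_integrable[OF g] by (simp cong: measurable_cong_sets)
  have "ennreal (smoothing n \<psi> g z) = (\<integral>\<^sup>+w. ennreal (\<psi> (torus_diff n z w) * g w) \<partial>torus_haar n)"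
    unfolding smoothing_def
    by (rule nn_integral_eq_integral[symmetric, OF integrable_smoothing[OF g]]) (intro AE_I2, simp add: g0 nonneg)
  also have "\<dots> = (\<integral>\<^sup>+w. (\<lambda>w. ennreal (\<psi> w) * ennreal (g (torus_diff n z w))) (torus_diff n z w) \<partial>torus_haar n)"
    by (rule nn_integral_cong) (simp add: torus_diff_torus_diff ennreal_mult g0 nonneg)
  also have "\<dots> = (\<integral>\<^sup>+w. ennreal (\<psi> w) * ennreal (g (torus_diff n z w)) \<partial>torus_haar n)"
    by (rule nn_integral_reflect) measurable
  finally show ?thesis .
qed

lemma smoothing_1: "smoothing n \<psi> (\<lambda>_. 1) z = 1"
proof -
  have "ennreal (smoothing n \<psi> (\<lambda>_. 1) z) = 1"
    by (subst nn_smoothing) (simp_all add: nn_integral_kernel)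
  then show ?thesis by (simp add: ennreal_eq_1)
qed

text \<open>
  By Fubini, as the integral of \<open>\<psi> (z - w)\<close> over \<open>z\<close> is \<open>1\<close> for each \<open>w\<close>.
\<close>

lemma nn_integral_smoothing_le:
  assumes g: "integrable (torus_haar n) g"
  shows "(\<integral>\<^sup>+z. ennreal \<bar>smoothing n \<psi> g z\<bar> \<partial>torus_haar n) \<le> (\<integral>\<^sup>+z. ennreal \<bar>g z\<bar> \<partial>torus_haar n)"
proof -
  have [measurable]: "g \<in> borel_measurable (torus_borel n)"
    using borel_measurable_integrable[OF g] by (simp cong: measurable_cong_sets)
  have "(\<integral>\<^sup>+z. ennreal \<bar>smoothing n \<psi> g z\<bar> \<partial>torus_haar n)
    \<le> (\<integral>\<^sup>+z. \<integral>\<^sup>+w. ennreal (\<psi> (torus_diff n z w)) * ennreal \<bar>g w\<bar> \<partial>torus_haar n \<partial>torus_haar n)"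
  proof (rule nn_integral_mono)
    fix z
    have "ennreal \<bar>smoothing n \<psi> g z\<bar> \<le> (\<integral>\<^sup>+w. ennreal \<bar>\<psi> (torus_diff n z w) * g w\<bar> \<partial>torus_haar n)"
      using integral_norm_bound_ennreal[OF integrable_smoothing[OF g]] by (simp add: smoothing_def)
    then show "ennreal \<bar>smoothing n \<psi> g z\<bar> \<le> (\<integral>\<^sup>+w. ennreal (\<psi> (torus_diff n z w)) * ennreal \<bar>g w\<bar> \<partial>torus_haar n)"
      by (simp add: abs_mult ennreal_mult nonneg)
  qed
  also have "\<dots> = (\<integral>\<^sup>+w. \<integral>\<^sup>+z. ennreal (\<psi> (torus_diff n z w)) * ennreal \<bar>g w\<bar> \<partial>torus_haar n \<partial>torus_haar n)"
    by (rule torus_haar_pair.Fubini') measurable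
  also have "\<dots> = (\<integral>\<^sup>+w. ennreal \<bar>g w\<bar> \<partial>torus_haar n)"
  proof (rule nn_integral_cong)
    fix w
    have "(\<integral>\<^sup>+z. ennreal (\<psi> (torus_diff n z w)) \<partial>torus_haar n) = 1"
      using nn_integral_torus_haar_invariant[OF distr_torus_haar_translate, where h = "\<lambda>z. ennreal (\<psi> z)"]
      by (simp add: nn_integral_kernel)
    then show "(\<integral>\<^sup>+z. ennreal (\<psi> (torus_diff n z w)) * ennreal \<bar>g w\<bar> \<partial>torus_haar n) = ennreal \<bar>g w\<bar>"
      by (simp add: nn_integral_multc)
  qed
  finally show ?thesis .
qed

end

lemma approximate_identity_kernel: "approximate_identity n \<phi> \<Longrightarrow> torus_kernel n (\<phi> j)"
  by (simp add: approximate_identity_def torus_kernel_def)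

text \<open>
  Smoothing does not increase the \<open>L\<^sup>1\<close> norm, so the functions for which it converges form a closed
  subset of \<open>L\<^sup>1\<close>.
\<close>

lemma smoothing_tends_L1_approx:
  assumes \<phi>: "approximate_identity n \<phi>" and g: "integrable (torus_haar n) g"
    and approx: "\<And>\<epsilon>. 0 < \<epsilon> \<Longrightarrow> \<exists>h. integrable (torus_haar n) h \<and>
      tends_L1 (torus_haar n) (\<lambda>j. smoothing n (\<phi> j) h) h \<and>
      (\<integral>\<^sup>+z. ennreal \<bar>g z - h z\<bar> \<partial>torus_haar n) \<le> ennreal \<epsilon>"
  shows "tends_L1 (torus_haar n) (\<lambda>j. smoothing n (\<phi> j) g) g"
  unfolding tends_L1_def
proof (intro allI impI)
  fix \<epsilon> :: real assume "0 < \<epsilon>"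
  then obtain h where h: "integrable (torus_haar n) h"
      "tends_L1 (torus_haar n) (\<lambda>j. smoothing n (\<phi> j) h) h"
      "(\<integral>\<^sup>+z. ennreal \<bar>g z - h z\<bar> \<partial>torus_haar n) \<le> ennreal (\<epsilon> / 3)"
    using approx[of "\<epsilon> / 3"] by auto
  have [measurable]: "g \<in> borel_measurable (torus_borel n)" "h \<in> borel_measurable (torus_borel n)"
    using borel_measurable_integrable[OF g] borel_measurable_integrable[OF h(1)]
    by (simp_all cong: measurable_cong_sets)
  have "\<forall>\<^sub>F j in sequentially. (\<integral>\<^sup>+z. ennreal \<bar>smoothing n (\<phi> j) h z - h z\<bar> \<partial>torus_haar n) \<le> ennreal (\<epsilon> / 3)"
    using h(2) \<open>0 < \<epsilon>\<close> by (simp add: tends_L1_def)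
  then show "\<forall>\<^sub>F j in sequentially. (\<integral>\<^sup>+z. ennreal \<bar>smoothing n (\<phi> j) g z - g z\<bar> \<partial>torus_haar n) \<le> ennreal \<epsilon>"
  proof eventually_elim
    fix j assume j: "(\<integral>\<^sup>+z. ennreal \<bar>smoothing n (\<phi> j) h z - h z\<bar> \<partial>torus_haar n) \<le> ennreal (\<epsilon> / 3)"
    interpret torus_kernel n "\<phi> j" by (rule approximate_identity_kernel[OF \<phi>])
    let ?gh = "\<lambda>z. g z - h z"
    have gh: "integrable (torus_haar n) ?gh" using g h(1) by simp
    have "(\<integral>\<^sup>+z. ennreal \<bar>smoothing n (\<phi> j) g z - g z\<bar> \<partial>torus_haar n)
      \<le> (\<integral>\<^sup>+z. ennreal \<bar>smoothing n (\<phi> j) ?gh z\<bar> + (ennreal \<bar>smoothing n (\<phi> j) h z - h z\<bar> + ennreal \<bar>?gh z\<bar>) \<partial>torus_haar n)"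
      by (intro nn_integral_mono)
         (simp add: smoothing_diff[OF g h(1)] ennreal_leI flip: ennreal_plus)
    also have "\<dots> = (\<integral>\<^sup>+z. ennreal \<bar>smoothing n (\<phi> j) ?gh z\<bar> \<partial>torus_haar n)
      + ((\<integral>\<^sup>+z. ennreal \<bar>smoothing n (\<phi> j) h z - h z\<bar> \<partial>torus_haar n) + (\<integral>\<^sup>+z. ennreal \<bar>?gh z\<bar> \<partial>torus_haar n))"
      by (subst nn_integral_add; (subst nn_integral_add)?) measurable
    also have "\<dots> \<le> ennreal (\<epsilon> / 3) + (ennreal (\<epsilon> / 3) + ennreal (\<epsilon> / 3))"
      by (intro add_mono order_trans[OF nn_integral_smoothing_le[OF gh]] h(3) j)
    also have "\<dots> = ennreal \<epsilon>" using \<open>0 < \<epsilon>\<close> by (simp flip: ennreal_plus)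
    finally show "(\<integral>\<^sup>+z. ennreal \<bar>smoothing n (\<phi> j) g z - g z\<bar> \<partial>torus_haar n) \<le> ennreal \<epsilon>" .
  qed
qed

lemma smoothing_tends_L1_add:
  assumes \<phi>: "approximate_identity n \<phi>" and g: "integrable (torus_haar n) g" and h: "integrable (torus_haar n) h"
    and Pg: "tends_L1 (torus_haar n) (\<lambda>j. smoothing n (\<phi> j) g) g"
    and Ph: "tends_L1 (torus_haar n) (\<lambda>j. smoothing n (\<phi> j) h) h"
  shows "tends_L1 (torus_haar n) (\<lambda>j. smoothing n (\<phi> j) (\<lambda>z. g z + h z)) (\<lambda>z. g z + h z)"
  unfolding tends_L1_def
proof (intro allI impI)
  fix \<epsilon> :: real assume "0 < \<epsilon>"
  have [measurable]: "g \<in> borel_measurable (torus_borel n)" "h \<in> borel_measurable (torus_borel n)"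
    using borel_measurable_integrable[OF g] borel_measurable_integrable[OF h]
    by (simp_all cong: measurable_cong_sets)
  from \<open>0 < \<epsilon>\<close> have "0 < \<epsilon> / 2" by simp
  then have "\<forall>\<^sub>F j in sequentially. (\<integral>\<^sup>+z. ennreal \<bar>smoothing n (\<phi> j) g z - g z\<bar> \<partial>torus_haar n) \<le> ennreal (\<epsilon> / 2)"
      "\<forall>\<^sub>F j in sequentially. (\<integral>\<^sup>+z. ennreal \<bar>smoothing n (\<phi> j) h z - h z\<bar> \<partial>torus_haar n) \<le> ennreal (\<epsilon> / 2)"
    using Pg Ph unfolding tends_L1_def by blast+
  then show "\<forall>\<^sub>F j in sequentially. (\<integral>\<^sup>+z. ennreal \<bar>smoothing n (\<phi> j) (\<lambda>z. g z + h z) z - (g z + h z)\<bar> \<partial>torus_haar n) \<le> ennreal \<epsilon>"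
  proof eventually_elim
    fix j assume j: "(\<integral>\<^sup>+z. ennreal \<bar>smoothing n (\<phi> j) g z - g z\<bar> \<partial>torus_haar n) \<le> ennreal (\<epsilon> / 2)"
      "(\<integral>\<^sup>+z. ennreal \<bar>smoothing n (\<phi> j) h z - h z\<bar> \<partial>torus_haar n) \<le> ennreal (\<epsilon> / 2)"
    interpret torus_kernel n "\<phi> j" by (rule approximate_identity_kernel[OF \<phi>])
    have "(\<integral>\<^sup>+z. ennreal \<bar>smoothing n (\<phi> j) (\<lambda>z. g z + h z) z - (g z + h z)\<bar> \<partial>torus_haar n)
      \<le> (\<integral>\<^sup>+z. ennreal \<bar>smoothing n (\<phi> j) g z - g z\<bar> + ennreal \<bar>smoothing n (\<phi> j) h z - h z\<bar> \<partial>torus_haar n)"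
      by (intro nn_integral_mono) (simp add: smoothing_add[OF g h] ennreal_leI flip: ennreal_plus)
    also have "\<dots> = (\<integral>\<^sup>+z. ennreal \<bar>smoothing n (\<phi> j) g z - g z\<bar> \<partial>torus_haar n)
      + (\<integral>\<^sup>+z. ennreal \<bar>smoothing n (\<phi> j) h z - h z\<bar> \<partial>torus_haar n)"
      by (rule nn_integral_add) measurable
    also have "\<dots> \<le> ennreal (\<epsilon> / 2) + ennreal (\<epsilon> / 2)" by (intro add_mono j)
    also have "\<dots> = ennreal \<epsilon>" using \<open>0 < \<epsilon>\<close> by (simp flip: ennreal_plus)
    finally show "(\<integral>\<^sup>+z. ennreal \<bar>smoothing n (\<phi> j) (\<lambda>z. g z + h z) z - (g z + h z)\<bar> \<partial>torus_haar n) \<le> ennreal \<epsilon>" .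
  qed
qed

lemma smoothing_tends_L1_mult_right:
  assumes \<phi>: "approximate_identity n \<phi>" and g: "integrable (torus_haar n) g"
    and Pg: "tends_L1 (torus_haar n) (\<lambda>j. smoothing n (\<phi> j) g) g"
  shows "tends_L1 (torus_haar n) (\<lambda>j. smoothing n (\<phi> j) (\<lambda>z. g z * c)) (\<lambda>z. g z * c)"
  unfolding tends_L1_def
proof (intro allI impI)
  fix \<epsilon> :: real assume "0 < \<epsilon>"
  have [measurable]: "g \<in> borel_measurable (torus_borel n)"
    using borel_measurable_integrable[OF g] by (simp_all cong: measurable_cong_sets)
  have "0 < \<epsilon> / (\<bar>c\<bar> + 1)" using \<open>0 < \<epsilon>\<close> by (simp add: add_nonneg_pos)
  then have "\<forall>\<^sub>F j in sequentially. (\<integral>\<^sup>+z. ennreal \<bar>smoothing n (\<phi> j) g z - g z\<bar> \<partial>torus_haar n) \<le> ennreal (\<epsilon> / (\<bar>c\<bar> + 1))"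
    using Pg unfolding tends_L1_def by blast
  then show "\<forall>\<^sub>F j in sequentially. (\<integral>\<^sup>+z. ennreal \<bar>smoothing n (\<phi> j) (\<lambda>z. g z * c) z - g z * c\<bar> \<partial>torus_haar n) \<le> ennreal \<epsilon>"
  proof eventually_elim
    fix j assume j: "(\<integral>\<^sup>+z. ennreal \<bar>smoothing n (\<phi> j) g z - g z\<bar> \<partial>torus_haar n) \<le> ennreal (\<epsilon> / (\<bar>c\<bar> + 1))"
    interpret torus_kernel n "\<phi> j" by (rule approximate_identity_kernel[OF \<phi>])
    have "(\<integral>\<^sup>+z. ennreal \<bar>smoothing n (\<phi> j) (\<lambda>z. g z * c) z - g z * c\<bar> \<partial>torus_haar n)
      = (\<integral>\<^sup>+z. ennreal \<bar>smoothing n (\<phi> j) g z - g z\<bar> * ennreal \<bar>c\<bar> \<partial>torus_haar n)"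
      by (intro nn_integral_cong)
         (simp add: smoothing_mult_right abs_mult left_diff_distrib[symmetric] ennreal_mult)
    also have "\<dots> = (\<integral>\<^sup>+z. ennreal \<bar>smoothing n (\<phi> j) g z - g z\<bar> \<partial>torus_haar n) * ennreal \<bar>c\<bar>"
      by (rule nn_integral_multc) measurable
    also have "\<dots> \<le> ennreal (\<epsilon> / (\<bar>c\<bar> + 1)) * ennreal \<bar>c\<bar>" using j by (rule mult_right_mono) simp
    also have "\<dots> = ennreal (\<epsilon> / (\<bar>c\<bar> + 1) * \<bar>c\<bar>)"
      using \<open>0 < \<epsilon>\<close> by (intro ennreal_mult[symmetric]) (simp_all add: add_nonneg_pos less_imp_le)
    also have "\<dots> \<le> ennreal \<epsilon>"
      using \<open>0 < \<epsilon>\<close> by (intro ennreal_leI) (simp add: field_simps)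
    finally show "(\<integral>\<^sup>+z. ennreal \<bar>smoothing n (\<phi> j) (\<lambda>z. g z * c) z - g z * c\<bar> \<partial>torus_haar n) \<le> ennreal \<epsilon>" .
  qed
qed

lemma integrable_indicator_torus: 
  "A \<in> sets (torus_borel n) \<Longrightarrow> integrable (torus_haar n) (indicator A :: _ \<Rightarrow> real)"
  by (intro integrable_real_indicator) (simp_all add: torus_haar.emeasure_finite less_top[symmetric])

text \<open>
  If \<open>z \<in> U\<close>, the points \<open>w\<close> with \<open>z - w \<in> U\<close> form an open neighbourhood \<open>V\<close> of \<open>0\<close>, and the amount by
  which the smoothed indicator falls short of \<open>1\<close> at \<open>z\<close> is the mass of the kernel outside \<open>V\<close>.
  Off \<open>U\<close> nothing can be missing, and the masses of the smoothed and the original indicator agree.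
\<close>

lemma smoothing_tends_L1_open_box:
  assumes \<phi>: "approximate_identity n \<phi>" and U: "U \<in> open_boxes n"
  shows "tends_L1 (torus_haar n) (\<lambda>j. smoothing n (\<phi> j) (indicator U)) (indicator U)"
proof -
  obtain A where U_eq: "U = Pi\<^sub>E {..<n} A" and A: "\<And>i. i < n \<Longrightarrow> open (A i)"
    using U by (auto simp: open_boxes_def)
  have U_sets [measurable]: "U \<in> sets (torus_borel n)"
    using U by (simp add: sets_torus_borel_eq_open_boxes sigma_sets.Basic)
  note int_U = integrable_indicator_torus[OF U_sets]
  interpret kernel: torus_kernel n "\<phi> j" for j by (rule approximate_identity_kernel[OF \<phi>])
  let ?s = "\<lambda>j. smoothing n (\<phi> j) (indicator U)"
  have s_le: "?s j z \<le> 1" for j z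
  proof -
    have "?s j z \<le> smoothing n (\<phi> j) (\<lambda>_. 1) z"
      unfolding smoothing_def
      by (rule integral_mono[OF kernel.integrable_smoothing[OF int_U] kernel.integrable_smoothing])
         (auto simp: kernel.nonneg indicator_def)
    then show ?thesis by (simp add: kernel.smoothing_1)
  qed
  have s_nonneg: "0 \<le> ?s j z" for j z by (rule kernel.smoothing_nonneg) simp
  have pointwise: "(\<lambda>j. ennreal (indicator U z - ?s j z)) \<longlonglongrightarrow> 0" if z: "z \<in> torus n" for z
  proof (cases "z \<in> U")
    case False
    then have "ennreal (indicator U z - ?s j z) = 0" for j
      using s_nonneg[of j z] by (simp add: ennreal_neg)
    then show ?thesis by simp
  next
    case True
    define V where "V = {w. \<forall>i<n. z i - w i \<in> A i}"
    have "V = (\<Inter>i<n. (\<lambda>w. w i) -` {t. z i - t \<in> A i})" by (auto simp: V_def)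
    moreover have "open ((\<lambda>w::nat \<Rightarrow> rmodz. w i) -` {t. z i - t \<in> A i})" if "i < n" for i
      by (intro open_vimage open_rmodz_reflected_translate A[OF that] continuous_on_product_coordinates)
    ultimately have "open V" by (simp add: open_INT)
    have V_diff: "w \<in> V \<longleftrightarrow> torus_diff n z w \<in> U" for w
      by (auto simp: V_def torus_diff_def U_eq PiE_iff)
    have "torus_zero n \<in> V"
      using True by (auto simp: V_def torus_zero_def U_eq PiE_iff)
    then have lim: "(\<lambda>j. LINT w:(torus n - V)|torus_leb n. \<phi> j w) \<longlonglongrightarrow> 0"
      using \<phi> \<open>open V\<close> by (simp add: approximate_identity_def)
    have TV: "torus n - V \<in> sets (torus_borel n)"
    proof -
      have "torus n - V = torus n - (torus n \<inter> V)" by auto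
      moreover have "torus n \<in> sets (torus_borel n)" using sets.top[of "torus_borel n"] by simp
      ultimately show ?thesis using open_Int_torus_sets[OF \<open>open V\<close>] by simp
    qed
    have int_1: "integrable (torus_haar n) (\<lambda>_. 1 :: real)" by simp
    have "ennreal (indicator U z - ?s j z) = ennreal (LINT w:(torus n - V)|torus_leb n. \<phi> j w)" for j
    proof -
      let ?c = "\<lambda>w. 1 - indicator U w :: real"
      have "indicator U z - ?s j z = smoothing n (\<phi> j) ?c z"
        using True by (simp add: kernel.smoothing_diff[OF int_1 int_U] kernel.smoothing_1)
      also have "ennreal (smoothing n (\<phi> j) ?c z)
        = (\<integral>\<^sup>+w. ennreal (\<phi> j w) * ennreal (?c (torus_diff n z w)) \<partial>torus_haar n)"
        by (intro kernel.nn_smoothing Bochner_Integration.integrable_diff int_1 int_U) (simp add: indicator_def)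
      also have "\<dots> = (\<integral>\<^sup>+w. ennreal (indicator (torus n - V) w *\<^sub>R \<phi> j w) \<partial>torus_haar n)"
        by (rule nn_integral_cong) (simp add: V_diff indicator_def)
      also have "\<dots> = ennreal (LINT w|torus_haar n. indicator (torus n - V) w *\<^sub>R \<phi> j w)"
        using TV by (intro nn_integral_eq_integral integrable_mult_indicator kernel.integrable_kernel)
                    (auto simp: kernel.nonneg indicator_def)
      also have "(LINT w|torus_haar n. indicator (torus n - V) w *\<^sub>R \<phi> j w)
        = (LINT w:(torus n - V)|torus_leb n. \<phi> j w)"
        unfolding set_lebesgue_integral_def torus_leb_eq
        by (intro integral_completion[symmetric] borel_measurable_scaleR borel_measurable_indicator) (simp_all add: TV)
      finally show ?thesis .
    qed
    then show ?thesis using tendsto_ennrealI[OF lim] by simp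
  qed
  have "(\<lambda>j. \<integral>\<^sup>+z. ennreal (indicator U z - ?s j z) \<partial>torus_haar n) \<longlonglongrightarrow> (\<integral>\<^sup>+z. 0 \<partial>torus_haar n)"
  proof (rule nn_integral_dominated_convergence[where w = "\<lambda>_. 1"])
    show "AE z in torus_haar n. ennreal (indicator U z - ?s j z) \<le> 1" for j
    proof (intro AE_I2)
      fix z
      have "indicator U z - ?s j z \<le> 1" using s_nonneg[of j z] by (simp add: indicator_def)
      from ennreal_leI[OF this] show "ennreal (indicator U z - ?s j z) \<le> 1" by simp
    qed
    show "AE z in torus_haar n. (\<lambda>j. ennreal (indicator U z - ?s j z)) \<longlonglongrightarrow> 0"
      using pointwise by (intro AE_I2) simp
  qed simp_all
  then have "(\<lambda>j. 2 * (\<integral>\<^sup>+z. ennreal (indicator U z - ?s j z) \<partial>torus_haar n)) \<longlonglongrightarrow> 2 * 0"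
    by (intro tendsto_mult_ennreal tendsto_const) simp_all
  then have lim: "(\<lambda>j. 2 * (\<integral>\<^sup>+z. ennreal (indicator U z - ?s j z) \<partial>torus_haar n)) \<longlonglongrightarrow> 0" by simp
  have bound: "(\<integral>\<^sup>+z. ennreal \<bar>?s j z - indicator U z\<bar> \<partial>torus_haar n)
    \<le> 2 * (\<integral>\<^sup>+z. ennreal (indicator U z - ?s j z) \<partial>torus_haar n)" for j
  proof (rule nn_integral_abs_diff_le)
    show "(\<integral>\<^sup>+z. ennreal (?s j z) \<partial>torus_haar n) \<le> (\<integral>\<^sup>+z. ennreal (indicator U z) \<partial>torus_haar n)"
      using kernel.nn_integral_smoothing_le[OF int_U, of j] s_nonneg[of j] by simp
    show "(\<integral>\<^sup>+z. ennreal (indicator U z) \<partial>torus_haar n) < \<infinity>"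
      by (simp add: ennreal_indicator less_top[symmetric])
  qed (simp_all add: s_nonneg)
  show ?thesis
    by (rule tends_L1I, rule tendsto_sandwich[OF _ _ tendsto_const lim]) (simp_all add: bound)
qed

lemma smoothing_cong:
  "(\<And>w. w \<in> torus n \<Longrightarrow> g w = h w) \<Longrightarrow> smoothing n \<psi> g z = smoothing n \<psi> h z"
  unfolding smoothing_def by (rule Bochner_Integration.integral_cong) simp_all

lemma tends_L1_cong:
  assumes "\<And>j z. z \<in> space M \<Longrightarrow> a j z = a' j z" "\<And>z. z \<in> space M \<Longrightarrow> b z = b' z"
  shows "tends_L1 M a b \<longleftrightarrow> tends_L1 M a' b'"
proof -
  have "(\<integral>\<^sup>+z. ennreal \<bar>a j z - b z\<bar> \<partial>M) = (\<integral>\<^sup>+z. ennreal \<bar>a' j z - b' z\<bar> \<partial>M)" for j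
    by (rule nn_integral_cong) (simp add: assms)
  then show ?thesis by (simp add: tends_L1_def)
qed

text \<open>
  Dynkin's lemma extends the result from open boxes; complements are differences of indicators, and a
  disjoint union is approximated in \<open>L\<^sup>1\<close> by its finite parts.
\<close>

lemma smoothing_tends_L1_indicator:
  assumes \<phi>: "approximate_identity n \<phi>" and A: "A \<in> sets (torus_borel n)"
  shows "tends_L1 (torus_haar n) (\<lambda>j. smoothing n (\<phi> j) (indicator A)) (indicator A)"
  using A unfolding sets_torus_borel_eq_open_boxes
proof (induction rule: sigma_sets_induct_disjoint[OF Int_stable_open_boxes open_boxes_subset,
      consumes 1, case_names basic empty compl union])
  case (basic U)
  then show ?case by (rule smoothing_tends_L1_open_box[OF \<phi>])
next
  case empty
  show ?case by (simp add: tends_L1_def smoothing_def)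
next
  case (compl B)
  then have B: "B \<in> sets (torus_borel n)" by (simp add: sets_torus_borel_eq_open_boxes)
  note int_B = integrable_indicator_torus[OF B]
  let ?D = "\<lambda>z. indicator (torus n) z + indicator B z * (- 1) :: real"
  have top: "torus n \<in> open_boxes n"
    unfolding open_boxes_def torus_def by (auto intro!: exI[of _ "\<lambda>_. UNIV"])
  then have int_top: "integrable (torus_haar n) (indicator (torus n) :: _ \<Rightarrow> real)"
    by (intro integrable_indicator_torus) (simp add: sets_torus_borel_eq_open_boxes sigma_sets.Basic)
  have "tends_L1 (torus_haar n) (\<lambda>j. smoothing n (\<phi> j) ?D) ?D"
    using int_top int_B
    by (intro smoothing_tends_L1_add[OF \<phi>] smoothing_tends_L1_mult_right[OF \<phi>]
        smoothing_tends_L1_open_box[OF \<phi> top] compl(2)) simp_all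
  moreover have eq: "?D z = indicator (torus n - B) z" if "z \<in> torus n" for z
    using that by (simp add: indicator_def)
  moreover have "smoothing n (\<phi> j) ?D z = smoothing n (\<phi> j) (indicator (torus n - B)) z" for j z
    by (rule smoothing_cong) (rule eq)
  ultimately show ?case by (subst (asm) tends_L1_cong) auto
next
  case (union C)
  have C: "C i \<in> sets (torus_borel n)" for i
    using union(2) by (auto simp: sets_torus_borel_eq_open_boxes)
  have dj: "disjoint_family_on C {..<N}" for N :: nat
    using union(1) by (auto simp: disjoint_family_on_def)
  show ?case
  proof (rule smoothing_tends_L1_approx[OF \<phi>])
    show "integrable (torus_haar n) (indicator (\<Union>i. C i) :: _ \<Rightarrow> real)"
      using C by (intro integrable_indicator_torus) auto
    fix \<epsilon> :: real assume "0 < \<epsilon>"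
    have "(\<lambda>N. emeasure (torus_haar n) ((\<Union>i. C i) - (\<Union>i<N. C i))) \<longlonglongrightarrow> emeasure (torus_haar n) (\<Inter>N. (\<Union>i. C i) - (\<Union>i<N. C i))"
      using C by (intro Lim_emeasure_decseq) (auto simp: decseq_def intro: order.strict_trans2)
    also have "(\<Inter>N. (\<Union>i. C i) - (\<Union>i<N. C i)) = {}" by blast
    finally have "(\<lambda>N. emeasure (torus_haar n) ((\<Union>i. C i) - (\<Union>i<N. C i))) \<longlonglongrightarrow> 0" by simp
    from order_tendstoD(2)[OF this, of "ennreal \<epsilon>"] \<open>0 < \<epsilon>\<close>
    obtain N where N: "emeasure (torus_haar n) ((\<Union>i. C i) - (\<Union>i<N. C i)) < ennreal \<epsilon>"
      by (auto simp: eventually_sequentially)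
    have fin: "integrable (torus_haar n) (\<lambda>z. \<Sum>i<N. indicator (C i) z :: real) \<and>
      tends_L1 (torus_haar n) (\<lambda>j. smoothing n (\<phi> j) (\<lambda>z. \<Sum>i<N. indicator (C i) z)) (\<lambda>z. \<Sum>i<N. indicator (C i) z)" for N
    proof (induction N)
      case 0 show ?case by (simp add: tends_L1_def smoothing_def)
    next
      case (Suc N)
      then show ?case
        using smoothing_tends_L1_add[OF \<phi> _ integrable_indicator_torus[OF C[of N]] _ union(3)[of N]]
          integrable_indicator_torus[OF C[of N]] by simp
    qed
    have "indicator (\<Union>i<N. C i) = (\<lambda>z. \<Sum>i<N. indicator (C i) z :: real)"
      using indicator_UN_disjoint[OF finite_lessThan dj] by (rule ext)
    then have "integrable (torus_haar n) (indicator (\<Union>i<N. C i) :: _ \<Rightarrow> real)"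
      "tends_L1 (torus_haar n) (\<lambda>j. smoothing n (\<phi> j) (indicator (\<Union>i<N. C i))) (indicator (\<Union>i<N. C i))"
      using fin[of N] by auto
    moreover have "(\<integral>\<^sup>+z. ennreal \<bar>indicator (\<Union>i. C i) z - indicator (\<Union>i<N. C i) z\<bar> \<partial>torus_haar n) \<le> ennreal \<epsilon>"
    proof -
      have "(\<integral>\<^sup>+z. ennreal \<bar>indicator (\<Union>i. C i) z - indicator (\<Union>i<N. C i) z\<bar> \<partial>torus_haar n)
        = (\<integral>\<^sup>+z. indicator ((\<Union>i. C i) - (\<Union>i<N. C i)) z \<partial>torus_haar n)"
        by (intro nn_integral_cong) (auto simp: indicator_def)
      also have "\<dots> = emeasure (torus_haar n) ((\<Union>i. C i) - (\<Union>i<N. C i))"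
        using C by (intro nn_integral_indicator) auto
      finally show ?thesis using N by simp
    qed
    ultimately show "\<exists>h. integrable (torus_haar n) h \<and>
      tends_L1 (torus_haar n) (\<lambda>j. smoothing n (\<phi> j) h) h \<and>
      (\<integral>\<^sup>+z. ennreal \<bar>indicator (\<Union>i. C i) z - h z\<bar> \<partial>torus_haar n) \<le> ennreal \<epsilon>" by blast
  qed
qed

proposition smoothing_tends_L1:
  assumes \<phi>: "approximate_identity n \<phi>" and g: "integrable (torus_haar n) g"
  shows "tends_L1 (torus_haar n) (\<lambda>j. smoothing n (\<phi> j) g) g"
  using g
proof induction
  case (base A c)
  then have A: "A \<in> sets (torus_borel n)" by simp
  show ?case
    using smoothing_tends_L1_mult_right[OF \<phi> integrable_indicator_torus[OF A] smoothing_tends_L1_indicator[OF \<phi> A], of c]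
    by simp
next
  case (add g h)
  then show ?case by (intro smoothing_tends_L1_add[OF \<phi>])
next
  case (lim g s)
  show ?case
  proof (rule smoothing_tends_L1_approx[OF \<phi> lim(4)])
    fix \<epsilon> :: real assume "0 < \<epsilon>"
    have "(\<lambda>i. \<integral>\<^sup>+z. norm (g z - s i z) \<partial>torus_haar n) \<longlonglongrightarrow> 0"
    proof (rule nn_integral_dominated_convergence_norm[where w = "\<lambda>z. 2 * norm (g z)"])
      show "(\<integral>\<^sup>+z. ennreal (2 * norm (g z)) \<partial>torus_haar n) < \<infinity>"
        using integrableD(2)[OF integrable_mult_right[OF integrable_norm[OF lim(4)], of 2]]
        by (simp add: less_top abs_mult)
    qed (use lim in \<open>auto intro: borel_measurable_integrable\<close>)
    from order_tendstoD(2)[OF this, of "ennreal \<epsilon>"] \<open>0 < \<epsilon>\<close>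
    obtain i where "(\<integral>\<^sup>+z. norm (g z - s i z) \<partial>torus_haar n) < ennreal \<epsilon>"
      by (auto simp: eventually_sequentially)
    then show "\<exists>h. integrable (torus_haar n) h \<and>
      tends_L1 (torus_haar n) (\<lambda>j. smoothing n (\<phi> j) h) h \<and>
      (\<integral>\<^sup>+z. ennreal \<bar>g z - h z\<bar> \<partial>torus_haar n) \<le> ennreal \<epsilon>"
      using lim(1,5) by (intro exI[of _ "s i"]) auto
  qed
qed

section \<open>Convergence of smoothed correlations\<close>

text \<open>
  In coordinates: \<open>(x - v; u) - w = (x - v - w'; u - w'')\<close> if \<open>w = (w', w'')\<close>.
\<close>

lemma torus_diff_shift_append:
  "torus_diff (d + r) (torus_shift d (d + r) (torus_append d r x u) v) w
    = torus_append d r (torus_diff d (torus_diff d x v) w) (torus_diff r u (\<lambda>i. w (d + i)))"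
  by (auto simp: torus_diff_def torus_shift_def torus_append_def fun_eq_iff)

text \<open>
  For fixed \<open>(x; u)\<close> the integral over \<open>v\<close> runs over a whole fibre and so equals \<open>H\<close> at the translate of
  \<open>u\<close>, whatever \<open>x\<close> and the first block of \<open>w\<close> are; integrating over \<open>x\<close> then produces the factor \<open>H u\<close>.
\<close>

lemma nn_integral_translated_correlation:
  fixes h :: "(nat \<Rightarrow> rmodz) \<Rightarrow> ennreal"
  assumes [measurable]: "h \<in> borel_measurable (torus_borel (d + r))"
  defines "H \<equiv> \<lambda>u. \<integral>\<^sup>+x. h (torus_append d r x u) \<partial>torus_haar d"
  shows "(\<integral>\<^sup>+z. \<integral>\<^sup>+v. h (torus_diff (d + r) (torus_shift d (d + r) z v) w) * h z \<partial>torus_haar d \<partial>torus_haar (d + r))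
    = (\<integral>\<^sup>+u. H (torus_diff r u (\<lambda>i. w (d + i))) * H u \<partial>torus_haar r)"
proof -
  let ?w = "\<lambda>i. w (d + i)"
  have H [measurable]: "H \<in> borel_measurable (torus_borel r)" unfolding H_def by measurable
  have [measurable]: "(\<lambda>p. torus_diff (d + r) (torus_shift d (d + r) (fst p) (snd p)) w)
      \<in> torus_borel (d + r) \<Otimes>\<^sub>M torus_haar d \<rightarrow>\<^sub>M torus_borel (d + r)"
    by (rule measurable_compose[OF _ measurable_torus_diff_left]) measurable
  have inner: "(\<integral>\<^sup>+v. h (torus_diff (d + r) (torus_shift d (d + r) (torus_append d r x u) v) w) \<partial>torus_haar d)
    = H (torus_diff r u ?w)" if [simp]: "x \<in> torus d" "u \<in> torus r" for x u
  proof -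
    have [measurable]: "(\<lambda>y. torus_append d r y (torus_diff r u ?w)) \<in> torus_borel d \<rightarrow>\<^sub>M torus_borel (d + r)"
      by (intro measurable_torus_append measurable_ident_sets measurable_const) simp_all
    let ?k = "\<lambda>y. h (torus_append d r y (torus_diff r u ?w))"
    have "(\<integral>\<^sup>+v. ?k (torus_diff d (torus_diff d x v) w) \<partial>torus_haar d)
      = (\<integral>\<^sup>+y. ?k (torus_diff d y w) \<partial>torus_haar d)"
      by (rule nn_integral_torus_haar_invariant[OF distr_torus_haar_reflect, where h = "\<lambda>y. ?k (torus_diff d y w)"])
         measurable
    also have "\<dots> = (\<integral>\<^sup>+y. ?k y \<partial>torus_haar d)"
      by (rule nn_integral_torus_haar_invariant[OF distr_torus_haar_translate, where h = ?k]) measurable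
    finally show ?thesis by (simp add: torus_diff_shift_append H_def)
  qed
  have "(\<integral>\<^sup>+z. \<integral>\<^sup>+v. h (torus_diff (d + r) (torus_shift d (d + r) z v) w) * h z \<partial>torus_haar d \<partial>torus_haar (d + r))
    = (\<integral>\<^sup>+z. (\<integral>\<^sup>+v. h (torus_diff (d + r) (torus_shift d (d + r) z v) w) \<partial>torus_haar d) * h z \<partial>torus_haar (d + r))"
  proof (rule nn_integral_cong)
    fix z assume "z \<in> space (torus_haar (d + r))"
    then have "(\<lambda>v. h (torus_diff (d + r) (torus_shift d (d + r) z v) w)) \<in> borel_measurable (torus_haar d)"
      by (intro measurable_compose[OF _ assms(1)] measurable_compose[OF _ measurable_torus_diff_left]
          measurable_torus_shift measurable_const measurable_ident_sets) simp_all
    then show "(\<integral>\<^sup>+v. h (torus_diff (d + r) (torus_shift d (d + r) z v) w) * h z \<partial>torus_haar d)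
      = (\<integral>\<^sup>+v. h (torus_diff (d + r) (torus_shift d (d + r) z v) w) \<partial>torus_haar d) * h z"
      by (rule nn_integral_multc)
  qed
  also have "\<dots> = (\<integral>\<^sup>+x. \<integral>\<^sup>+u. (\<integral>\<^sup>+v. h (torus_diff (d + r) (torus_shift d (d + r) (torus_append d r x u) v) w) \<partial>torus_haar d)
      * h (torus_append d r x u) \<partial>torus_haar r \<partial>torus_haar d)"
    by (rule nn_integral_torus_append) measurable
  also have "\<dots> = (\<integral>\<^sup>+x. \<integral>\<^sup>+u. H (torus_diff r u ?w) * h (torus_append d r x u) \<partial>torus_haar r \<partial>torus_haar d)"
    by (intro nn_integral_cong) (simp add: inner)
  also have "\<dots> = (\<integral>\<^sup>+u. \<integral>\<^sup>+x. H (torus_diff r u ?w) * h (torus_append d r x u) \<partial>torus_haar d \<partial>torus_haar r)"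
  proof (rule torus_haar_pair.Fubini'[symmetric])
    have "(\<lambda>p. H (torus_diff r (snd p) ?w)) \<in> borel_measurable (torus_haar d \<Otimes>\<^sub>M torus_haar r)"
      by (intro measurable_compose[OF _ H] measurable_compose[OF _ measurable_torus_diff_left]) measurable
    then show "(\<lambda>(x, u). H (torus_diff r u ?w) * h (torus_append d r x u))
        \<in> borel_measurable (torus_haar d \<Otimes>\<^sub>M torus_haar r)"
      by (simp add: case_prod_beta) measurable
  qed
  also have "\<dots> = (\<integral>\<^sup>+u. H (torus_diff r u ?w) * H u \<partial>torus_haar r)"
  proof (rule nn_integral_cong)
    fix u assume u: "u \<in> space (torus_haar r)"
    have "(\<lambda>x. h (torus_append d r x u)) \<in> borel_measurable (torus_haar d)"
      using u by (intro measurable_compose[OF _ assms(1)] measurable_torus_append measurable_const measurable_ident_sets) simp_all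
    then show "(\<integral>\<^sup>+x. H (torus_diff r u ?w) * h (torus_append d r x u) \<partial>torus_haar d) = H (torus_diff r u ?w) * H u"
      unfolding H_def by (rule nn_integral_cmult)
  qed
  finally show ?thesis .
qed

lemma ennreal_two_mult_le_sum_squares: "2 * (a * b) \<le> a * a + b * (b::ennreal)"
proof (cases "a = \<infinity> \<or> b = \<infinity>")
  case True
  then show ?thesis by (auto simp: ennreal_top_mult)
next
  case False
  then obtain x y where a: "a = ennreal x" "0 \<le> x" and b: "b = ennreal y" "0 \<le> y"
    by (cases a; cases b) auto
  have "2 * (x * y) \<le> x * x + y * y"
    using sum_squares_bound[of x y] by (simp add: power2_eq_square)
  then have "ennreal (2 * (x * y)) \<le> ennreal (x * x + y * y)" by (rule ennreal_leI)
  also have "ennreal (2 * (x * y)) = 2 * (a * b)"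
    using a b by (simp add: ennreal_mult)
  also have "ennreal (x * x + y * y) = a * a + b * b"
    using a b by (simp add: ennreal_mult)
  finally show ?thesis .
qed

text \<open>
  Apply \<open>2ab \<le> a\<^sup>2 + b\<^sup>2\<close> to \<open>H\<close> and its translate, whose squares have equal integrals.  The
  right-hand side is the case \<open>w = 0\<close> of the translated correlation.
\<close>

lemma nn_integral_translated_correlation_le:
  fixes h :: "(nat \<Rightarrow> rmodz) \<Rightarrow> ennreal"
  assumes [measurable]: "h \<in> borel_measurable (torus_borel (d + r))"
  shows "(\<integral>\<^sup>+z. \<integral>\<^sup>+v. h (torus_diff (d + r) (torus_shift d (d + r) z v) w) * h z \<partial>torus_haar d \<partial>torus_haar (d + r))
    \<le> (\<integral>\<^sup>+z. \<integral>\<^sup>+v. h (torus_shift d (d + r) z v) * h z \<partial>torus_haar d \<partial>torus_haar (d + r))"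
proof -
  define H where "H u = (\<integral>\<^sup>+x. h (torus_append d r x u) \<partial>torus_haar d)" for u
  have H [measurable]: "H \<in> borel_measurable (torus_borel r)" unfolding H_def[abs_def] by measurable
  let ?w = "\<lambda>i. w (d + i)" and ?S = "\<integral>\<^sup>+u. H u * H u \<partial>torus_haar r"
  have "(\<integral>\<^sup>+z. \<integral>\<^sup>+v. h (torus_shift d (d + r) z v) * h z \<partial>torus_haar d \<partial>torus_haar (d + r))
    = (\<integral>\<^sup>+z. \<integral>\<^sup>+v. h (torus_diff (d + r) (torus_shift d (d + r) z v) (\<lambda>_. 0)) * h z \<partial>torus_haar d \<partial>torus_haar (d + r))"
    by (simp add: torus_diff_zero)
  also have "\<dots> = (\<integral>\<^sup>+u. H (torus_diff r u (\<lambda>_. 0)) * H u \<partial>torus_haar r)"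
    using nn_integral_translated_correlation[OF assms, of "\<lambda>_. 0"] by (simp add: H_def)
  also have "\<dots> = ?S" by (intro nn_integral_cong) (simp add: torus_diff_zero)
  finally have S: "(\<integral>\<^sup>+z. \<integral>\<^sup>+v. h (torus_shift d (d + r) z v) * h z \<partial>torus_haar d \<partial>torus_haar (d + r)) = ?S" .
  have "2 * (\<integral>\<^sup>+u. H (torus_diff r u ?w) * H u \<partial>torus_haar r)
    = (\<integral>\<^sup>+u. 2 * (H (torus_diff r u ?w) * H u) \<partial>torus_haar r)"
    by (rule nn_integral_cmult[symmetric]) measurable
  also have "\<dots> \<le> (\<integral>\<^sup>+u. H (torus_diff r u ?w) * H (torus_diff r u ?w) + H u * H u \<partial>torus_haar r)"
    by (intro nn_integral_mono ennreal_two_mult_le_sum_squares)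
  also have "\<dots> = (\<integral>\<^sup>+u. H (torus_diff r u ?w) * H (torus_diff r u ?w) \<partial>torus_haar r) + ?S"
    by (rule nn_integral_add) measurable
  also have "(\<integral>\<^sup>+u. H (torus_diff r u ?w) * H (torus_diff r u ?w) \<partial>torus_haar r) = ?S"
    by (rule nn_integral_torus_haar_invariant[OF distr_torus_haar_translate, where h = "\<lambda>u. H u * H u"]) measurable
  also have "?S + ?S = 2 * ?S" by (rule mult_2[symmetric])
  finally have "(\<integral>\<^sup>+u. H (torus_diff r u ?w) * H u \<partial>torus_haar r) \<le> ?S"
    by (simp add: ennreal_mult_le_mult_iff)
  then show ?thesis
    unfolding S using nn_integral_translated_correlation[OF assms, of w] by (simp add: H_def)
qed

text \<open>
  Smoothing averages over translations by \<open>w\<close> with a weight of total mass \<open>1\<close>, and each translation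
  can only decrease the correlation.
\<close>

lemma nn_integral_smoothed_correlation_le:
  assumes "torus_kernel (d + r) \<psi>"
    and g: "integrable (torus_haar (d + r)) g" and g0: "\<And>z. 0 \<le> g z"
  shows "(\<integral>\<^sup>+z. \<integral>\<^sup>+v. ennreal (smoothing (d + r) \<psi> g (torus_shift d (d + r) z v) * g z) \<partial>torus_haar d \<partial>torus_haar (d + r))
    \<le> (\<integral>\<^sup>+z. \<integral>\<^sup>+v. ennreal (g (torus_shift d (d + r) z v) * g z) \<partial>torus_haar d \<partial>torus_haar (d + r))"
proof -
  let ?n = "d + r"
  let ?h = "\<lambda>z. ennreal (g z)" and ?T = "torus_shift d ?n"
  let ?N = "torus_haar ?n \<Otimes>\<^sub>M torus_haar d"
  interpret torus_kernel ?n \<psi> by fact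
  interpret N: pair_sigma_finite ?N "torus_haar ?n"
    by (intro pair_sigma_finite.intro torus_haar_pair.sigma_finite_measure_axioms torus_haar.sigma_finite_measure_axioms)
  have [measurable]: "g \<in> borel_measurable (torus_borel ?n)"
    using borel_measurable_integrable[OF g] by (simp cong: measurable_cong_sets)
  have meas: "(\<lambda>(p, w). ennreal (\<psi> w) * ?h (torus_diff ?n (?T (fst p) (snd p)) w) * ?h (fst p))
      \<in> borel_measurable (?N \<Otimes>\<^sub>M torus_haar ?n)"
    by measurable
  have "(\<integral>\<^sup>+z. \<integral>\<^sup>+v. ennreal (smoothing ?n \<psi> g (?T z v) * g z) \<partial>torus_haar d \<partial>torus_haar ?n)
    = (\<integral>\<^sup>+p. ennreal (smoothing ?n \<psi> g (?T (fst p) (snd p)) * g (fst p)) \<partial>?N)"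
    by (subst torus_haar.nn_integral_fst[symmetric]) simp_all
  also have "\<dots> = (\<integral>\<^sup>+p. \<integral>\<^sup>+w. ennreal (\<psi> w) * ?h (torus_diff ?n (?T (fst p) (snd p)) w) * ?h (fst p) \<partial>torus_haar ?n \<partial>?N)"
  proof (rule nn_integral_cong)
    fix p
    have "ennreal (smoothing ?n \<psi> g (?T (fst p) (snd p)) * g (fst p))
      = ennreal (smoothing ?n \<psi> g (?T (fst p) (snd p))) * ?h (fst p)"
      by (rule ennreal_mult) (simp_all add: smoothing_nonneg g0)
    also have "\<dots> = (\<integral>\<^sup>+w. ennreal (\<psi> w) * ?h (torus_diff ?n (?T (fst p) (snd p)) w) \<partial>torus_haar ?n) * ?h (fst p)"
      by (simp add: nn_smoothing[OF g g0])
    also have "\<dots> = (\<integral>\<^sup>+w. ennreal (\<psi> w) * ?h (torus_diff ?n (?T (fst p) (snd p)) w) * ?h (fst p) \<partial>torus_haar ?n)"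
      by (rule nn_integral_multc[symmetric]) measurable
    finally show "ennreal (smoothing ?n \<psi> g (?T (fst p) (snd p)) * g (fst p))
      = (\<integral>\<^sup>+w. ennreal (\<psi> w) * ?h (torus_diff ?n (?T (fst p) (snd p)) w) * ?h (fst p) \<partial>torus_haar ?n)" .
  qed
  also have "\<dots> = (\<integral>\<^sup>+w. \<integral>\<^sup>+p. ennreal (\<psi> w) * ?h (torus_diff ?n (?T (fst p) (snd p)) w) * ?h (fst p) \<partial>?N \<partial>torus_haar ?n)"
    by (rule N.Fubini'[OF meas, symmetric])
  also have "\<dots> \<le> (\<integral>\<^sup>+w. ennreal (\<psi> w) * (\<integral>\<^sup>+z. \<integral>\<^sup>+v. ?h (?T z v) * ?h z \<partial>torus_haar d \<partial>torus_haar ?n) \<partial>torus_haar ?n)"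
  proof (rule nn_integral_mono)
    fix w
    have [measurable]: "(\<lambda>p. ?h (torus_diff ?n (?T (fst p) (snd p)) w)) \<in> borel_measurable ?N"
      by (intro measurable_compose[OF _ measurable_compose[OF measurable_torus_diff_left]]) measurable
    have "(\<integral>\<^sup>+p. ennreal (\<psi> w) * ?h (torus_diff ?n (?T (fst p) (snd p)) w) * ?h (fst p) \<partial>?N)
      = ennreal (\<psi> w) * (\<integral>\<^sup>+p. ?h (torus_diff ?n (?T (fst p) (snd p)) w) * ?h (fst p) \<partial>?N)"
      by (simp add: mult.assoc nn_integral_cmult)
    also have "(\<integral>\<^sup>+p. ?h (torus_diff ?n (?T (fst p) (snd p)) w) * ?h (fst p) \<partial>?N)
      = (\<integral>\<^sup>+z. \<integral>\<^sup>+v. ?h (torus_diff ?n (?T z v) w) * ?h z \<partial>torus_haar d \<partial>torus_haar ?n)"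
      by (subst torus_haar.nn_integral_fst[symmetric]) simp_all
    finally show "(\<integral>\<^sup>+p. ennreal (\<psi> w) * ?h (torus_diff ?n (?T (fst p) (snd p)) w) * ?h (fst p) \<partial>?N)
      \<le> ennreal (\<psi> w) * (\<integral>\<^sup>+z. \<integral>\<^sup>+v. ?h (?T z v) * ?h z \<partial>torus_haar d \<partial>torus_haar ?n)"
      by (simp only:) (intro mult_left_mono nn_integral_translated_correlation_le, simp_all)
  qed
  also have "\<dots> = (\<integral>\<^sup>+z. \<integral>\<^sup>+v. ?h (?T z v) * ?h z \<partial>torus_haar d \<partial>torus_haar ?n)"
    by (simp add: nn_integral_multc nn_integral_kernel)
  finally show ?thesis by (simp add: ennreal_mult g0)
qed

text \<open>
  Where \<open>g (fst p)\<close> is at most \<open>L\<close>, convergence of the smoothing in \<open>L\<^sup>1\<close> suffices.  Where it exceeds \<open>L\<close>,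
  the deficit \<open>(G - A\<^sub>j)\<^sup>+\<close> is bounded by the integrable function \<open>G\<close>, whatever \<open>j\<close> is.  An excess of \<open>A\<^sub>j\<close>
  over \<open>G\<close> is excluded by comparing total masses.
\<close>

proposition smoothed_correlation_tends_L1:
  assumes \<phi>: "approximate_identity (d + r) \<phi>"
    and g: "integrable (torus_haar (d + r)) g" and g0: "\<And>z. 0 \<le> g z"
    and fin: "(\<integral>\<^sup>+p. ennreal (g (torus_shift d (d + r) (fst p) (snd p)) * g (fst p))
      \<partial>(torus_haar (d + r) \<Otimes>\<^sub>M torus_haar d)) < \<infinity>"
  shows "tends_L1 (torus_haar (d + r) \<Otimes>\<^sub>M torus_haar d)
    (\<lambda>j p. smoothing (d + r) (\<phi> j) g (torus_shift d (d + r) (fst p) (snd p)) * g (fst p))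
    (\<lambda>p. g (torus_shift d (d + r) (fst p) (snd p)) * g (fst p))"
  unfolding tends_L1_def
proof (intro allI impI)
  let ?n = "d + r"
  let ?N = "torus_haar ?n \<Otimes>\<^sub>M torus_haar d"
  let ?T = "\<lambda>p :: (nat \<Rightarrow> rmodz) \<times> (nat \<Rightarrow> rmodz). torus_shift d ?n (fst p) (snd p)"
  let ?G = "\<lambda>p. g (?T p) * g (fst p)"
  let ?tail = "\<lambda>(L::nat) p. if real L < g (fst p) then ennreal (?G p) else 0"
  let ?s = "\<lambda>j. smoothing ?n (\<phi> j) g"
  let ?A = "\<lambda>j p. ?s j (?T p) * g (fst p)"
  interpret kernel: torus_kernel ?n "\<phi> j" for j by (rule approximate_identity_kernel[OF \<phi>])
  have [measurable]: "g \<in> borel_measurable (torus_borel ?n)"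
    using borel_measurable_integrable[OF g] by (simp cong: measurable_cong_sets)
  fix \<epsilon> :: real assume "0 < \<epsilon>"
  have "(\<lambda>L. \<integral>\<^sup>+p. ?tail L p \<partial>?N) \<longlonglongrightarrow> (\<integral>\<^sup>+p. 0 \<partial>?N)"
  proof (rule nn_integral_dominated_convergence[where w = "\<lambda>p. ennreal (?G p)"])
    show "AE p in ?N. (\<lambda>L. ?tail L p) \<longlonglongrightarrow> 0"
    proof (intro AE_I2 tendsto_eventually)
      fix p :: "(nat \<Rightarrow> rmodz) \<times> (nat \<Rightarrow> rmodz)"
      have "\<forall>\<^sub>F L in sequentially. g (fst p) \<le> real L"
        using filterlim_real_sequentially by (simp add: filterlim_at_top)
      then show "\<forall>\<^sub>F L in sequentially. ?tail L p = 0"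
        by eventually_elim (simp add: indicator_def)
    qed
  qed (use fin in \<open>auto simp: indicator_def\<close>)
  then have tail: "(\<lambda>L. \<integral>\<^sup>+p. ?tail L p \<partial>?N) \<longlonglongrightarrow> 0" by simp
  have "0 < \<epsilon> / 4" using \<open>0 < \<epsilon>\<close> by simp
  then have "0 < ennreal (\<epsilon> / 4)" by (simp only: ennreal_less_zero_iff)
  then have "\<forall>\<^sub>F L in sequentially. (\<integral>\<^sup>+p. ?tail L p \<partial>?N) < ennreal (\<epsilon> / 4)"
    by (rule order_tendstoD(2)[OF tail])
  then obtain L :: nat where L: "(\<integral>\<^sup>+p. ?tail L p \<partial>?N) < ennreal (\<epsilon> / 4)"
    by (auto simp: eventually_sequentially)
  \<comment> \<open>The summand \<open>1\<close> only guards against \<open>L = 0\<close>.\<close>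
  have "0 < \<epsilon> / (4 * (real L + 1))" using \<open>0 < \<epsilon>\<close> by simp
  then have "\<forall>\<^sub>F j in sequentially. (\<integral>\<^sup>+z. ennreal \<bar>?s j z - g z\<bar> \<partial>torus_haar ?n) \<le> ennreal (\<epsilon> / (4 * (real L + 1)))"
    using smoothing_tends_L1[OF \<phi> g] unfolding tends_L1_def by blast
  then show "\<forall>\<^sub>F j in sequentially. (\<integral>\<^sup>+p. ennreal \<bar>?A j p - ?G p\<bar> \<partial>?N) \<le> ennreal \<epsilon>"
  proof eventually_elim
    fix j assume j: "(\<integral>\<^sup>+z. ennreal \<bar>?s j z - g z\<bar> \<partial>torus_haar ?n) \<le> ennreal (\<epsilon> / (4 * (real L + 1)))"
    have "(\<integral>\<^sup>+p. ennreal (?G p - ?A j p) \<partial>?N)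
      \<le> (\<integral>\<^sup>+p. ?tail L p + ennreal (real L) * ennreal \<bar>?s j (?T p) - g (?T p)\<bar> \<partial>?N)"
    proof (rule nn_integral_mono)
      fix p :: "(nat \<Rightarrow> rmodz) \<times> (nat \<Rightarrow> rmodz)"
      show "ennreal (?G p - ?A j p) \<le> ?tail L p
        + ennreal (real L) * ennreal \<bar>?s j (?T p) - g (?T p)\<bar>"
      proof (cases "real L < g (fst p)")
        case True
        have "?G p - ?A j p \<le> ?G p" by (simp add: kernel.smoothing_nonneg g0)
        then have "ennreal (?G p - ?A j p) \<le> ennreal (?G p)" by (rule ennreal_leI)
        then show ?thesis using True by (simp add: add_increasing2)
      next
        case False
        have "?G p - ?A j p = (g (?T p) - ?s j (?T p)) * g (fst p)" by (simp add: left_diff_distrib)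
        also have "\<dots> \<le> \<bar>?s j (?T p) - g (?T p)\<bar> * real L"
          using False g0 by (intro mult_mono) auto
        finally have "ennreal (?G p - ?A j p) \<le> ennreal (real L * \<bar>?s j (?T p) - g (?T p)\<bar>)"
          by (intro ennreal_leI) (simp add: mult.commute)
        with False show ?thesis by (simp add: ennreal_mult)
      qed
    qed
    also have "\<dots> = (\<integral>\<^sup>+p. ?tail L p \<partial>?N)
      + ennreal (real L) * (\<integral>\<^sup>+p. ennreal \<bar>?s j (?T p) - g (?T p)\<bar> \<partial>?N)"
      by (subst nn_integral_add) (simp_all add: nn_integral_cmult)
    also have "(\<integral>\<^sup>+p. ennreal \<bar>?s j (?T p) - g (?T p)\<bar> \<partial>?N) = (\<integral>\<^sup>+z. ennreal \<bar>?s j z - g z\<bar> \<partial>torus_haar ?n)"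
      by (rule nn_integral_torus_shift) measurable
    also have "(\<integral>\<^sup>+p. ?tail L p \<partial>?N) + ennreal (real L) * \<dots>
      \<le> ennreal (\<epsilon> / 4) + ennreal (real L) * ennreal (\<epsilon> / (4 * (real L + 1)))"
      using L j by (intro add_mono mult_left_mono) simp_all
    also have "\<dots> = ennreal (\<epsilon> / 4 + real L * (\<epsilon> / (4 * (real L + 1))))"
    proof -
      have nn: "0 \<le> \<epsilon> / (4 * (real L + 1))" using \<open>0 < \<epsilon>\<close> by simp
      show ?thesis
        unfolding ennreal_mult[OF of_nat_0_le_iff nn, symmetric]
        using nn \<open>0 < \<epsilon>\<close> by (intro ennreal_plus[symmetric] mult_nonneg_nonneg) auto
    qed
    also have "\<dots> \<le> ennreal (\<epsilon> / 2)"
    proof (rule ennreal_leI)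
      have "real L * (\<epsilon> / (4 * (real L + 1))) \<le> \<epsilon> / 4"
        using \<open>0 < \<epsilon>\<close> by (simp add: field_simps)
      then show "\<epsilon> / 4 + real L * (\<epsilon> / (4 * (real L + 1))) \<le> \<epsilon> / 2" by linarith
    qed
    finally have lower: "(\<integral>\<^sup>+p. ennreal (?G p - ?A j p) \<partial>?N) \<le> ennreal (\<epsilon> / 2)" .
    have "(\<integral>\<^sup>+p. ennreal \<bar>?A j p - ?G p\<bar> \<partial>?N) \<le> 2 * (\<integral>\<^sup>+p. ennreal (?G p - ?A j p) \<partial>?N)"
    proof (rule nn_integral_abs_diff_le)
      show "(\<integral>\<^sup>+p. ennreal (?A j p) \<partial>?N) \<le> (\<integral>\<^sup>+p. ennreal (?G p) \<partial>?N)"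
        using nn_integral_smoothed_correlation_le[OF kernel.torus_kernel_axioms g g0, of j]
        by (simp add: torus_haar.nn_integral_fst[symmetric])
    qed (use fin g0 in \<open>auto simp: kernel.smoothing_nonneg\<close>)
    also have "\<dots> \<le> 2 * ennreal (\<epsilon> / 2)" using lower by (rule mult_left_mono) simp
    also have "\<dots> = ennreal \<epsilon>" using \<open>0 < \<epsilon>\<close> ennreal_mult[of 2 "\<epsilon> / 2"] by simp
    finally show "(\<integral>\<^sup>+p. ennreal \<bar>?A j p - ?G p\<bar> \<partial>?N) \<le> ennreal \<epsilon>" .
  qed
qed

section \<open>The difference of a measure with a density\<close>

definition torus_front :: "nat \<Rightarrow> (nat \<Rightarrow> rmodz) \<Rightarrow> nat \<Rightarrow> rmodz" where
  "torus_front n y = (\<lambda>i\<in>{..<n}. y i)"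

definition torus_back :: "nat \<Rightarrow> nat \<Rightarrow> (nat \<Rightarrow> rmodz) \<Rightarrow> nat \<Rightarrow> rmodz" where
  "torus_back n d y = (\<lambda>i\<in>{..<d}. y (n + i))"

text \<open>
  For \<open>y = (x; u', v)\<close>, with \<open>v\<close> the last \<open>d\<close> coordinates, this is \<open>g(x - v; u') g(x; u')\<close>.
\<close>

definition correlation :: "nat \<Rightarrow> nat \<Rightarrow> ((nat \<Rightarrow> rmodz) \<Rightarrow> 'a::times) \<Rightarrow> (nat \<Rightarrow> rmodz) \<Rightarrow> 'a" where
  "correlation d n g y = g (torus_shift d n (torus_front n y) (torus_back n d y)) * g (torus_front n y)"

lemma torus_front_append: "z \<in> torus n \<Longrightarrow> torus_front n (torus_append n d z v) = z"
  by (auto simp: torus_front_def torus_append_def torus_def PiE_iff extensional_def fun_eq_iff)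

lemma torus_back_append: "v \<in> torus d \<Longrightarrow> torus_back n d (torus_append n d z v) = v"
  by (auto simp: torus_back_def torus_append_def torus_def PiE_iff extensional_def fun_eq_iff)

lemma correlation_append:
  "z \<in> torus n \<Longrightarrow> v \<in> torus d \<Longrightarrow>
    correlation d n g (torus_append n d z v) = g (torus_shift d n z v) * g z"
  by (simp add: correlation_def torus_front_append torus_back_append)

lemma measurable_torus_front [measurable]: "torus_front n \<in> torus_borel (n + d) \<rightarrow>\<^sub>M torus_borel n"
  unfolding torus_front_def[abs_def]
  by (intro measurable_into_torus measurable_torus_component[of "\<lambda>y. y" _ "n + d"]) simp_all

lemma measurable_torus_back [measurable]: "torus_back n d \<in> torus_borel (n + d) \<rightarrow>\<^sub>M torus_borel d"
  unfolding torus_back_def[abs_def]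
  by (intro measurable_into_torus measurable_torus_component[of "\<lambda>y. y" _ "n + d"]) simp_all

lemma measurable_torus_shift_front_back [measurable]:
  "(\<lambda>y. torus_shift d n (torus_front n y) (torus_back n d y)) \<in> torus_borel (n + d) \<rightarrow>\<^sub>M torus_borel n"
  by (intro measurable_torus_shift measurable_torus_front measurable_torus_back)

lemma measurable_correlation [measurable]:
  fixes g :: "(nat \<Rightarrow> rmodz) \<Rightarrow> 'a::{second_countable_topology, real_normed_algebra}"
  assumes [measurable]: "g \<in> borel_measurable (torus_borel n)"
  shows "correlation d n g \<in> borel_measurable (torus_borel (n + d))"
  unfolding correlation_def[abs_def]
  by (intro borel_measurable_times measurable_compose[OF _ assms] measurable_torus_front
      measurable_torus_shift_front_back)

lemma nn_integral_correlation:
  fixes g :: "(nat \<Rightarrow> rmodz) \<Rightarrow> real"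
  assumes [measurable]: "g \<in> borel_measurable (torus_borel n)"
  shows "(\<integral>\<^sup>+y. ennreal (correlation d n g y) \<partial>torus_haar (n + d))
    = (\<integral>\<^sup>+p. ennreal (g (torus_shift d n (fst p) (snd p)) * g (fst p)) \<partial>(torus_haar n \<Otimes>\<^sub>M torus_haar d))"
proof -
  have "(\<integral>\<^sup>+y. ennreal (correlation d n g y) \<partial>torus_haar (n + d))
    = (\<integral>\<^sup>+z. \<integral>\<^sup>+v. ennreal (correlation d n g (torus_append n d z v)) \<partial>torus_haar d \<partial>torus_haar n)"
    by (rule nn_integral_torus_append) measurable
  also have "\<dots> = (\<integral>\<^sup>+z. \<integral>\<^sup>+v. ennreal (g (torus_shift d n z v) * g z) \<partial>torus_haar d \<partial>torus_haar n)"
    by (intro nn_integral_cong) (simp add: correlation_append)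
  also have "\<dots> = (\<integral>\<^sup>+p. ennreal (g (torus_shift d n (fst p) (snd p)) * g (fst p)) \<partial>(torus_haar n \<Otimes>\<^sub>M torus_haar d))"
    by (subst torus_haar.nn_integral_fst[symmetric]) simp_all
  finally show ?thesis .
qed

lemma torus_convolution_density:
  assumes "torus_kernel n \<psi>" and g: "integrable (torus_haar n) g" and g0: "\<And>z. 0 \<le> g z"
  shows "torus_convolution n \<psi> (\<lambda>A. cnj (torus_density n (\<lambda>z. complex_of_real (g z)) A)) y
    = complex_of_real (smoothing n \<psi> g y)"
proof -
  interpret torus_kernel n \<psi> by fact
  have "(\<lambda>A. cnj (torus_density n (\<lambda>z. complex_of_real (g z)) A)) = torus_density n (\<lambda>z. complex_of_real (g z))"
    by (auto simp: torus_density_def set_integral_complex_of_real)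
  moreover have "(\<lambda>w. complex_of_real (\<psi> (torus_diff n y w))) \<in> borel_measurable (torus_borel n)"
    by measurable
  ultimately show ?thesis
    unfolding torus_convolution_def smoothing_def
    by (simp add: complex_integral_torus_density[OF g g0]
         scaleR_conv_of_real mult.commute flip: of_real_mult)
qed

text \<open>
  With \<open>H\<close> the integral of \<open>g\<close> over the first block, the correlation has integral \<open>\<integral> H\<^sup>2\<close>, while \<open>g\<close> has
  integral \<open>\<integral> H\<close>; and \<open>H \<le> 1 + H\<^sup>2\<close> on a space of total mass \<open>1\<close>.
\<close>

lemma integrable_if_correlation:
  fixes g :: "(nat \<Rightarrow> rmodz) \<Rightarrow> real"
  assumes [measurable]: "g \<in> borel_measurable (torus_borel (d + r))" and g0: "\<And>z. 0 \<le> g z"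
    and int: "integrable (torus_haar (d + r + d)) (correlation d (d + r) g)"
  shows "integrable (torus_haar (d + r)) g"
proof -
  let ?h = "\<lambda>z. ennreal (g z)"
  define H where "H u = (\<integral>\<^sup>+x. ?h (torus_append d r x u) \<partial>torus_haar d)" for u
  have H [measurable]: "H \<in> borel_measurable (torus_borel r)" unfolding H_def[abs_def] by measurable
  have "(\<integral>\<^sup>+u. H u * H u \<partial>torus_haar r) = (\<integral>\<^sup>+u. H (torus_diff r u (\<lambda>_. 0)) * H u \<partial>torus_haar r)"
    by (intro nn_integral_cong) (simp add: torus_diff_zero)
  also have "\<dots> = (\<integral>\<^sup>+z. \<integral>\<^sup>+v. ?h (torus_diff (d + r) (torus_shift d (d + r) z v) (\<lambda>_. 0)) * ?h z \<partial>torus_haar d \<partial>torus_haar (d + r))"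
    using nn_integral_translated_correlation[of ?h d r "\<lambda>_. 0"] by (simp add: H_def)
  also have "\<dots> = (\<integral>\<^sup>+z. \<integral>\<^sup>+v. ennreal (g (torus_shift d (d + r) z v) * g z) \<partial>torus_haar d \<partial>torus_haar (d + r))"
    by (simp add: torus_diff_zero ennreal_mult g0)
  also have "\<dots> = (\<integral>\<^sup>+y. ennreal (correlation d (d + r) g y) \<partial>torus_haar (d + r + d))"
    unfolding nn_integral_correlation[OF assms(1)]
    by (subst torus_haar.nn_integral_fst[symmetric]) simp_all
  also have "\<dots> < \<infinity>"
    using integrableD(2)[OF int] g0 by (simp add: correlation_def less_top)
  finally have HH: "(\<integral>\<^sup>+u. H u * H u \<partial>torus_haar r) < \<infinity>" .
  have "(\<integral>\<^sup>+z. ?h z \<partial>torus_haar (d + r)) = (\<integral>\<^sup>+x. \<integral>\<^sup>+u. ?h (torus_append d r x u) \<partial>torus_haar r \<partial>torus_haar d)"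
    by (rule nn_integral_torus_append) measurable
  also have "\<dots> = (\<integral>\<^sup>+u. H u \<partial>torus_haar r)"
    unfolding H_def by (rule torus_haar_pair.Fubini'[symmetric]) measurable
  also have "\<dots> \<le> (\<integral>\<^sup>+u. 1 + H u * H u \<partial>torus_haar r)"
  proof (rule nn_integral_mono)
    fix u
    show "H u \<le> 1 + H u * H u"
    proof (cases "H u \<le> 1")
      case True then show ?thesis by (simp add: add_increasing2)
    next
      case False
      then have "1 * H u \<le> H u * H u" by (intro mult_right_mono) auto
      then show ?thesis by (simp add: add_increasing)
    qed
  qed
  also have "\<dots> = 1 + (\<integral>\<^sup>+u. H u * H u \<partial>torus_haar r)"
    by (subst nn_integral_add) simp_all
  also have "\<dots> < \<infinity>" using HH by (simp add: less_top)
  finally show ?thesis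
    using g0 by (intro integrableI_bounded) (simp_all cong: measurable_cong_sets)
qed

text \<open>
  For a density, the approximating expression is the integral of \<open>F\<close> against a smoothed correlation,
  and \<open>F\<close> is bounded because the torus is compact.
\<close>

proposition is_delta_density:
  fixes g :: "(nat \<Rightarrow> rmodz) \<Rightarrow> real"
  assumes \<phi>: "approximate_identity (d + r) \<phi>"
    and gm [measurable]: "g \<in> borel_measurable (torus_borel (d + r))" and g0: "\<And>z. 0 \<le> g z"
    and int: "integrable (torus_haar (d + r + d)) (correlation d (d + r) g)"
  defines "\<nu> \<equiv> torus_density (d + r) (\<lambda>z. complex_of_real (g z))"
  shows "is_delta d r \<phi> \<nu> \<nu> (torus_density (d + r + d) (\<lambda>y. complex_of_real (correlation d (d + r) g y)))"
  unfolding is_delta_def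
proof (intro conjI allI impI)
  let ?n = "d + r"
  let ?N = "torus_haar ?n \<Otimes>\<^sub>M torus_haar d"
  let ?T = "\<lambda>p :: (nat \<Rightarrow> rmodz) \<times> (nat \<Rightarrow> rmodz). torus_shift d ?n (fst p) (snd p)"
  let ?G = "\<lambda>p. g (?T p) * g (fst p)"
  let ?s = "\<lambda>j. smoothing ?n (\<phi> j) g"
  let ?A = "\<lambda>j p. ?s j (?T p) * g (fst p)"
  let ?c = "correlation d ?n g"
  have g: "integrable (torus_haar ?n) g" by (rule integrable_if_correlation[OF gm g0 int])
  have c0: "0 \<le> ?c y" for y by (simp add: correlation_def g0)
  have intc: "integrable (torus_leb (?n + d)) (\<lambda>y. complex_of_real (?c y))"
    unfolding torus_leb_eq by (subst integrable_completion) (simp_all add: int)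
  then show "complex_measure (torus_borel (?n + d)) (torus_density (?n + d) (\<lambda>y. complex_of_real (?c y)))"
    by (rule complex_measure_torus_density)
  have fin: "(\<integral>\<^sup>+p. ennreal (?G p) \<partial>?N) < \<infinity>"
    unfolding nn_integral_correlation[OF gm, symmetric]
    using integrableD(2)[OF int] c0 by (simp add: less_top)
  interpret kernel: torus_kernel ?n "\<phi> j" for j by (rule approximate_identity_kernel[OF \<phi>])
  have A0: "0 \<le> ?A j p" for j p by (simp add: kernel.smoothing_nonneg g0)
  have intG: "integrable ?N ?G"
    using fin g0 by (intro integrableI_bounded) simp_all
  have intA: "integrable ?N (?A j)" for j
  proof (rule integrableI_bounded)
    have "(\<integral>\<^sup>+p. ennreal (?A j p) \<partial>?N) \<le> (\<integral>\<^sup>+p. ennreal (?G p) \<partial>?N)"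
      using nn_integral_smoothed_correlation_le[OF kernel.torus_kernel_axioms g g0, of j]
      by (simp add: torus_haar.nn_integral_fst[symmetric])
    with fin show "(\<integral>\<^sup>+p. ennreal (norm (?A j p)) \<partial>?N) < \<infinity>"
      using A0[of j] by (auto simp: order.strict_trans1)
  qed measurable
  fix F :: "(nat \<Rightarrow> rmodz) \<Rightarrow> complex"
  assume F: "continuous_on (torus (?n + d)) F"
  have Fm [measurable]: "F \<in> borel_measurable (torus_borel (?n + d))"
    by (rule borel_measurable_continuous_on_torus[OF F])
  obtain B where B: "0 \<le> B" "\<And>z. z \<in> torus (?n + d) \<Longrightarrow> norm (F z) \<le> B"
    using continuous_on_torus_bounded[OF F] by blast
  let ?F = "\<lambda>p. F (torus_append ?n d (fst p) (snd p))"
  have FN: "?F \<in> borel_measurable ?N" by measurable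
  have intF: "integrable ?N (\<lambda>p. ?F p * complex_of_real (a p))" if a: "integrable ?N a" for a :: "_ \<Rightarrow> real"
  proof (rule Bochner_Integration.integrable_bound)
    show "integrable ?N (\<lambda>p. B * a p)" using a by simp
    have [measurable]: "a \<in> borel_measurable ?N" by (rule borel_measurable_integrable[OF a])
    show "(\<lambda>p. ?F p * complex_of_real (a p)) \<in> borel_measurable ?N" by measurable
    show "AE p in ?N. norm (?F p * complex_of_real (a p)) \<le> norm (B * a p)"
      using B by (intro AE_I2) (simp add: norm_mult abs_mult mult_right_mono)
  qed
  have approx: "delta_approx d r \<phi> \<nu> \<nu> F j = (LINT p|?N. ?F p * complex_of_real (?A j p))" for j
  proof -
    let ?k = "\<lambda>z v. F (torus_append ?n d z v) * complex_of_real (?s j (torus_shift d ?n z v))"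
    have inner: "(LINT v|torus_leb d. ?k z v) = (LINT v|torus_haar d. ?k z v)" if "z \<in> torus ?n" for z
    proof -
      have "(\<lambda>v. torus_append ?n d z v) \<in> torus_borel d \<rightarrow>\<^sub>M torus_borel (?n + d)"
        "(\<lambda>v. torus_shift d ?n z v) \<in> torus_borel d \<rightarrow>\<^sub>M torus_borel ?n"
        using that by (intro measurable_torus_append measurable_torus_shift measurable_const measurable_ident_sets; simp)+
      then have "(\<lambda>v. ?k z v) \<in> borel_measurable (torus_borel d)"
        by measurable
      then show ?thesis
        unfolding torus_leb_eq by (intro integral_completion) (simp cong: measurable_cong_sets)
    qed
    have "delta_approx d r \<phi> \<nu> \<nu> F j = complex_integral (torus_borel ?n) \<nu> (\<lambda>z. LINT v|torus_leb d. ?k z v)"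
      unfolding delta_approx_def \<nu>_def torus_convolution_density[OF kernel.torus_kernel_axioms g g0] ..
    also have "\<dots> = (LINT z|torus_haar ?n. g z *\<^sub>R (LINT v|torus_leb d. ?k z v))"
      unfolding \<nu>_def
    proof (rule complex_integral_torus_density[OF g g0])
      have "(\<lambda>z. LINT v|torus_haar d. ?k z v) \<in> borel_measurable (torus_borel ?n)" by measurable
      then show "(\<lambda>z. LINT v|torus_leb d. ?k z v) \<in> borel_measurable (torus_borel ?n)"
        by (subst measurable_cong[OF inner]) simp_all
    qed
    also have "\<dots> = (LINT z|torus_haar ?n. LINT v|torus_haar d. ?F (z, v) * complex_of_real (?A j (z, v)))"
      by (rule Bochner_Integration.integral_cong)
         (simp_all add: inner scaleR_conv_of_real mult_ac flip: integral_mult_right_zero)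
    also have "\<dots> = (LINT p|?N. ?F p * complex_of_real (?A j p))"
      by (rule torus_haar_pair.integral_fst'[OF intF[OF intA]])
    finally show ?thesis .
  qed
  have limit: "complex_integral (torus_borel (?n + d)) (torus_density (?n + d) (\<lambda>y. complex_of_real (?c y))) F
    = (LINT p|?N. ?F p * complex_of_real (?G p))"
  proof -
    have "complex_integral (torus_borel (?n + d)) (torus_density (?n + d) (\<lambda>y. complex_of_real (?c y))) F
      = (LINT y|torus_haar (?n + d). ?c y *\<^sub>R F y)"
      by (rule complex_integral_torus_density[OF int c0 Fm])
    also have "\<dots> = (LINT p|?N. ?c (case p of (z, v) \<Rightarrow> torus_append ?n d z v) *\<^sub>R F (case p of (z, v) \<Rightarrow> torus_append ?n d z v))"
      by (subst distr_torus_haar_append[symmetric], subst integral_distr) simp_all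
    also have "\<dots> = (LINT p|?N. ?F p * complex_of_real (?G p))"
      by (rule Bochner_Integration.integral_cong)
         (auto simp: space_pair_measure correlation_append scaleR_conv_of_real mult_ac)
    finally show ?thesis .
  qed
  have tends: "tends_L1 ?N (\<lambda>j. ?A j) ?G"
    by (rule smoothed_correlation_tends_L1[OF \<phi> g g0 fin])
  show "delta_approx d r \<phi> \<nu> \<nu> F \<longlonglongrightarrow>
    complex_integral (torus_borel (?n + d)) (torus_density (?n + d) (\<lambda>y. complex_of_real (?c y))) F"
    unfolding limit
  proof (rule metric_LIMSEQ_I)
    fix \<epsilon> :: real assume "0 < \<epsilon>"
    define \<delta> where "\<delta> = \<epsilon> / (B + 1)"
    have \<delta>: "0 < \<delta>" "B * \<delta> < \<epsilon>"
      using \<open>0 < \<epsilon>\<close> B(1) by (simp_all add: \<delta>_def field_simps add_pos_nonneg)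
    from tends \<delta>(1) obtain j0 where j0: "\<And>j. j0 \<le> j \<Longrightarrow> (\<integral>\<^sup>+p. ennreal \<bar>?A j p - ?G p\<bar> \<partial>?N) \<le> ennreal \<delta>"
      unfolding tends_L1_def eventually_sequentially by blast
    show "\<exists>j0. \<forall>j\<ge>j0. dist (delta_approx d r \<phi> \<nu> \<nu> F j) (LINT p|?N. ?F p * complex_of_real (?G p)) < \<epsilon>"
    proof (intro exI allI impI)
      fix j assume "j0 \<le> j"
      let ?D = "\<lambda>p. ?A j p - ?G p"
      have intD: "integrable ?N ?D" by (intro Bochner_Integration.integrable_diff intA intG)
      have "delta_approx d r \<phi> \<nu> \<nu> F j - (LINT p|?N. ?F p * complex_of_real (?G p))
        = (LINT p|?N. ?F p * complex_of_real (?A j p) - ?F p * complex_of_real (?G p))"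
        unfolding approx by (rule Bochner_Integration.integral_diff[symmetric]) (intro intF intA intG)+
      also have "\<dots> = (LINT p|?N. ?F p * complex_of_real (?D p))"
        by (simp only: of_real_diff right_diff_distrib)
      finally have "dist (delta_approx d r \<phi> \<nu> \<nu> F j) (LINT p|?N. ?F p * complex_of_real (?G p))
        = norm (LINT p|?N. ?F p * complex_of_real (?D p))"
        by (simp only: dist_norm)
      also have "\<dots> \<le> (LINT p|?N. norm (?F p * complex_of_real (?D p)))"
        by (rule integral_norm_bound)
      also have "\<dots> \<le> (LINT p|?N. B * \<bar>?D p\<bar>)"
        using B by (intro integral_mono integrable_norm intF intD integrable_mult_right integrable_abs)
                   (simp add: norm_mult mult_right_mono del: of_real_diff of_real_mult)
      also have "\<dots> = B * (LINT p|?N. \<bar>?D p\<bar>)" by simp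
      also have "\<dots> \<le> B * \<delta>"
      proof (rule mult_left_mono[OF _ B(1)])
        have "ennreal (LINT p|?N. \<bar>?D p\<bar>) \<le> ennreal \<delta>"
          using j0[OF \<open>j0 \<le> j\<close>] nn_integral_eq_integral[OF integrable_abs[OF intD]] by simp
        then show "(LINT p|?N. \<bar>?D p\<bar>) \<le> \<delta>" using \<delta>(1) by (simp add: ennreal_le_iff)
      qed
      also have "\<dots> < \<epsilon>" by (rule \<delta>(2))
      finally show "dist (delta_approx d r \<phi> \<nu> \<nu> F j) (LINT p|?N. ?F p * complex_of_real (?G p)) < \<epsilon>" .
    qed
  qed
qed

lemma is_delta_unique:
  assumes "is_delta d r \<phi> \<nu>0 \<nu>1 \<rho>" "is_delta d r \<phi> \<nu>0 \<nu>1 \<rho>'"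
  shows "\<rho> = \<rho>'"
  using assms unfolding is_delta_def
  by (intro complex_measure_eqI_continuous) (auto intro: LIMSEQ_unique)

lemma delta_measure_eq: "is_delta d r \<phi> \<nu>0 \<nu>1 \<rho> \<Longrightarrow> delta_measure d r \<phi> \<nu>0 \<nu>1 = \<rho>"
  unfolding delta_measure_def by (intro the_equality is_delta_unique)

lemma T_approx_tendsto:
  assumes "is_delta d r \<phi> \<nu>0 \<nu>1 \<rho>"
  shows "T_approx d r \<phi> \<nu>0 \<nu>1 \<longlonglongrightarrow> complex_integral (torus_borel (d + r + d)) \<rho> (\<lambda>_. 1)"
proof -
  have "T_approx d r \<phi> \<nu>0 \<nu>1 = delta_approx d r \<phi> \<nu>0 \<nu>1 (\<lambda>_. 1)"
    by (simp add: T_approx_def delta_approx_def fun_eq_iff)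
  with assms show ?thesis by (simp add: is_delta_def)
qed

section \<open>Gowers differences of nonnegative functions\<close>

lemma gowers_diff_cong:
  assumes "\<And>j. j < k \<Longrightarrow> u j = u' j"
  shows "gowers_diff d f k x u = gowers_diff d f k x u'"
  using assms by (induction k arbitrary: x) simp_all

text \<open>
  The recursion in terms of flat coordinates.  Dropping the last block of \<open>d\<close> coordinates and
  subtracting it from the first block turn \<open>(x; u', v)\<close> into \<open>(x; u')\<close> and \<open>(x - v; u')\<close>.
\<close>

lemma gowers_diff_flat_Suc:
  "gowers_diff_flat d f (Suc k) y =
    gowers_diff_flat d f k (torus_front (d + d * k) y)
    * cnj (gowers_diff_flat d f k (torus_shift d (d + d * k) (torus_front (d + d * k) y) (torus_back (d + d * k) d y)))"
proof -
  let ?n = "d + d * k"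
  let ?z = "torus_front ?n y" and ?v = "torus_back ?n d y"
  have less: "d * j + i < ?n" if "j \<le> k" "i < d" for i j
    using that mult_le_mono2[of j k d] by linarith
  have block: "torus_block d j ?z = torus_block d j y" if "j \<le> k" for j
    using less[OF that] by (auto simp: torus_block_def torus_front_def fun_eq_iff)
  have block_0: "torus_block d 0 (torus_shift d ?n ?z ?v) = torus_diff d (torus_block d 0 y) (torus_block d (Suc k) y)"
    by (auto simp: torus_block_def torus_shift_def torus_diff_def torus_front_def torus_back_def fun_eq_iff add.commute)
  have block_Suc: "torus_block d (Suc j) (torus_shift d ?n ?z ?v) = torus_block d (Suc j) y" if "j < k" for j
    using less[of "Suc j"] that by (auto simp: torus_block_def torus_shift_def torus_front_def fun_eq_iff)
  have "gowers_diff_flat d f k ?z = gowers_diff d f k (torus_block d 0 y) (\<lambda>j. torus_block d (Suc j) y)"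
    unfolding gowers_diff_flat_def by (simp add: block) (intro gowers_diff_cong, simp add: block)
  moreover have "gowers_diff_flat d f k (torus_shift d ?n ?z ?v)
    = gowers_diff d f k (torus_diff d (torus_block d 0 y) (torus_block d (Suc k) y)) (\<lambda>j. torus_block d (Suc j) y)"
    unfolding gowers_diff_flat_def block_0 by (intro gowers_diff_cong) (simp add: block_Suc)
  ultimately show ?thesis by (simp add: gowers_diff_flat_def)
qed

lemma gowers_diff_nonneg_real:
  assumes "\<And>x. 0 \<le> f x"
  shows "0 \<le> Re (gowers_diff d (\<lambda>x. complex_of_real (f x)) k x u) \<and>
    gowers_diff d (\<lambda>x. complex_of_real (f x)) k x u = complex_of_real (Re (gowers_diff d (\<lambda>x. complex_of_real (f x)) k x u))"
proof (induction k arbitrary: x)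
  case (Suc k)
  from Suc[of x] Suc[of "torus_diff d x (u k)"] show ?case
    by (metis (no_types, lifting) complex_cnj_complex_of_real gowers_diff.simps(2) mult_nonneg_nonneg
        of_real_mult Re_complex_of_real)
qed (simp add: assms)

definition real_gowers_diff :: "nat \<Rightarrow> ((nat \<Rightarrow> rmodz) \<Rightarrow> real) \<Rightarrow> nat \<Rightarrow> (nat \<Rightarrow> rmodz) \<Rightarrow> real" where
  "real_gowers_diff d f k y = Re (gowers_diff_flat d (\<lambda>x. complex_of_real (f x)) k y)"

lemma gowers_diff_flat_real:
  "(\<And>x. 0 \<le> f x) \<Longrightarrow>
    gowers_diff_flat d (\<lambda>x. complex_of_real (f x)) k y = complex_of_real (real_gowers_diff d f k y)"
  using gowers_diff_nonneg_real[of f] by (simp add: real_gowers_diff_def gowers_diff_flat_def)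

lemma real_gowers_diff_nonneg: "(\<And>x. 0 \<le> f x) \<Longrightarrow> 0 \<le> real_gowers_diff d f k y"
  using gowers_diff_nonneg_real[of f] by (simp add: real_gowers_diff_def gowers_diff_flat_def)

lemma real_gowers_diff_Suc:
  assumes "\<And>x. 0 \<le> f x"
  shows "real_gowers_diff d f (Suc k) = correlation d (d + d * k) (real_gowers_diff d f k)"
proof
  fix y
  have "complex_of_real (real_gowers_diff d f (Suc k) y)
    = complex_of_real (correlation d (d + d * k) (real_gowers_diff d f k) y)"
    unfolding gowers_diff_flat_real[OF assms, symmetric] gowers_diff_flat_Suc
    by (simp add: gowers_diff_flat_real[OF assms] correlation_def mult.commute)
  then show "real_gowers_diff d f (Suc k) y = correlation d (d + d * k) (real_gowers_diff d f k) y"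
    by (simp only: of_real_eq_iff)
qed

lemma torus_block_0: "z \<in> torus d \<Longrightarrow> torus_block d 0 z = z"
  by (auto simp: torus_block_def torus_def PiE_iff extensional_def fun_eq_iff)

lemma measurable_real_gowers_diff:
  assumes f0: "\<And>x. 0 \<le> f x" and f [measurable]: "f \<in> borel_measurable (torus_borel d)"
  shows "real_gowers_diff d f k \<in> borel_measurable (torus_borel (d + d * k))"
proof (induction k)
  case 0
  show ?case
    by (subst measurable_cong[where g = f])
       (simp_all add: real_gowers_diff_def gowers_diff_flat_def torus_block_0)
next
  case (Suc k)
  have "correlation d (d + d * k) (real_gowers_diff d f k) \<in> borel_measurable (torus_borel (d + d * k + d))"
    by (rule measurable_correlation[OF Suc])
  moreover have "d + d * k + d = d + d * Suc k" by simp
  ultimately show ?case by (simp only: real_gowers_diff_Suc[OF f0])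
qed

section \<open>Changes on null sets\<close>

lemma distr_torus_front: "distr (torus_haar (n + d)) (torus_borel n) (torus_front n) = torus_haar n"
proof (rule measure_eqI)
  fix A assume "A \<in> sets (distr (torus_haar (n + d)) (torus_borel n) (torus_front n))"
  then have A [measurable]: "A \<in> sets (torus_borel n)" by simp
  have "emeasure (distr (torus_haar (n + d)) (torus_borel n) (torus_front n)) A
    = (\<integral>\<^sup>+z. indicator A z \<partial>distr (torus_haar (n + d)) (torus_borel n) (torus_front n))"
    by simp
  also have "\<dots> = (\<integral>\<^sup>+y. indicator A (torus_front n y) \<partial>torus_haar (n + d))"
    by (rule nn_integral_distr) simp_all
  also have "\<dots> = (\<integral>\<^sup>+z. \<integral>\<^sup>+v. indicator A (torus_front n (torus_append n d z v)) \<partial>torus_haar d \<partial>torus_haar n)"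
    by (rule nn_integral_torus_append) measurable
  also have "\<dots> = (\<integral>\<^sup>+z. indicator A z \<partial>torus_haar n)"
    by (intro nn_integral_cong) (simp add: torus_front_append)
  finally show "emeasure (distr (torus_haar (n + d)) (torus_borel n) (torus_front n)) A = emeasure (torus_haar n) A"
    by simp
qed simp

lemma distr_torus_shift_front_back:
  "distr (torus_haar (n + d)) (torus_borel n) (\<lambda>y. torus_shift d n (torus_front n y) (torus_back n d y)) = torus_haar n"
  (is "distr ?M _ ?S = _")
proof (rule measure_eqI)
  fix A assume "A \<in> sets (distr ?M (torus_borel n) ?S)"
  then have A [measurable]: "A \<in> sets (torus_borel n)" by simp
  have "emeasure (distr ?M (torus_borel n) ?S) A = (\<integral>\<^sup>+z. indicator A z \<partial>distr ?M (torus_borel n) ?S)"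
    by simp
  also have "\<dots> = (\<integral>\<^sup>+y. indicator A (?S y) \<partial>?M)"
    by (rule nn_integral_distr) simp_all
  also have "\<dots> = (\<integral>\<^sup>+z. \<integral>\<^sup>+v. indicator A (?S (torus_append n d z v)) \<partial>torus_haar d \<partial>torus_haar n)"
    by (rule nn_integral_torus_append) measurable
  also have "\<dots> = (\<integral>\<^sup>+z. \<integral>\<^sup>+v. indicator A (torus_shift d n z v) \<partial>torus_haar d \<partial>torus_haar n)"
    by (intro nn_integral_cong) (simp add: torus_front_append torus_back_append)
  also have "\<dots> = (\<integral>\<^sup>+p. indicator A (torus_shift d n (fst p) (snd p)) \<partial>(torus_haar n \<Otimes>\<^sub>M torus_haar d))"
    by (subst torus_haar.nn_integral_fst[symmetric]) simp_all
  also have "\<dots> = (\<integral>\<^sup>+z. indicator A z \<partial>torus_haar n)"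
    by (rule nn_integral_torus_shift) measurable
  finally show "emeasure (distr ?M (torus_borel n) ?S) A = emeasure (torus_haar n) A" by simp
qed simp

text \<open>
  Both \<open>(x; u', v) \<mapsto> (x; u')\<close> and \<open>(x; u', v) \<mapsto> (x - v; u')\<close> preserve measure, so the preimages of the
  exceptional set for \<open>k\<close> are null.
\<close>

lemma gowers_diff_flat_cong_AE:
  assumes "AE x in torus_haar d. f x = f' x"
  shows "AE y in torus_haar (d + d * k). gowers_diff_flat d f k y = gowers_diff_flat d f' k y"
proof (induction k)
  case 0
  have "AE y in torus_haar d. y \<in> torus d" using AE_space[of "torus_haar d"] by simp
  with assms have "AE y in torus_haar d. gowers_diff_flat d f 0 y = gowers_diff_flat d f' 0 y"
    by eventually_elim (simp add: gowers_diff_flat_def torus_block_0)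
  moreover have "d + d * 0 = d" by simp
  ultimately show ?case by metis
next
  case (Suc k)
  let ?n = "d + d * k"
  let ?S = "\<lambda>y. torus_shift d ?n (torus_front ?n y) (torus_back ?n d y)"
  have "AE z in distr (torus_haar (?n + d)) (torus_borel ?n) (torus_front ?n).
      gowers_diff_flat d f k z = gowers_diff_flat d f' k z"
    unfolding distr_torus_front by (rule Suc.IH)
  then have "AE y in torus_haar (?n + d).
      gowers_diff_flat d f k (torus_front ?n y) = gowers_diff_flat d f' k (torus_front ?n y)"
    by (rule AE_distrD[rotated]) simp
  moreover have "AE z in distr (torus_haar (?n + d)) (torus_borel ?n) ?S.
      gowers_diff_flat d f k z = gowers_diff_flat d f' k z"
    unfolding distr_torus_shift_front_back by (rule Suc.IH)
  then have "AE y in torus_haar (?n + d). gowers_diff_flat d f k (?S y) = gowers_diff_flat d f' k (?S y)"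
    by (rule AE_distrD[rotated]) simp
  ultimately have "AE y in torus_haar (?n + d). gowers_diff_flat d f (Suc k) y = gowers_diff_flat d f' (Suc k) y"
    by eventually_elim (simp add: gowers_diff_flat_Suc)
  moreover have "?n + d = d + d * Suc k" by simp
  ultimately show ?case by metis
qed

lemma borel_measurable_completion_AE:
  fixes f g :: "'a \<Rightarrow> 'b::topological_space"
  assumes g: "g \<in> borel_measurable M" and ae: "AE x in M. f x = g x"
  shows "f \<in> borel_measurable (completion M)"
proof (rule measurableI)
  fix S :: "'b set" assume "S \<in> sets borel"
  then have sets: "g -` S \<inter> space M \<in> sets (completion M)" using g by (simp add: measurable_sets)
  have "AE x in completion M. x \<in> g -` S \<inter> space M \<longleftrightarrow> x \<in> f -` S \<inter> space M"
    using AE_completion[OF ae] by eventually_elim simp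
  from completion.in_sets_AE[OF this sets] have "f -` S \<inter> space M \<in> sets (completion M)" by simp
  then show "f -` S \<inter> space (completion M) \<in> sets (completion M)" by simp
qed simp

lemma torus_density_cong_AE:
  assumes g: "g \<in> borel_measurable (torus_borel n)" and ae: "AE z in torus_haar n. f z = g z"
  shows "torus_density n f = torus_density n g"
proof
  fix A
  have f: "f \<in> borel_measurable (torus_leb n)"
    unfolding torus_leb_eq using g ae by (intro borel_measurable_completion_AE) (simp_all cong: measurable_cong_sets)
  have g': "g \<in> borel_measurable (torus_leb n)"
    unfolding torus_leb_eq using g by (intro measurable_completion) (simp cong: measurable_cong_sets)
  have "AE z in torus_leb n. f z = g z" unfolding torus_leb_eq by (rule AE_completion[OF ae])
  then have "(LINT z:A|torus_leb n. f z) = (LINT z:A|torus_leb n. g z)" if "A \<in> sets (torus_borel n)"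
    unfolding set_lebesgue_integral_def using that f g'
    by (intro integral_cong_AE borel_measurable_scaleR borel_measurable_indicator)
       (auto simp: torus_leb_eq elim: eventually_mono)
  then show "torus_density n f A = torus_density n g A" by (simp add: torus_density_def)
qed

section \<open>Iterated differences of measures\<close>

lemma integrable_real_gowers_diff_downward:
  assumes f0: "\<And>x. 0 \<le> f x" and f: "f \<in> borel_measurable (torus_borel d)"
    and int: "integrable (torus_haar (d + d * k)) (real_gowers_diff d f k)" and "j \<le> k"
  shows "integrable (torus_haar (d + d * j)) (real_gowers_diff d f j)"
  using \<open>j \<le> k\<close>
proof (induction rule: inc_induct)
  case (step j)
  have "d + d * Suc j = d + d * j + d" by simp
  with step.IH have "integrable (torus_haar (d + d * j + d)) (correlation d (d + d * j) (real_gowers_diff d f j))"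
    by (simp only: real_gowers_diff_Suc[OF f0])
  from integrable_if_correlation[OF measurable_real_gowers_diff[OF f0 f] real_gowers_diff_nonneg[OF f0] this]
  show ?case .
qed (rule int)

lemma is_delta_real_gowers_diff:
  assumes \<phi>: "approximate_identity (d + d * j) \<phi>"
    and f0: "\<And>x. 0 \<le> f x" and f: "f \<in> borel_measurable (torus_borel d)"
    and int: "integrable (torus_haar (d + d * Suc j)) (real_gowers_diff d f (Suc j))"
  defines "\<nu> \<equiv> \<lambda>j. torus_density (d + d * j) (\<lambda>y. complex_of_real (real_gowers_diff d f j y))"
  shows "is_delta d (d * j) \<phi> (\<nu> j) (\<nu> j) (\<nu> (Suc j))"
proof -
  have eq: "d + d * Suc j = d + d * j + d" by simp
  show ?thesis
    unfolding \<nu>_def eq real_gowers_diff_Suc[OF f0]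
    by (rule is_delta_density[OF \<phi> measurable_real_gowers_diff[OF f0 f] real_gowers_diff_nonneg[OF f0]
          int[unfolded eq real_gowers_diff_Suc[OF f0]]])
qed

text \<open>
  Integrability of the top difference makes all lower ones integrable, so that each step of the
  induction is the single step for densities; uniqueness of the limit measure identifies the measure
  given by the definite description.
\<close>

lemma delta_power_real_gowers_diff:
  assumes \<phi>: "\<And>r. approximate_identity (d + r) (\<phi> r)"
    and f0: "\<And>x. 0 \<le> f x" and f: "f \<in> borel_measurable (torus_borel d)"
    and int: "integrable (torus_haar (d + d * k)) (real_gowers_diff d f k)"
    and \<mu>: "\<mu> = torus_density d (\<lambda>y. complex_of_real (real_gowers_diff d f 0 y))"
    and "j \<le> k"
  shows "delta_power_exists d \<phi> \<mu> j \<and>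
    delta_power d \<phi> \<mu> j = torus_density (d + d * j) (\<lambda>y. complex_of_real (real_gowers_diff d f j y))"
  using \<open>j \<le> k\<close>
proof (induction j)
  case 0
  have "integrable (torus_haar (d + d * 0)) (real_gowers_diff d f 0)"
    by (rule integrable_real_gowers_diff_downward[OF f0 f int]) simp_all
  then have "integrable (torus_leb d) (\<lambda>y. complex_of_real (real_gowers_diff d f 0 y))"
    unfolding torus_leb_eq by (subst integrable_completion) (simp_all add: borel_measurable_integrable)
  from complex_measure_torus_density[OF this] show ?case by (simp add: \<mu>)
next
  case (Suc j)
  have "is_delta d (d * j) (\<phi> (d * j)) (delta_power d \<phi> \<mu> j) (delta_power d \<phi> \<mu> j)
    (torus_density (d + d * Suc j) (\<lambda>y. complex_of_real (real_gowers_diff d f (Suc j) y)))"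
    using is_delta_real_gowers_diff[OF \<phi> f0 f integrable_real_gowers_diff_downward[OF f0 f int Suc.prems]]
      Suc by simp
  with Suc delta_measure_eq[OF this] show ?case by auto
qed

theorem lemma4p1:
  fixes d k :: nat
    and \<phi> :: "nat \<Rightarrow> nat \<Rightarrow> (nat \<Rightarrow> rmodz) \<Rightarrow> real"
    and f :: "(nat \<Rightarrow> rmodz) \<Rightarrow> real"
    and fc :: "(nat \<Rightarrow> rmodz) \<Rightarrow> complex"
    and \<mu> :: "(nat \<Rightarrow> rmodz) set \<Rightarrow> complex"
  assumes "d \<ge> 1"
    and "\<And>r. approximate_identity (d + r) (\<phi> r)"
    and "f \<in> borel_measurable (torus_leb d)"
    and "\<And>x. x \<in> torus d \<Longrightarrow> 0 \<le> f x"
    and "fc = (\<lambda>x. complex_of_real (f x))"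
    and "gowers_norm_fun d (k + 1) fc < \<infinity>"
    and "\<mu> = torus_density d fc"
  shows "gowers_norm_measure_Suc d \<phi> k \<mu> = gowers_norm_fun d (k + 1) fc
    \<and> delta_power_exists d \<phi> \<mu> (k + 1)
    \<and> complex_measure (torus_borel (d * (k + 2))) (delta_power d \<phi> \<mu> (k + 1))
    \<and> (\<forall>A \<in> null_sets (torus_leb (d * (k + 2))). delta_power d \<phi> \<mu> (k + 1) A = 0)
    \<and> integrable (torus_leb (d * (k + 2))) (gowers_diff_flat d fc (k + 1))
    \<and> delta_power d \<phi> \<mu> (k + 1) = torus_density (d * (k + 2)) (gowers_diff_flat d fc (k + 1))"
proof -
  let ?N = "d * (k + 2)" and ?D = "gowers_diff_flat d fc (k + 1)"
  have N: "?N = d + d * Suc k" "d * (k + 1 + 1) = ?N" "d + d * k + d = ?N" by (simp_all add: algebra_simps)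
  have int: "integrable (torus_leb ?N) ?D"
    using assms(6) by (auto simp: gowers_norm_fun_def N(2) split: if_splits)
  have norm_fun: "gowers_norm_fun d (k + 1) fc = ennreal (root (2 ^ (k + 1)) (Re (LINT y|torus_leb ?N. ?D y)))"
    using int by (simp only: gowers_norm_fun_def N(2) if_True)
  obtain f0 where f0: "f0 \<in> borel_measurable (torus_haar d)" "AE x in torus_haar d. f x = f0 x"
    using completion_ex_borel_measurable_real assms(3) unfolding torus_leb_eq by blast
  \<comment> \<open>\<open>f0\<close> is nonnegative only almost everywhere; with \<open>f'\<close> all Gowers differences are nonnegative at every point.\<close>
  define f' where "f' x = max 0 (f0 x)" for x
  have f'0: "0 \<le> f' x" for x by (simp add: f'_def)
  have f': "f' \<in> borel_measurable (torus_borel d)"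
    using f0(1) unfolding f'_def[abs_def] by (simp cong: measurable_cong_sets)
  have "AE x in torus_haar d. x \<in> torus d" using AE_space[of "torus_haar d"] by simp
  with f0(2) have ae: "AE x in torus_haar d. fc x = complex_of_real (f' x)"
  proof eventually_elim
    case (elim x)
    then show ?case using assms(4)[of x] by (simp add: assms(5) f'_def)
  qed
  let ?g = "real_gowers_diff d f'"
  have g_meas: "(\<lambda>y. complex_of_real (?g j y)) \<in> borel_measurable (torus_borel (d + d * j))" for j
    using measurable_real_gowers_diff[OF f'0 f'] by measurable
  have ae_g: "AE y in torus_haar (d + d * j). gowers_diff_flat d fc j y = complex_of_real (?g j y)" for j
    using gowers_diff_flat_cong_AE[OF ae] by (simp add: gowers_diff_flat_real[OF f'0])
  have ae_N: "AE y in torus_leb ?N. ?D y = complex_of_real (?g (Suc k) y)"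
    using AE_completion[OF ae_g[of "Suc k"]] by (simp only: N(1) torus_leb_eq Suc_eq_plus1)
  have g_leb: "(\<lambda>y. complex_of_real (?g (Suc k) y)) \<in> borel_measurable (torus_leb ?N)"
    using g_meas[of "Suc k"] unfolding torus_leb_eq N(1)
    by (intro measurable_completion) (simp cong: measurable_cong_sets)
  have D_leb: "?D \<in> borel_measurable (torus_leb ?N)" by (rule borel_measurable_integrable[OF int])
  have "integrable (torus_leb ?N) (\<lambda>y. complex_of_real (?g (Suc k) y))"
    using int integrable_cong_AE[OF D_leb g_leb ae_N] by simp
  then have "integrable (torus_haar ?N) (\<lambda>y. complex_of_real (?g (Suc k) y))"
    using g_meas[of "Suc k"] unfolding torus_leb_eq N(1)
    by (subst (asm) integrable_completion) (simp_all cong: measurable_cong_sets)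
  then have int_g: "integrable (torus_haar (d + d * Suc k)) (?g (Suc k))"
    unfolding N(1) by (simp add: complex_of_real_integrable_eq)
  have \<mu>: "\<mu> = torus_density d (\<lambda>y. complex_of_real (?g 0 y))"
  proof -
    have "AE y in torus_haar d. y \<in> torus d" using AE_space[of "torus_haar d"] by simp
    with ae have "AE y in torus_haar d. fc y = complex_of_real (?g 0 y)"
      by eventually_elim (simp add: real_gowers_diff_def gowers_diff_flat_def torus_block_0)
    with g_meas[of 0] show ?thesis
      unfolding assms(7) by (intro torus_density_cong_AE) simp_all
  qed
  note power = delta_power_real_gowers_diff[OF assms(2) f'0 f' int_g \<mu>]
  have ex: "delta_power_exists d \<phi> \<mu> j" if "j \<le> Suc k" for j using power that by blast
  have "delta_power d \<phi> \<mu> (k + 1) = torus_density ?N (\<lambda>y. complex_of_real (?g (Suc k) y))"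
    using power[of "Suc k"] by (simp only: N(1) Suc_eq_plus1 le_refl simp_thms)
  also have "\<dots> = torus_density ?N ?D"
    using g_meas[of "Suc k"] ae_g[of "Suc k"] unfolding N(1)
    by (intro torus_density_cong_AE[symmetric]) simp_all
  finally have density: "delta_power d \<phi> \<mu> (k + 1) = torus_density ?N ?D" .
  have "T_approx d (d * k) (\<phi> (d * k)) (delta_power d \<phi> \<mu> k) (delta_power d \<phi> \<mu> k)
    \<longlonglongrightarrow> complex_integral (torus_borel ?N) (torus_density ?N (\<lambda>y. complex_of_real (?g (Suc k) y))) (\<lambda>_. 1)"
  proof -
    have "is_delta d (d * k) (\<phi> (d * k)) (delta_power d \<phi> \<mu> k) (delta_power d \<phi> \<mu> k)
      (torus_density ?N (\<lambda>y. complex_of_real (?g (Suc k) y)))"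
      using is_delta_real_gowers_diff[OF assms(2) f'0 f' int_g] power[of k] by (simp add: N(1))
    from T_approx_tendsto[OF this] show ?thesis by (simp only: N(3))
  qed
  moreover have "complex_integral (torus_borel ?N) (torus_density ?N (\<lambda>y. complex_of_real (?g (Suc k) y))) (\<lambda>_. 1)
    = (LINT y|torus_leb ?N. ?D y)"
  proof -
    have "complex_integral (torus_borel ?N) (torus_density ?N (\<lambda>y. complex_of_real (?g (Suc k) y))) (\<lambda>_. 1)
      = (LINT y|torus_haar ?N. ?g (Suc k) y *\<^sub>R 1)"
      unfolding N(1) using int_g real_gowers_diff_nonneg[OF f'0] by (intro complex_integral_torus_density) simp_all
    also have "\<dots> = (LINT y|torus_haar ?N. complex_of_real (?g (Suc k) y))"
      by (simp add: scaleR_conv_of_real)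
    also have "\<dots> = (LINT y|torus_leb ?N. complex_of_real (?g (Suc k) y))"
      unfolding torus_leb_eq N(1) using g_meas[of "Suc k"]
      by (intro integral_completion[symmetric]) (simp cong: measurable_cong_sets)
    also have "\<dots> = (LINT y|torus_leb ?N. ?D y)"
      by (rule integral_cong_AE[OF D_leb g_leb ae_N, symmetric])
    finally show ?thesis .
  qed
  ultimately have T: "T_approx d (d * k) (\<phi> (d * k)) (delta_power d \<phi> \<mu> k) (delta_power d \<phi> \<mu> k)
    \<longlonglongrightarrow> (LINT y|torus_leb ?N. ?D y)" by (simp only:)
  have norm_measure: "gowers_norm_measure_Suc d \<phi> k \<mu> = gowers_norm_fun d (k + 1) fc"
    unfolding norm_fun gowers_norm_measure_Suc_def Let_def
    using ex[of k] convergentI[OF T] limI[OF T] by simp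
  have null: "torus_density ?N ?D A = 0" if "A \<in> null_sets (torus_leb ?N)" for A
  proof -
    have "AE y in torus_leb ?N. y \<notin> A" by (rule AE_not_in[OF that])
    then have "(LINT y:A|torus_leb ?N. ?D y) = 0"
      unfolding set_lebesgue_integral_def
      by (intro integral_eq_zero_AE) (auto elim: eventually_mono)
    then show ?thesis by (simp add: torus_density_def)
  qed
  show ?thesis
    using norm_measure ex[of "k + 1"] complex_measure_torus_density[OF int] null int density by simp
qed

end
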